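(* Assume that $X$ is a Banach space not containing an isomorphic copy of $\ell^1$. Then $B_1(X)=C(X)$, and hence for any set $A\subset X^*$ we have $$\text{(I)-env}(A)=\overline{\operatorname{conv} A}^{\sigma(X^*,B_1(X))}.$$
   Context: Banach spaces are real or complex. For a Banach space $X$ and $A\subset X^*$, the (I)-envelope of $A$ is $$\text{(I)-env}(A)= \bigcap\left\{\overline{\operatorname{conv}\bigcup_{n=1}^\infty \overline{\operatorname{conv} A_n}^{w^*}}^{\|\cdot\|} : A=\bigcup_{n=1}^\infty A_n\right\},$$ the intersection being over all countable covers $A=\bigcup_n A_n$ by subsets of $A$. Here $\operatorname{conv}$ is the convex hull. Further, $B_1(X)=\{x^{**}\in X^{**} : \text{there is a sequence } (x_n) \text{ in } X \text{ with } x_n\to x^{**} \text{ in the weak}^*\text{ topology of } X^{**}\}$ and $C(X)=\{x^{**}\in X^{**} : \text{there is a countable } C\subset X \text{ with } x^{**}\in\overline{C}^{w^*}\}$. For a linear subspace $Z\subset X^{**}$, $\sigma(X^*,Z)$ is the weakest topology on $X^*$ making all elements of $Z$ continuous. $\overline{A}^{\tau}$ denotes the closure of $A$ in the topology $\tau$. *)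

theory Defs
  imports "HOL-Analysis.Analysis"
begin

text \<open>The scalar fields: a type of this class is isometrically isomorphic, as a normed real
  algebra, to \<open>real\<close> or to \<open>complex\<close>. Both are instances.\<close>

class real_or_complex = real_normed_field +
  assumes iso_real_or_complex:
    "(\<exists>h :: 'a \<Rightarrow> real. bij h \<and> (\<forall>x y. h (x + y) = h x + h y) \<and> (\<forall>x y. h (x * y) = h x * h y) \<and>
        (\<forall>r x. h (r *\<^sub>R x) = r *\<^sub>R h x) \<and> (\<forall>x. norm (h x) = norm x)) \<or>
     (\<exists>h :: 'a \<Rightarrow> complex. bij h \<and> (\<forall>x y. h (x + y) = h x + h y) \<and> (\<forall>x y. h (x * y) = h x * h y) \<and>
        (\<forall>r x. h (r *\<^sub>R x) = r *\<^sub>R h x) \<and> (\<forall>x. norm (h x) = norm x))"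

instance real :: real_or_complex
  by standard (rule disjI1, rule exI[of _ "\<lambda>x. x"], auto simp: bij_def inj_def surj_def)

instance complex :: real_or_complex
  by standard (rule disjI2, rule exI[of _ "\<lambda>x. x"], auto simp: bij_def inj_def surj_def)

text \<open>A Banach space over \<open>'k\<close> is a type \<open>'a::banach\<close> with a scalar multiplication by \<open>'k\<close>
  extending the real one. For \<open>'k = real\<close> this forces \<open>smul = scaleR\<close>.\<close>

locale banach_space_over = vector_space smul
  for smul :: "'k::real_or_complex \<Rightarrow> 'a::banach \<Rightarrow> 'a" +
  assumes smul_of_real: "smul (of_real r) x = r *\<^sub>R x"
    and norm_smul: "norm (smul c x) = norm c * norm x"

definition ell1 :: "(nat \<Rightarrow> 'k::real_or_complex) set" where
  "ell1 = {a. summable (\<lambda>n. norm (a n))}"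

definition ell1_norm :: "(nat \<Rightarrow> 'k::real_or_complex) \<Rightarrow> real" where
  "ell1_norm a = (\<Sum>n. norm (a n))"

definition contains_ell1 :: "('k::real_or_complex \<Rightarrow> 'a::banach \<Rightarrow> 'a) \<Rightarrow> bool" where
  "contains_ell1 smul \<longleftrightarrow>
    (\<exists>T :: (nat \<Rightarrow> 'k) \<Rightarrow> 'a.
      (\<forall>a\<in>ell1. \<forall>b\<in>ell1. T (\<lambda>n. a n + b n) = T a + T b) \<and>
      (\<forall>c. \<forall>a\<in>ell1. T (\<lambda>n. c * a n) = smul c (T a)) \<and>
      (\<exists>m>0. \<exists>M. \<forall>a\<in>ell1. m * ell1_norm a \<le> norm (T a) \<and> norm (T a) \<le> M * ell1_norm a))"

text \<open>The dual consists of the \<open>'k\<close>-linear elements of the type of bounded real-linear maps;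
  the norm of that type restricts to the dual norm.\<close>

definition dual :: "('k::real_or_complex \<Rightarrow> 'a::banach \<Rightarrow> 'a) \<Rightarrow> ('a \<Rightarrow>\<^sub>L 'k) set" where
  "dual smul = {f. \<forall>c x. blinfun_apply f (smul c x) = c * blinfun_apply f x}"

text \<open>Elements of the bidual are functions on the set \<open>dual smul\<close>, hence \<open>extensional\<close>;
  \<open>blinfun_mult_right c o\<^sub>L f\<close> is the functional \<open>\<lambda>x. c * f x\<close>.\<close>

definition bidual :: "('k::real_or_complex \<Rightarrow> 'a::banach \<Rightarrow> 'a) \<Rightarrow> (('a \<Rightarrow>\<^sub>L 'k) \<Rightarrow> 'k) set" where
  "bidual smul = {\<phi> \<in> extensional (dual smul).
     (\<forall>f\<in>dual smul. \<forall>g\<in>dual smul. \<phi> (f + g) = \<phi> f + \<phi> g) \<and>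
     (\<forall>c. \<forall>f\<in>dual smul. \<phi> (blinfun_mult_right c o\<^sub>L f) = c * \<phi> f) \<and>
     (\<exists>B. \<forall>f\<in>dual smul. norm (\<phi> f) \<le> B * norm f)}"

definition canonical_embedding ::
    "('k::real_or_complex \<Rightarrow> 'a::banach \<Rightarrow> 'a) \<Rightarrow> 'a \<Rightarrow> ('a \<Rightarrow>\<^sub>L 'k) \<Rightarrow> 'k" where
  "canonical_embedding smul x = (\<lambda>f\<in>dual smul. blinfun_apply f x)"

text \<open>The weakest topology on \<open>E\<close> making all elements of \<open>Z\<close> continuous. Inserting \<open>E\<close> makes \<open>E\<close>
  the underlying set even for empty \<open>Z\<close>.\<close>

definition weak_topology :: "'e set \<Rightarrow> ('e \<Rightarrow> 'k::topological_space) set \<Rightarrow> 'e topology" where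
  "weak_topology E Z =
     topology_generated_by (insert E {{x\<in>E. \<phi> x \<in> U} | \<phi> U. \<phi> \<in> Z \<and> open U})"

definition weak_star_dual ::
    "('k::real_or_complex \<Rightarrow> 'a::banach \<Rightarrow> 'a) \<Rightarrow> ('a \<Rightarrow>\<^sub>L 'k) topology" where
  "weak_star_dual smul = weak_topology (dual smul) (range (canonical_embedding smul))"

definition weak_star_bidual ::
    "('k::real_or_complex \<Rightarrow> 'a::banach \<Rightarrow> 'a) \<Rightarrow> (('a \<Rightarrow>\<^sub>L 'k) \<Rightarrow> 'k) topology" where
  "weak_star_bidual smul = weak_topology (bidual smul) ((\<lambda>f \<phi>. \<phi> f) ` dual smul)"

definition B1 :: "('k::real_or_complex \<Rightarrow> 'a::banach \<Rightarrow> 'a) \<Rightarrow> (('a \<Rightarrow>\<^sub>L 'k) \<Rightarrow> 'k) set" where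
  "B1 smul = {\<phi> \<in> bidual smul. \<exists>x :: nat \<Rightarrow> 'a.
     limitin (weak_star_bidual smul) (\<lambda>n. canonical_embedding smul (x n)) \<phi> sequentially}"

definition countable_closure_points ::
    "('k::real_or_complex \<Rightarrow> 'a::banach \<Rightarrow> 'a) \<Rightarrow> (('a \<Rightarrow>\<^sub>L 'k) \<Rightarrow> 'k) set" where
  "countable_closure_points smul = {\<phi> \<in> bidual smul. \<exists>C :: 'a set. countable C \<and>
     \<phi> \<in> weak_star_bidual smul closure_of (canonical_embedding smul ` C)}"

text \<open>The outer \<open>closure\<close> is taken in the type of bounded real-linear maps, where the dual is
  norm closed, so it is the norm closure in the dual.\<close>

definition I_env ::
    "('k::real_or_complex \<Rightarrow> 'a::banach \<Rightarrow> 'a) \<Rightarrow> ('a \<Rightarrow>\<^sub>L 'k) set \<Rightarrow> ('a \<Rightarrow>\<^sub>L 'k) set" where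
  "I_env smul A = \<Inter> {closure (convex hull (\<Union>n. weak_star_dual smul closure_of (convex hull (F n)))) |
      F :: nat \<Rightarrow> ('a \<Rightarrow>\<^sub>L 'k) set. A = (\<Union>n. F n)}"

end

theory Submission
  imports Defs
begin

text \<open>
  Let \<open>\<phi>\<close> lie in the weak* closure of a countable set \<open>C\<close>. By Goldstine's argument it lies in the closure
  of a bounded convex set \<open>D\<close> in the span of \<open>C\<close>. A minimax argument shows that elements of \<open>D\<close> satisfy,
  up to an arbitrarily small error, any finite number of upper bounds that \<open>\<phi>\<close> satisfies on weak* compact
  convex sets. Hence \<open>\<phi>\<close> is the limit of a sequence in \<open>D\<close> as soon as, for every \<open>\<epsilon> > 0\<close>, the dual unit ball is
  a countable union of weak* compact convex sets on which \<open>\<phi>\<close> oscillates by at most \<open>\<epsilon>\<close>. If this fails for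
  some \<open>\<epsilon>\<close>, a derivation argument leaves a nonempty set \<open>R\<close> such that \<open>\<phi>\<close> oscillates by more than \<open>\<epsilon>\<close>
  on the closed convex hull of every nonempty relatively open subset of \<open>R\<close>, and Rosenthal's construction
  of an independent sequence yields a copy of \<open>\<ell>\<^sup>1\<close>. For complex scalars the values of the independent
  sequence must be located near two points of the plane and not merely in two half planes; these are
  chosen as a diametral pair of the set of values that \<open>\<phi>\<close> attains on all of these hulls.

  For the envelope: a point outside the closure of \<open>conv A\<close> is separated from \<open>A\<close> by some \<open>\<phi> = lim x\<^sub>n\<close>, and the
  sets of all \<open>a \<in> A\<close> on which the \<open>x\<^sub>m\<close> with \<open>m \<ge> n\<close> separate form a cover showing that it is outside the
  envelope. Conversely, if a cover excludes \<open>x\<close>, finitely many of its bounded pieces are separated from \<open>x\<close>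
  by some \<open>x\<^sub>n\<close> in the unit ball, and a weak* cluster point of \<open>(x\<^sub>n)\<close> separates \<open>x\<close> from \<open>conv A\<close>.
\<close>

section \<open>Alternatives for convex functions and the Hahn--Banach theorem\<close>

text \<open>Three obstacles shape the argument. The space need not be separable, so its dual ball
  need not be second countable in the weak* topology. Openness is therefore measured only by the
  values at a countable set that approximates \<open>D\<close> in norm and is stable under
  \<open>J\<close>; there Lindelof's theorem removes all coverable parts in one step. Minimax needs
  compact convex pieces, so oscillation is measured on hulls, whose points need not belong to the
  set itself. Only a single half-plane condition at one vector descends from a hull point to a point
  of the set; every other condition has to hold on the whole hull. For a diametral pair it does: all
  values lie within about the diameter of both points, and one more half plane then pins a value
  down. In the envelope, an outer norm closure meets inner weak* closures. One inclusion absorbs the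
  norm closure by Lipschitz bounds uniform along the sequences; the other turns norm distance into
  separation by vectors of the unit ball.\<close>

lemma convexlike_alternative_two:
  fixes f g :: "'a \<Rightarrow> real"
  assumes mix: "\<And>x y t. x \<in> D \<Longrightarrow> y \<in> D \<Longrightarrow> 0 \<le> t \<Longrightarrow> t \<le> 1 \<Longrightarrow>
      \<exists>z\<in>D. f z \<le> (1 - t) * f x + t * f y \<and> g z \<le> (1 - t) * g x + t * g y"
    and alt: "\<And>x. x \<in> D \<Longrightarrow> 0 \<le> f x \<or> 0 \<le> g x"
  shows "\<exists>t. 0 \<le> t \<and> t \<le> 1 \<and> (\<forall>x\<in>D. 0 \<le> (1 - t) * f x + t * g x)"
proof -
  \<comment> \<open>Where \<open>f x < 0\<close>, a weight \<open>t\<close> is admissible iff it is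
    at least the quotient in \<open>L\<close>; where \<open>g z < 0\<close>, iff it is at most
    \<open>f z / (f z - g z)\<close>. So \<open>cross\<close> makes the supremum of \<open>L\<close>
    admissible. The inserted 0 keeps \<open>L\<close> nonempty and \<open>t\<close>
    nonnegative.\<close>
  define L where "L = insert 0 {- f x / (g x - f x) | x. x \<in> D \<and> f x < 0}"
  have cross: "- f x / (g x - f x) \<le> f z / (f z - g z)"
    if x: "x \<in> D" "f x < 0" and z: "z \<in> D" "g z < 0" for x z
  proof (rule ccontr)
    have gx: "0 \<le> g x" and fz: "0 \<le> f z"
      using alt[OF x(1)] alt[OF z(1)] x z by auto
    \<comment> \<open>These weights make both functions negative at the convex combination of \<open>x\<close> and \<open>z\<close>.\<close>
    define p q where "p = f z - g z" and "q = g x - f x"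
    have pos: "p > 0" "q > 0"
      unfolding p_def q_def using x z gx fz by auto
    assume "\<not> ?thesis"
    then have "f z / p < - f x / q"
      by (simp add: p_def q_def)
    then have "f z * q < - f x * p"
      using pos by (simp add: field_simps)
    then have neg: "p * f x + q * f z < 0" "p * g x + q * g z < 0"
      unfolding p_def q_def by (auto simp: algebra_simps)
    define t where "t = q / (p + q)"
    have t: "0 \<le> t" "t \<le> 1" "1 - t = p / (p + q)"
      unfolding t_def using pos by (auto simp: field_simps)
    obtain w where w: "w \<in> D" "f w \<le> (1 - t) * f x + t * f z" "g w \<le> (1 - t) * g x + t * g z"
      using mix[OF x(1) z(1) t(1,2)] by blast
    have "(1 - t) * f x + t * f z = (p * f x + q * f z) / (p + q)"
      "(1 - t) * g x + t * g z = (p * g x + q * g z) / (p + q)"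
      by (subst t(3), subst t_def, simp add: add_divide_distrib)+
    moreover have "(p * f x + q * f z) / (p + q) < 0" "(p * g x + q * g z) / (p + q) < 0"
      using neg pos by (auto simp: divide_neg_pos)
    ultimately show False
      using alt[OF w(1)] w by linarith
  qed
  have le1: "l \<le> 1" if l: "l \<in> L" for l
  proof (cases "l = 0")
    case False
    then obtain x where x: "x \<in> D" "f x < 0" "l = - f x / (g x - f x)"
      using l False unfolding L_def by blast
    then have "0 < g x - f x" "- f x \<le> g x - f x" using alt[OF x(1)] by auto
    then show ?thesis unfolding x(3) by (simp only: pos_divide_le_eq mult_1)
  qed simp
  have bdd: "bdd_above L"
    using le1 by (auto intro!: bdd_aboveI)
  define t where "t = Sup L"
  have ub: "l \<le> t" if "l \<in> L" for l
    unfolding t_def using bdd that by (rule cSup_upper[rotated])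
  have t01: "0 \<le> t" "t \<le> 1"
    using ub[of 0] le1 by (auto simp: L_def t_def intro!: cSup_least)
  have "0 \<le> (1 - t) * f x + t * g x" if x: "x \<in> D" for x
  proof (cases "f x < 0")
    case True
    then have gx: "0 \<le> g x" using alt[OF x] by auto
    have "- f x / (g x - f x) \<le> t"
      by (rule ub) (use x True in \<open>auto simp: L_def\<close>)
    then show ?thesis
      using gx True by (simp add: field_simps)
  next
    case nf: False
    show ?thesis
    proof (cases "g x < 0")
      case True
      have "t \<le> f x / (f x - g x)"
        unfolding t_def
      proof (rule cSup_least)
        fix l assume "l \<in> L"
        then show "l \<le> f x / (f x - g x)"
          using cross[OF _ _ x True] nf True unfolding L_def by auto
      qed (simp add: L_def)
      then show ?thesis
        using nf True by (simp add: field_simps)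
    next
      case False
      then show ?thesis using nf t01 by simp
    qed
  qed
  then show ?thesis using t01 by blast
qed

text \<open>Ky Fan's form of Gordan's alternative. Where \<open>f j\<close> is negative, the
  remaining functions satisfy the hypothesis by themselves, which is why \<open>D\<close> varies in
  the induction; their combination is then weighed against \<open>f j\<close> by the case of two
  functions.\<close>

lemma convexlike_alternative:
  fixes f :: "'i \<Rightarrow> 'a \<Rightarrow> real"
  assumes "finite I" "I \<noteq> {}"
    and "\<And>x y t. x \<in> D \<Longrightarrow> y \<in> D \<Longrightarrow> 0 \<le> t \<Longrightarrow> t \<le> 1 \<Longrightarrow>
      \<exists>z\<in>D. \<forall>i\<in>I. f i z \<le> (1 - t) * f i x + t * f i y"
    and "\<And>x. x \<in> D \<Longrightarrow> \<exists>i\<in>I. 0 \<le> f i x"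
  shows "\<exists>l. (\<forall>i\<in>I. 0 \<le> l i) \<and> sum l I = 1 \<and> (\<forall>x\<in>D. 0 \<le> (\<Sum>i\<in>I. l i * f i x))"
  using assms
proof (induction I arbitrary: D rule: finite_ne_induct)
  case (singleton i)
  then show ?case by (intro exI[of _ "\<lambda>_. 1"]) auto
next
  case (insert j I)
  define D' where "D' = {x \<in> D. f j x < 0}"
  have "\<exists>l. (\<forall>i\<in>I. 0 \<le> l i) \<and> sum l I = 1 \<and> (\<forall>x\<in>D'. 0 \<le> (\<Sum>i\<in>I. l i * f i x))"
  proof (rule insert.IH)
    fix x y t :: _ assume xy: "x \<in> D'" "y \<in> D'" and t: "0 \<le> (t::real)" "t \<le> 1"
    obtain z where z: "z \<in> D" "\<forall>i\<in>insert j I. f i z \<le> (1 - t) * f i x + t * f i y"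
      using insert.prems(1)[OF _ _ t] xy unfolding D'_def by blast
    have "(1 - t) * f j x + t * f j y < 0"
    proof (cases "t = 0")
      case False
      then have "t * f j y < 0" "(1 - t) * f j x \<le> 0"
        using xy t by (auto simp: D'_def mult_pos_neg mult_nonneg_nonpos)
      then show ?thesis by linarith
    qed (use xy in \<open>auto simp: D'_def\<close>)
    then have "f j z < 0" using z by force
    then show "\<exists>z\<in>D'. \<forall>i\<in>I. f i z \<le> (1 - t) * f i x + t * f i y"
      using z by (auto simp: D'_def)
  next
    fix x assume "x \<in> D'"
    then show "\<exists>i\<in>I. 0 \<le> f i x"
      using insert.prems(2)[of x] by (auto simp: D'_def)
  qed
  then obtain l where l: "\<And>i. i \<in> I \<Longrightarrow> 0 \<le> l i" "sum l I = 1"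
    "\<And>x. x \<in> D' \<Longrightarrow> 0 \<le> (\<Sum>i\<in>I. l i * f i x)" by blast
  define g where "g x = (\<Sum>i\<in>I. l i * f i x)" for x
  have "\<exists>t. 0 \<le> t \<and> t \<le> 1 \<and> (\<forall>x\<in>D. 0 \<le> (1 - t) * f j x + t * g x)"
  proof (rule convexlike_alternative_two)
    fix x y t assume xy: "x \<in> D" "y \<in> D" and t: "0 \<le> (t::real)" "t \<le> 1"
    obtain z where z: "z \<in> D" "\<forall>i\<in>insert j I. f i z \<le> (1 - t) * f i x + t * f i y"
      using insert.prems(1)[OF xy t] by blast
    have "g z \<le> (\<Sum>i\<in>I. l i * ((1 - t) * f i x + t * f i y))"
      unfolding g_def using z l by (intro sum_mono mult_left_mono) auto
    also have "\<dots> = (\<Sum>i\<in>I. (1 - t) * (l i * f i x) + t * (l i * f i y))"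
      by (intro sum.cong) (auto simp: algebra_simps)
    also have "\<dots> = (1 - t) * g x + t * g y"
      unfolding g_def by (simp add: sum_distrib_left sum.distrib)
    finally show "\<exists>z\<in>D. f j z \<le> (1 - t) * f j x + t * f j y \<and> g z \<le> (1 - t) * g x + t * g y"
      using z by blast
  next
    fix x assume "x \<in> D"
    then show "0 \<le> f j x \<or> 0 \<le> g x"
      using l(3)[of x] unfolding D'_def g_def by force
  qed
  then obtain t where t: "0 \<le> t" "t \<le> 1" "\<And>x. x \<in> D \<Longrightarrow> 0 \<le> (1 - t) * f j x + t * g x"
    by blast
  define l' where "l' i = (if i = j then 1 - t else t * l i)" for i
  have l'I: "(\<Sum>i\<in>I. l' i * h i) = t * (\<Sum>i\<in>I. l i * h i)" for h
    unfolding sum_distrib_left using insert.hyps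
    by (intro sum.cong) (auto simp: l'_def)
  have "sum l' I = t"
    using l'I[of "\<lambda>_. 1"] l(2) by simp
  then show ?case
    using t l insert.hyps l'I
    by (intro exI[of _ l']) (auto simp: l'_def g_def)
qed

section \<open>The Hahn--Banach theorem\<close>

text \<open>A minimal sublinear functional is linear, because lowering it along any ray produces a
  sublinear functional again. Zorn's lemma supplies a minimal one below \<open>q\<close>.\<close>

lemma sublinear_dominates_linear:
  fixes q :: "'a::real_vector \<Rightarrow> real"
  assumes sub: "\<And>x y. q (x + y) \<le> q x + q y"
    and hom: "\<And>c x. 0 \<le> c \<Longrightarrow> q (c *\<^sub>R x) = c * q x"
  shows "\<exists>g. linear g \<and> (\<forall>x. g x \<le> q x)"
proof -
  define A where "A = {p::'a \<Rightarrow> real. (\<forall>x y. p (x + y) \<le> p x + p y) \<and>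
     (\<forall>c x. 0 \<le> c \<longrightarrow> p (c *\<^sub>R x) = c * p x) \<and> (\<forall>x. p x \<le> q x)}"
  have qA: "q \<in> A" unfolding A_def using assms by auto
  \<comment> \<open>This bound is common to all candidates and keeps the pointwise infimum of a
    chain finite.\<close>
  have lower: "- q (- x) \<le> p x" if "p \<in> A" for p x
  proof -
    have "p (0 *\<^sub>R x) = 0" using that unfolding A_def by fastforce
    then have "0 \<le> p x + p (- x)"
      using that unfolding A_def by (metis (mono_tags, lifting) mem_Collect_eq add.right_inverse scaleR_zero_left)
    moreover have "p (- x) \<le> q (- x)" using that unfolding A_def by auto
    ultimately show ?thesis by linarith
  qed
  have "\<exists>m\<in>A. \<forall>a\<in>A. (\<lambda>f g. \<forall>x. g x \<le> f x) m a \<longrightarrow> a = m"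
  proof (rule predicate_Zorn)
    show "partial_order_on A (relation_of (\<lambda>f g. \<forall>x. g x \<le> f x) A)"
      by (rule partial_order_on_relation_ofI) (auto intro: order.trans intro!: ext order.antisym)
  next
    fix C assume C: "C \<in> Chains (relation_of (\<lambda>f g. \<forall>x. g x \<le> f x) A)"
    then have CA: "C \<subseteq> A" by (simp add: Chains_relation_of)
    have chain: "(\<forall>x. f x \<le> g x) \<or> (\<forall>x. g x \<le> f x)" if "f \<in> C" "g \<in> C" for f g
      using C that unfolding Chains_def relation_of_def by auto
    show "\<exists>u\<in>A. \<forall>a\<in>C. \<forall>x. u x \<le> a x"
    proof (cases "C = {}")
      case True
      then show ?thesis using qA by auto
    next
      case False
      define u where "u x = (INF p\<in>C. p x)" for x
      have bdd: "bdd_below ((\<lambda>p. p x) ` C)" for x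
        using lower CA by (intro bdd_belowI2[of _ "- q (- x)"]) auto
      have ule: "u x \<le> p x" if "p \<in> C" for p x
        unfolding u_def using bdd that by (rule cINF_lower)
      have uge: "b \<le> u x" if "\<And>p. p \<in> C \<Longrightarrow> b \<le> p x" for b x
        unfolding u_def using False that by (rule cINF_greatest)
      have "u \<in> A"
        unfolding A_def
      proof (safe)
        fix x y
        have *: "u (x + y) \<le> p x + p' y" if pp': "p \<in> C" "p' \<in> C" for p p'
          using chain[OF pp']
        proof
          assume "\<forall>x. p x \<le> p' x"
          moreover have "p (x + y) \<le> p x + p y" using pp' CA unfolding A_def by auto
          ultimately show ?thesis using ule[OF pp'(1), of "x + y"]
            by (smt (verit))
        next
          assume "\<forall>x. p' x \<le> p x"
          moreover have "p' (x + y) \<le> p' x + p' y" using pp' CA unfolding A_def by auto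
          ultimately show ?thesis using ule[OF pp'(2), of "x + y"]
            by (smt (verit))
        qed
        have "u (x + y) - p x \<le> u y" if "p \<in> C" for p
          using *[OF that] by (intro uge) (auto simp: algebra_simps)
        then have "u (x + y) - u y \<le> u x"
          by (intro uge) (auto simp: algebra_simps)
        then show "u (x + y) \<le> u x + u y" by simp
      next
        fix c :: real and x assume c: "0 \<le> c"
        show "u (c *\<^sub>R x) = c * u x"
        proof (cases "c = 0")
          case True
          have "(\<lambda>p. p (0 *\<^sub>R x)) ` C = {0}"
            using False CA unfolding A_def by fastforce
          then show ?thesis unfolding u_def True by simp
        next
          case c0: False
          have "u (c *\<^sub>R x) / c \<le> u x"
          proof (rule uge)
            fix p assume p: "p \<in> C"
            then have "p (c *\<^sub>R x) = c * p x" using CA c unfolding A_def by auto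
            then show "u (c *\<^sub>R x) / c \<le> p x"
              using ule[OF p, of "c *\<^sub>R x"] c c0 by (simp add: field_simps)
          qed
          moreover have "c * u x \<le> u (c *\<^sub>R x)"
          proof (rule uge)
            fix p assume p: "p \<in> C"
            then have "p (c *\<^sub>R x) = c * p x" using CA c unfolding A_def by auto
            then show "c * u x \<le> p (c *\<^sub>R x)"
              using ule[OF p, of "x"] c by (simp add: mult_left_mono)
          qed
          ultimately show ?thesis using c c0 by (simp add: field_simps)
        qed
      next
        fix x
        obtain p where "p \<in> C" using False by blast
        moreover from this have "p x \<le> q x" using CA unfolding A_def by auto
        ultimately show "u x \<le> q x" using ule[of p x] by linarith
      qed
      then show ?thesis using ule by blast
    qed
  qed
  then obtain m where m: "m \<in> A" and min: "\<And>p. p \<in> A \<Longrightarrow> (\<And>x. p x \<le> m x) \<Longrightarrow> p = m"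
    by blast
  have msub: "m (x + y) \<le> m x + m y" and mhom: "0 \<le> c \<Longrightarrow> m (c *\<^sub>R x) = c * m x"
    and mq: "m x \<le> q x" for x y c
    using m unfolding A_def by auto
  have m0: "m 0 = 0" using mhom[of 0 0] by simp
  have sup: "m x + m y \<le> m (x + y)" for x y
  proof -
    \<comment> \<open>At \<open>t = 0\<close> the infimum is at most \<open>m x\<close>, so
      minimality forces \<open>p = m\<close>; comparing with \<open>t = 1\<close> is then
      superadditivity.\<close>
    define P where "P x = {m (x + t *\<^sub>R y) - t * m y | t. 0 \<le> t}" for x
    define p where "p x = Inf (P x)" for x
    have lb: "- m (- x) \<le> s" if s: "s \<in> P x" for s x
    proof -
      obtain t where t: "0 \<le> t" "s = m (x + t *\<^sub>R y) - t * m y" using s unfolding P_def by blast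
      show ?thesis
        using msub[of "x + t *\<^sub>R y" "- x"] mhom[OF t(1), of y] t by simp
    qed
    have bdd: "bdd_below (P x)" for x by (rule bdd_belowI[of _ "- m (- x)"]) (rule lb)
    have ple: "p x \<le> m (x + t *\<^sub>R y) - t * m y" if "0 \<le> t" for x t
      unfolding p_def using bdd that by (intro cInf_lower) (auto simp: P_def)
    have pge: "b \<le> p x" if "\<And>t. 0 \<le> t \<Longrightarrow> b \<le> m (x + t *\<^sub>R y) - t * m y" for b x
      unfolding p_def
      by (intro cInf_greatest) (use that order.refl[of "0::real"] in \<open>auto simp: P_def\<close>)
    have pm: "p x \<le> m x" for x using ple[of 0 x] by simp
    have "p \<in> A"
      unfolding A_def
    proof safe
      fix a b
      have *: "p (a + b) \<le> (m (a + s *\<^sub>R y) - s * m y) + (m (b + t *\<^sub>R y) - t * m y)"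
        if "0 \<le> s" "0 \<le> t" for s t
        using ple[of "s + t" "a + b"] msub[of "a + s *\<^sub>R y" "b + t *\<^sub>R y"] that
        by (simp add: algebra_simps)
      have "p (a + b) - (m (a + s *\<^sub>R y) - s * m y) \<le> p b" if s: "0 \<le> s" for s
      proof (rule pge)
        fix t :: real assume "0 \<le> t"
        from *[OF s this] show "p (a + b) - (m (a + s *\<^sub>R y) - s * m y) \<le> m (b + t *\<^sub>R y) - t * m y"
          by linarith
      qed
      then have "p (a + b) - p b \<le> p a"
        by (intro pge) (auto simp: algebra_simps)
      then show "p (a + b) \<le> p a + p b" by simp
    next
      fix c :: real and a assume c: "0 \<le> c"
      show "p (c *\<^sub>R a) = c * p a"
      proof (cases "c = 0")
        case True
        have "0 \<le> p 0" by (rule pge) (auto simp: mhom)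
        then show ?thesis using pm[of 0] m0 True by simp
      next
        case c0: False
        have "p (c *\<^sub>R a) / c \<le> p a"
        proof (rule pge)
          fix t :: real assume t: "0 \<le> t"
          have "m (c *\<^sub>R a + (c * t) *\<^sub>R y) = c * m (a + t *\<^sub>R y)"
            using mhom[OF c, of "a + t *\<^sub>R y"] by (simp add: scaleR_add_right)
          then show "p (c *\<^sub>R a) / c \<le> m (a + t *\<^sub>R y) - t * m y"
            using ple[of "c * t" "c *\<^sub>R a"] c c0 t by (simp add: field_simps)
        qed
        moreover have "c * p a \<le> p (c *\<^sub>R a)"
        proof (rule pge)
          fix t :: real assume t: "0 \<le> t"
          have "m (c *\<^sub>R a + t *\<^sub>R y) = c * m (a + (t / c) *\<^sub>R y)"
            using mhom[OF c, of "a + (t / c) *\<^sub>R y"] c0 by (simp add: scaleR_add_right)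
          moreover have "p a \<le> m (a + (t / c) *\<^sub>R y) - (t / c) * m y"
            using ple[of "t / c" a] c t by simp
          then have "c * p a \<le> c * (m (a + (t / c) *\<^sub>R y) - (t / c) * m y)"
            using c by (rule mult_left_mono)
          ultimately show "c * p a \<le> m (c *\<^sub>R a + t *\<^sub>R y) - t * m y"
            using c0 by (simp add: algebra_simps)
        qed
        ultimately show ?thesis using c c0 by (simp add: field_simps)
      qed
    next
      fix a show "p a \<le> q a" using pm[of a] mq[of a] by linarith
    qed
    then have "p = m" using min pm by blast
    then show ?thesis using ple[of 1 x] by simp
  qed
  have add: "m (x + y) = m x + m y" for x y
    using sup[of x y] msub[of x y] by linarith
  have neg: "m (- x) = - m x" for x using add[of x "- x"] m0 by simp
  have "linear m"
  proof (rule linearI)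
    fix c :: real and x
    show "m (c *\<^sub>R x) = c *\<^sub>R m x"
    proof (cases "0 \<le> c")
      case False
      then have "m ((- c) *\<^sub>R x) = (- c) * m x" by (intro mhom) simp
      then show ?thesis using neg[of "c *\<^sub>R x"] by simp
    qed (simp add: mhom)
  qed (rule add)
  then show ?thesis using mq by blast
qed

text \<open>The infimal convolution \<open>q\<close> of the norm bound with \<open>w\<close> on
  \<open>S\<close> is sublinear. A linear \<open>g\<close> below it satisfies
  \<open>g \<le> w\<close> on \<open>S\<close>, hence equality by a change of sign, and the choice
  \<open>y = 0\<close> gives the norm bound.\<close>

lemma hahn_banach_extension:
  fixes w :: "'a::real_normed_vector \<Rightarrow> real"
  assumes w: "linear w" and S: "subspace S" and c: "0 \<le> c"
    and le: "\<And>y. y \<in> S \<Longrightarrow> w y \<le> c * norm y"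
  shows "\<exists>g. linear g \<and> (\<forall>y\<in>S. g y = w y) \<and> (\<forall>x. \<bar>g x\<bar> \<le> c * norm x)"
proof -
  define P where "P x = {c * norm (x - y) + w y | y. y \<in> S}" for x
  define q where "q x = Inf (P x)" for x
  have S0: "0 \<in> S" using S by (rule subspace_0)
  have lb: "- c * norm x \<le> s" if s: "s \<in> P x" for s x
  proof -
    obtain y where y: "y \<in> S" "s = c * norm (x - y) + w y" using s unfolding P_def by blast
    have "- w y \<le> c * norm y"
      using le[of "- y"] y S w by (simp add: subspace_neg linear_neg)
    also have "\<dots> \<le> c * (norm x + norm (x - y))"
      using c norm_triangle_ineq4[of x "x - y"] by (intro mult_left_mono) auto
    finally show ?thesis using y by (simp add: algebra_simps)
  qed
  have bdd: "bdd_below (P x)" for x using lb by (rule bdd_belowI)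
  have qle: "q x \<le> c * norm (x - y) + w y" if "y \<in> S" for x y
    unfolding q_def using bdd that by (intro cInf_lower) (auto simp: P_def)
  have qge: "b \<le> q x" if "\<And>y. y \<in> S \<Longrightarrow> b \<le> c * norm (x - y) + w y" for b x
    unfolding q_def by (intro cInf_greatest) (use that S0 in \<open>auto simp: P_def\<close>)
  have "\<exists>g. linear g \<and> (\<forall>x. g x \<le> q x)"
  proof (rule sublinear_dominates_linear)
    fix a b
    have *: "q (a + b) \<le> (c * norm (a - y) + w y) + (c * norm (b - z) + w z)"
      if "y \<in> S" "z \<in> S" for y z
    proof -
      have "c * norm (a + b - (y + z)) \<le> c * (norm (a - y) + norm (b - z))"
        using c norm_triangle_ineq[of "a - y" "b - z"]
        by (intro mult_left_mono) (auto simp: algebra_simps)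
      then show ?thesis
        using qle[of "y + z" "a + b"] S w that by (simp add: subspace_add linear_add algebra_simps)
    qed
    have "q (a + b) - (c * norm (a - y) + w y) \<le> q b" if y: "y \<in> S" for y
    proof (rule qge)
      fix z assume "z \<in> S"
      from *[OF y this] show "q (a + b) - (c * norm (a - y) + w y) \<le> c * norm (b - z) + w z"
        by linarith
    qed
    then have "q (a + b) - q b \<le> q a"
      by (intro qge) (auto simp: algebra_simps)
    then show "q (a + b) \<le> q a + q b" by simp
  next
    fix t :: real and a assume t: "0 \<le> t"
    show "q (t *\<^sub>R a) = t * q a"
    proof (cases "t = 0")
      case True
      have "q 0 \<le> 0" using qle[OF S0, of 0] w by (simp add: linear_0)
      moreover have "0 \<le> q 0"
      proof (rule qge)
        fix y assume "y \<in> S"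
        then show "0 \<le> c * norm (0 - y) + w y"
          using le[of "- y"] S w by (simp add: subspace_neg linear_neg)
      qed
      ultimately show ?thesis using True by simp
    next
      case t0: False
      have "q (t *\<^sub>R a) / t \<le> q a"
      proof (rule qge)
        fix y assume y: "y \<in> S"
        have "norm (t *\<^sub>R a - t *\<^sub>R y) = t * norm (a - y)"
          using t by (metis scaleR_diff_right norm_scaleR abs_of_nonneg)
        then show "q (t *\<^sub>R a) / t \<le> c * norm (a - y) + w y"
          using qle[of "t *\<^sub>R y" "t *\<^sub>R a"] t t0 S w y
          by (simp add: subspace_scale linear_scale field_simps)
      qed
      moreover have "t * q a \<le> q (t *\<^sub>R a)"
      proof (rule qge)
        fix y assume y: "y \<in> S"
        define z where "z = (1 / t) *\<^sub>R y"
        have z: "z \<in> S" "y = t *\<^sub>R z" unfolding z_def using y S t0 by (auto simp: subspace_scale)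
        have "norm (t *\<^sub>R a - t *\<^sub>R z) = t * norm (a - z)"
          using t by (metis scaleR_diff_right norm_scaleR abs_of_nonneg)
        then show "t * q a \<le> c * norm (t *\<^sub>R a - y) + w y"
          using mult_left_mono[OF qle[OF z(1), of a] t] w z by (simp add: linear_scale algebra_simps)
      qed
      ultimately show ?thesis using t t0 by (simp add: field_simps)
    qed
  qed
  then obtain g where g: "linear g" "\<And>x. g x \<le> q x" by blast
  have gw: "g y \<le> w y" if "y \<in> S" for y
    using g(2)[of y] qle[OF that, of y] by simp
  have "g y = w y" if "y \<in> S" for y
    using gw[OF that] gw[of "- y"] that S w g(1) by (simp add: subspace_neg linear_neg)
  moreover have gn: "g x \<le> c * norm x" for x
    using g(2)[of x] qle[OF S0, of x] w by (simp add: linear_0)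
  then have "\<bar>g x\<bar> \<le> c * norm x" for x
    using gn[of x] gn[of "- x"] g(1) by (simp add: linear_neg abs_le_iff)
  ultimately show ?thesis using g(1) by blast
qed

section \<open>Compact convex sets of functionals and minimax\<close>

text \<open>The function type is no instance of \<open>real_vector\<close>, so \<open>convex\<close> does not apply to sets of functions.\<close>

definition pconvex :: "('a \<Rightarrow> real) set \<Rightarrow> bool" where
  "pconvex S \<longleftrightarrow> (\<forall>u\<in>S. \<forall>v\<in>S. \<forall>t. 0 \<le> t \<longrightarrow> t \<le> 1 \<longrightarrow> (\<lambda>x. (1 - t) * u x + t * v x) \<in> S)"

lemma pconvexD:
  "pconvex S \<Longrightarrow> u \<in> S \<Longrightarrow> v \<in> S \<Longrightarrow> 0 \<le> t \<Longrightarrow> t \<le> 1 \<Longrightarrow> (\<lambda>x. (1 - t) * u x + t * v x) \<in> S"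
  unfolding pconvex_def by blast

lemma pconvex_singleton: "pconvex {u}"
  unfolding pconvex_def by (auto simp: algebra_simps)

lemma pconvex_Inter: "(\<And>S. S \<in> \<S> \<Longrightarrow> pconvex S) \<Longrightarrow> pconvex (\<Inter>\<S>)"
  unfolding pconvex_def by blast

lemma continuous_on_eval: "continuous_on S (\<lambda>u. u x :: 'b::topological_space)"
  by (rule continuous_on_subset[OF continuous_on_product_coordinates subset_UNIV])

lemma pconvex_closure:
  assumes "pconvex S"
  shows "pconvex (closure S)"
  unfolding pconvex_def
proof (intro ballI allI impI)
  fix u v :: "'a \<Rightarrow> real" and t :: real
  assume u: "u \<in> closure S" and v: "v \<in> closure S" and t: "0 \<le> t" "t \<le> 1"
  define h :: "('a \<Rightarrow> real) \<times> ('a \<Rightarrow> real) \<Rightarrow> 'a \<Rightarrow> real"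
    where "h p x = (1 - t) * fst p x + t * snd p x" for p x
  have "continuous_on (closure (S \<times> S)) h"
    unfolding h_def
    by (rule continuous_on_coordinatewise_then_product, intro continuous_on_add
        continuous_on_mult continuous_on_const
        continuous_on_product_then_coordinatewise[OF continuous_on_fst[OF continuous_on_id]]
        continuous_on_product_then_coordinatewise[OF continuous_on_snd[OF continuous_on_id]])
  moreover have "h ` (S \<times> S) \<subseteq> closure S"
  proof
    fix z assume "z \<in> h ` (S \<times> S)"
    then obtain a b where ab: "a \<in> S" "b \<in> S" "z = h (a, b)" by blast
    have "h (a, b) \<in> S"
      using pconvexD[OF assms ab(1,2) t] unfolding h_def by simp
    then show "z \<in> closure S" using ab(3) closure_subset by blast
  qed
  ultimately have "h ` closure (S \<times> S) \<subseteq> closure S"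
    by (rule image_closure_subset[OF _ closed_closure])
  then have "h (u, v) \<in> closure S"
    using u v by (auto simp: closure_Times)
  then show "(\<lambda>x. (1 - t) * u x + t * v x) \<in> closure S"
    unfolding h_def by simp
qed

lemma compact_product:
  fixes S :: "'i \<Rightarrow> 'b::topological_space set"
  assumes "\<And>i. compact (S i)"
  shows "compact {w. \<forall>i. w i \<in> S i}"
proof -
  have "compactin (product_topology (\<lambda>i. euclidean) UNIV) (PiE UNIV S)"
    using assms by (simp add: compactin_PiE)
  moreover have "PiE UNIV S = {w. \<forall>i. w i \<in> S i}" by auto
  ultimately show ?thesis by (simp add: euclidean_product_topology)
qed

lemma closure_product_approx:
  fixes S :: "('a \<Rightarrow> 'b::metric_space) set"
  assumes "u \<in> closure S" "finite N" "0 < \<epsilon>"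
  shows "\<exists>s\<in>S. \<forall>x\<in>N. dist (s x) (u x) < \<epsilon>"
proof -
  define U where "U = {s. \<forall>x\<in>N. s x \<in> ball (u x) \<epsilon>}"
  have "open U"
    unfolding U_def using product_topology_basis'[of N "\<lambda>x. ball (u x) \<epsilon>" "\<lambda>x. x"] assms(2) by simp
  moreover have "u \<in> U" unfolding U_def using assms(3) by simp
  ultimately have "U \<inter> S \<noteq> {}"
    using open_Int_closure_eq_empty[of U S] assms(1) by blast
  then obtain s where "s \<in> U" "s \<in> S" by blast
  then show ?thesis unfolding U_def by (auto simp: dist_commute)
qed

text \<open>The hypothesis lets \<open>u\<close> depend on \<open>y\<close>; the conclusion has one
  choice \<open>w\<close> for all \<open>y\<close>, at the price of mixing the inequalities. The
  alternative is used twice: over \<open>D\<close> for the support functions of the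
  \<open>K i\<close>, which are convex, and over the product of the \<open>K i\<close> for finitely
  many \<open>y\<close> at a time, which suffices by compactness.\<close>

lemma minimax_alternative:
  fixes K :: "'i \<Rightarrow> ('a::real_vector \<Rightarrow> real) set"
  assumes I: "finite I" "I \<noteq> {}" and D: "convex D"
    and comp: "\<And>i. i \<in> I \<Longrightarrow> compact (K i)" and cvx: "\<And>i. i \<in> I \<Longrightarrow> pconvex (K i)"
    and ne: "\<And>i. i \<in> I \<Longrightarrow> K i \<noteq> {}" and lin: "\<And>i u. i \<in> I \<Longrightarrow> u \<in> K i \<Longrightarrow> linear u"
    and alt: "\<And>y. y \<in> D \<Longrightarrow> \<exists>i\<in>I. \<exists>u\<in>K i. c i \<le> u y"
    and eps: "0 < \<epsilon>"
  shows "\<exists>l w. (\<forall>i\<in>I. 0 \<le> l i \<and> w i \<in> K i) \<and> sum l I = 1 \<and>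
    (\<forall>y\<in>D. - \<epsilon> \<le> (\<Sum>i\<in>I. l i * (w i y - c i)))"
proof -
  have "\<exists>u\<in>K i. \<forall>v\<in>K i. v y \<le> u y" if "i \<in> I" for i y
    using continuous_attains_sup[OF comp[OF that] ne[OF that] continuous_on_eval] by blast
  then have mex: "\<exists>u. u \<in> K i \<and> (\<forall>v\<in>K i. v y \<le> u y)" if "i \<in> I" for i y
    using that by blast
  define m where "m i y = (SOME u. u \<in> K i \<and> (\<forall>v\<in>K i. v y \<le> u y))" for i y
  have mK: "m i y \<in> K i" and mmax: "v \<in> K i \<Longrightarrow> v y \<le> m i y y" if "i \<in> I" for i y v
    using someI_ex[OF mex[OF that, of y]] unfolding m_def[symmetric] by blast+
  have linc: "u ((1 - t) *\<^sub>R x + t *\<^sub>R y) = (1 - t) * u x + t * u y" if "linear u" for u x y and t :: real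
    using that by (simp add: linear_add linear_scale)
  have "\<exists>l. (\<forall>i\<in>I. 0 \<le> l i) \<and> sum l I = 1 \<and> (\<forall>y\<in>D. 0 \<le> (\<Sum>i\<in>I. l i * (m i y y - c i)))"
  proof (rule convexlike_alternative[OF I])
    fix x y and t :: real assume xy: "x \<in> D" "y \<in> D" and t: "0 \<le> t" "t \<le> 1"
    define z where "z = (1 - t) *\<^sub>R x + t *\<^sub>R y"
    have "z \<in> D" unfolding z_def using convexD_alt[OF D xy t] .
    moreover have "m i z z - c i \<le> (1 - t) * (m i x x - c i) + t * (m i y y - c i)" if i: "i \<in> I" for i
    proof -
      have "m i z z = (1 - t) * m i z x + t * m i z y"
        using linc[OF lin[OF i mK[OF i, of z]]] unfolding z_def .
      also have "\<dots> \<le> (1 - t) * m i x x + t * m i y y"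
        using t mmax[OF i mK[OF i]] by (intro add_mono mult_left_mono) auto
      finally show ?thesis by (simp add: algebra_simps)
    qed
    ultimately show "\<exists>z\<in>D. \<forall>i\<in>I. m i z z - c i \<le> (1 - t) * (m i x x - c i) + t * (m i y y - c i)"
      by blast
  next
    fix y assume "y \<in> D"
    then obtain i u where "i \<in> I" "u \<in> K i" "c i \<le> u y" using alt by blast
    then show "\<exists>i\<in>I. 0 \<le> m i y y - c i" using mmax[of i u y] by force
  qed
  then obtain l where l: "\<And>i. i \<in> I \<Longrightarrow> 0 \<le> l i" "sum l I = 1"
    and lD: "\<And>y. y \<in> D \<Longrightarrow> 0 \<le> (\<Sum>i\<in>I. l i * (m i y y - c i))" by blast
  \<comment> \<open>Indices outside \<open>I\<close> get a one-point factor, so that the product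
    over the whole index type is compact.\<close>
  define T where "T = {w. \<forall>i. w i \<in> (if i \<in> I then K i else {\<lambda>_. 0})}"
  have T: "compact T"
    unfolding T_def by (rule compact_product) (auto intro: comp)
  have TK: "w i \<in> K i" if "w \<in> T" "i \<in> I" for w i
  proof -
    have "w i \<in> (if i \<in> I then K i else {\<lambda>_. 0})" using that(1) unfolding T_def by blast
    then show ?thesis using that(2) by simp
  qed
  have T0: "w i = (\<lambda>_. 0)" if "w \<in> T" "i \<notin> I" for w i
  proof -
    have "w i \<in> (if i \<in> I then K i else {\<lambda>_. 0})" using that(1) unfolding T_def by blast
    then show ?thesis using that(2) by simp
  qed
  define G where "G w y = (\<Sum>i\<in>I. l i * (w i y - c i))" for w and y :: 'a
  define S where "S y = {w. - \<epsilon> \<le> G w y}" for y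
  have contG: "continuous_on UNIV (\<lambda>w. G w y)" for y
    unfolding G_def
    by (intro continuous_on_sum continuous_on_mult continuous_on_diff continuous_on_const
        continuous_on_product_then_coordinatewise[OF continuous_on_product_coordinates])
  have "T \<inter> (\<Inter>y\<in>D. S y) \<noteq> {}"
  proof (rule compact_imp_fip_image[OF T])
    fix y show "closed (S y)"
      unfolding S_def using contG by (intro closed_Collect_le continuous_on_const)
  next
    fix Y assume Y: "finite Y" "Y \<subseteq> D"
    show "T \<inter> (\<Inter>y\<in>Y. S y) \<noteq> {}"
    proof
      assume emp: "T \<inter> (\<Inter>y\<in>Y. S y) = {}"
      have Tm: "(\<lambda>i. if i \<in> I then m i y else (\<lambda>_. 0)) \<in> T" for y
        unfolding T_def using mK by auto
      have Yne: "Y \<noteq> {}" using emp Tm[of 0] by auto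
      have "\<exists>\<mu>. (\<forall>y\<in>Y. 0 \<le> \<mu> y) \<and> sum \<mu> Y = 1 \<and> (\<forall>w\<in>T. 0 \<le> (\<Sum>y\<in>Y. \<mu> y * (- \<epsilon> - G w y)))"
      proof (rule convexlike_alternative[OF Y(1) Yne])
        fix w w' and t :: real assume w: "w \<in> T" "w' \<in> T" and t: "0 \<le> t" "t \<le> 1"
        define z where "z i = (\<lambda>x. (1 - t) * w i x + t * w' i x)" for i
        have "z i \<in> (if i \<in> I then K i else {\<lambda>_. 0})" for i
        proof (cases "i \<in> I")
          case True
          then have "w i \<in> K i" "w' i \<in> K i" using w TK by auto
          then show ?thesis using pconvexD[OF cvx[OF True] _ _ t] True by (simp add: z_def)
        next
          case False
          then have "w i = (\<lambda>_. 0)" "w' i = (\<lambda>_. 0)" using w T0 by auto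
          then show ?thesis using False by (simp add: z_def)
        qed
        then have "z \<in> T" unfolding T_def by blast
        moreover have "G z y = (1 - t) * G w y + t * G w' y" for y
          unfolding G_def z_def sum_distrib_left sum.distrib[symmetric]
          by (intro sum.cong) (auto simp: algebra_simps)
        ultimately show "\<exists>z\<in>T. \<forall>y\<in>Y. - \<epsilon> - G z y \<le> (1 - t) * (- \<epsilon> - G w y) + t * (- \<epsilon> - G w' y)"
          by (intro bexI[of _ z]) (auto simp: algebra_simps)
      next
        fix w assume "w \<in> T"
        then obtain y where "y \<in> Y" "w \<notin> S y" using emp by blast
        then show "\<exists>y\<in>Y. 0 \<le> - \<epsilon> - G w y"
          unfolding S_def by (intro bexI[of _ y]) auto
      qed
      then obtain \<mu> where \<mu>: "\<And>y. y \<in> Y \<Longrightarrow> 0 \<le> \<mu> y" "sum \<mu> Y = 1"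
        and \<mu>T: "\<And>w. w \<in> T \<Longrightarrow> 0 \<le> (\<Sum>y\<in>Y. \<mu> y * (- \<epsilon> - G w y))" by blast
      \<comment> \<open>The weights \<open>\<mu>\<close> merge the finitely many vectors into one
        point of \<open>D\<close>. The maximisers at \<open>y0\<close> form an element of
        \<open>T\<close> whose mixture is nonnegative, whereas \<open>\<mu>T\<close> bounds it by
        \<open>- \<epsilon>\<close>.\<close>
      define y0 where "y0 = (\<Sum>y\<in>Y. \<mu> y *\<^sub>R y)"
      have y0: "y0 \<in> D" unfolding y0_def using Y \<mu> D by (intro convex_sum) auto
      define w where "w = (\<lambda>i. if i \<in> I then m i y0 else (\<lambda>_. 0))"
      have "(\<Sum>y\<in>Y. \<mu> y * G w y) = (\<Sum>i\<in>I. l i * (\<Sum>y\<in>Y. \<mu> y * (w i y - c i)))"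
        unfolding G_def sum_distrib_left by (subst sum.swap) (simp add: ac_simps)
      also have "\<dots> = (\<Sum>i\<in>I. l i * (m i y0 y0 - c i))"
      proof (intro sum.cong refl)
        fix i assume i: "i \<in> I"
        have "m i y0 y0 = (\<Sum>y\<in>Y. \<mu> y * m i y0 y)"
          using lin[OF i mK[OF i, of y0]] unfolding y0_def by (simp add: linear_sum linear_scale)
        moreover have "(\<Sum>y\<in>Y. \<mu> y * (w i y - c i)) = (\<Sum>y\<in>Y. \<mu> y * m i y0 y) - sum \<mu> Y * c i"
          unfolding sum_distrib_right sum_subtractf[symmetric] using i
          by (intro sum.cong) (auto simp: w_def algebra_simps)
        ultimately show "l i * (\<Sum>y\<in>Y. \<mu> y * (w i y - c i)) = l i * (m i y0 y0 - c i)"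
          using \<mu>(2) by simp
      qed
      finally have "0 \<le> (\<Sum>y\<in>Y. \<mu> y * G w y)" using lD[OF y0] by simp
      moreover have "0 \<le> (\<Sum>y\<in>Y. \<mu> y * (- \<epsilon> - G w y))"
        unfolding w_def by (rule \<mu>T[OF Tm])
      moreover have "(\<Sum>y\<in>Y. \<mu> y * (- \<epsilon> - G w y)) = - \<epsilon> * sum \<mu> Y - (\<Sum>y\<in>Y. \<mu> y * G w y)"
        unfolding sum_distrib_left sum_subtractf[symmetric]
        by (intro sum.cong) (auto simp: algebra_simps)
      ultimately show False using eps \<mu>(2) by simp
    qed
  qed
  then obtain w where w: "w \<in> T" "\<And>y. y \<in> D \<Longrightarrow> - \<epsilon> \<le> G w y" unfolding S_def by blast
  have "w i \<in> K i" if "i \<in> I" for i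
    using TK[OF w(1) that] .
  then show ?thesis using l w(2) unfolding G_def by blast
qed

section \<open>Functionals in the weak* closure of a set of vectors\<close>

text \<open>The functional \<open>\<Phi>\<close>, which only matters on bounded linear arguments, lies in the weak* closure of \<open>C\<close>.\<close>

definition approximable :: "('a::real_normed_vector set) \<Rightarrow> (('a \<Rightarrow> real) \<Rightarrow> real) \<Rightarrow> bool" where
  "approximable C \<Phi> \<longleftrightarrow> (\<forall>N \<epsilon>. finite N \<longrightarrow> (\<forall>u\<in>N. bounded_linear u) \<longrightarrow> 0 < \<epsilon> \<longrightarrow>
     (\<exists>y\<in>C. \<forall>u\<in>N. \<bar>u y - \<Phi> u\<bar> < \<epsilon>))"

lemma approximableD:
  "approximable C \<Phi> \<Longrightarrow> finite N \<Longrightarrow> (\<And>u. u \<in> N \<Longrightarrow> bounded_linear u) \<Longrightarrow> 0 < \<epsilon> \<Longrightarrow>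
    \<exists>y\<in>C. \<forall>u\<in>N. \<bar>u y - \<Phi> u\<bar> < \<epsilon>"
  unfolding approximable_def by blast

text \<open>Approximation at finitely many functionals becomes control on whole compact convex sets.
  If every \<open>y\<close> violated some bound, minimax would select one functional from each set
  such that every \<open>y\<close> nearly violates a fixed average of the bounds; but the selected
  functionals are finite in number, so \<open>D\<close> approximates \<open>\<Phi>\<close> on
  them.\<close>

lemma approximable_uniformly:
  fixes \<P> :: "(('a::real_normed_vector \<Rightarrow> real) set \<times> real) set"
  assumes apx: "approximable D \<Phi>" and D: "convex D" and P: "finite \<P>" and eta: "0 < \<eta>"
    and Q: "\<And>Q c. (Q, c) \<in> \<P> \<Longrightarrow> compact Q \<and> pconvex Q \<and> (\<forall>u\<in>Q. bounded_linear u \<and> \<Phi> u \<le> c)"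
  shows "\<exists>y\<in>D. \<forall>(Q, c)\<in>\<P>. \<forall>u\<in>Q. u y < c + \<eta>"
proof (rule ccontr)
  assume neg: "\<not> ?thesis"
  define I where "I = {p \<in> \<P>. fst p \<noteq> {}}"
  have I: "finite I" unfolding I_def using P by simp
  have props: "compact (fst p)" "pconvex (fst p)" "u \<in> fst p \<Longrightarrow> bounded_linear u"
    "u \<in> fst p \<Longrightarrow> \<Phi> u \<le> snd p" if "p \<in> I" for p u
    using Q[of "fst p" "snd p"] that unfolding I_def by auto
  have alt: "\<exists>p\<in>I. \<exists>u\<in>fst p. snd p + \<eta> \<le> u y" if yD: "y \<in> D" for y
  proof -
    obtain Q c u where "(Q, c) \<in> \<P>" "u \<in> Q" "\<not> u y < c + \<eta>" using neg yD by blast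
    then show ?thesis unfolding I_def by (intro bexI[of _ "(Q, c)"] bexI[of _ u]) auto
  qed
  obtain y where "y \<in> D" using approximableD[OF apx, of "{}" 1] by auto
  then have Ine: "I \<noteq> {}" using alt by blast
  have "\<exists>l w. (\<forall>p\<in>I. 0 \<le> l p \<and> w p \<in> fst p) \<and> sum l I = 1 \<and>
    (\<forall>y\<in>D. - (\<eta> / 2) \<le> (\<Sum>p\<in>I. l p * (w p y - (snd p + \<eta>))))"
  proof (rule minimax_alternative[OF I Ine D])
    show "fst p \<noteq> {}" if "p \<in> I" for p using that unfolding I_def by simp
    show "linear u" if "p \<in> I" "u \<in> fst p" for p u
      using props(3)[OF that] by (rule bounded_linear.linear)
    show "\<exists>p\<in>I. \<exists>u\<in>fst p. snd p + \<eta> \<le> u y" if "y \<in> D" for y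
      by (rule alt[OF that])
  qed (simp_all add: props eta)
  then obtain l w where lw: "\<And>p. p \<in> I \<Longrightarrow> 0 \<le> l p" "\<And>p. p \<in> I \<Longrightarrow> w p \<in> fst p" "sum l I = 1"
    and ge: "\<And>y. y \<in> D \<Longrightarrow> - (\<eta> / 2) \<le> (\<Sum>p\<in>I. l p * (w p y - (snd p + \<eta>)))" by blast
  have "\<exists>y\<in>D. \<forall>u\<in>w ` I. \<bar>u y - \<Phi> u\<bar> < \<eta> / 4"
    using I eta lw(2) props(3) by (intro approximableD[OF apx]) auto
  then obtain y where y: "y \<in> D" "\<And>u. u \<in> w ` I \<Longrightarrow> \<bar>u y - \<Phi> u\<bar> < \<eta> / 4" by blast
  \<comment> \<open>Approximation within \<open>\<eta> / 4\<close> puts each bracket at or below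
    \<open>- 3 * \<eta> / 4\<close>, which is less than the minimax bound
    \<open>- \<eta> / 2\<close>.\<close>
  have "(\<Sum>p\<in>I. l p * (w p y - (snd p + \<eta>))) \<le> (\<Sum>p\<in>I. l p * (- (3 * \<eta> / 4)))"
  proof (intro sum_mono mult_left_mono)
    fix p assume p: "p \<in> I"
    show "w p y - (snd p + \<eta>) \<le> - (3 * \<eta> / 4)"
      using y(2)[OF imageI[OF p]] props(4)[OF p lw(2)[OF p]] by linarith
  qed (rule lw)
  also have "\<dots> = sum l I * (- (3 * \<eta> / 4))" by (simp only: sum_distrib_right)
  also have "\<dots> = - (3 * \<eta> / 4)" using lw(3) by simp
  finally show False using ge[OF y(1)] eta by simp
qed

text \<open>Linearity of \<open>\<Phi>\<close> is inherited from the vectors: a single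
  \<open>y\<close> approximates \<open>\<Phi>\<close> at all summands and at their
  combination.\<close>

lemma approximable_sum:
  assumes apx: "approximable C \<Phi>" and I: "finite I" and bl: "\<And>i. i \<in> I \<Longrightarrow> bounded_linear (u i)"
  shows "\<Phi> (\<lambda>x. \<Sum>i\<in>I. l i * u i x) = (\<Sum>i\<in>I. l i * \<Phi> (u i))"
proof (rule ccontr)
  define w where "w x = (\<Sum>i\<in>I. l i * u i x)" for x
  define d where "d = \<bar>\<Phi> w - (\<Sum>i\<in>I. l i * \<Phi> (u i))\<bar>"
  define L where "L = 1 + (\<Sum>i\<in>I. \<bar>l i\<bar>)"
  assume "\<not> ?thesis"
  then have d: "0 < d" unfolding d_def w_def by simp
  have L: "0 < L" unfolding L_def by (simp add: sum_nonneg add_pos_nonneg)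
  define \<epsilon> where "\<epsilon> = d / (2 * L)"
  have eps: "0 < \<epsilon>" unfolding \<epsilon>_def using d L by simp
  have "bounded_linear w"
    unfolding w_def using bl by (intro bounded_linear_sum bounded_linear_const_mult)
  then have "\<exists>y\<in>C. \<forall>v\<in>insert w (u ` I). \<bar>v y - \<Phi> v\<bar> < \<epsilon>"
    using I bl eps by (intro approximableD[OF apx]) auto
  then obtain y where y: "\<bar>w y - \<Phi> w\<bar> < \<epsilon>" "\<And>i. i \<in> I \<Longrightarrow> \<bar>u i y - \<Phi> (u i)\<bar> < \<epsilon>" by blast
  have "\<bar>\<Sum>i\<in>I. l i * (u i y - \<Phi> (u i))\<bar> \<le> (\<Sum>i\<in>I. \<bar>l i\<bar> * \<epsilon>)"
    using less_imp_le[OF y(2)] by (intro order.trans[OF sum_abs] sum_mono)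
      (auto simp: abs_mult intro: mult_left_mono)
  moreover have "(\<Sum>i\<in>I. l i * (u i y - \<Phi> (u i))) = w y - (\<Sum>i\<in>I. l i * \<Phi> (u i))"
    unfolding w_def by (simp add: right_diff_distrib sum_subtractf)
  moreover have "(\<Sum>i\<in>I. \<bar>l i\<bar> * \<epsilon>) = (L - 1) * \<epsilon>"
    unfolding L_def by (simp add: sum_distrib_right)
  ultimately have "d < \<epsilon> + (L - 1) * \<epsilon>"
    using y(1) unfolding d_def by linarith
  also have "\<dots> = d / 2" unfolding \<epsilon>_def using L by (simp add: field_simps)
  finally show False using d by simp
qed

text \<open>Indexing by truth values instead of by the functionals themselves allows
  \<open>u = v\<close>.\<close>

lemma approximable_lincomb:
  assumes "approximable C \<Phi>" "bounded_linear u" "bounded_linear v"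
  shows "\<Phi> (\<lambda>x. a * u x + b * v x) = a * \<Phi> u + b * \<Phi> v"
  using approximable_sum[OF assms(1), of "UNIV::bool set" "\<lambda>i. if i then u else v" "\<lambda>i. if i then a else b"]
    assms(2,3) by (simp add: UNIV_bool add.commute)

lemma bounded_linear_real_iff:
  fixes u :: "'a::real_normed_vector \<Rightarrow> real"
  shows "bounded_linear u \<longleftrightarrow> linear u \<and> (\<exists>b. \<forall>x. \<bar>u x\<bar> \<le> b * norm x)"
  unfolding bounded_linear_def bounded_linear_axioms_def
  by (auto simp: mult.commute)

text \<open>Goldstine's theorem inside \<open>span C\<close>. A failure gives a mixture
  \<open>w\<close> of the tested functionals and their negatives that exceeds
  \<open>\<Phi> w\<close> by \<open>\<epsilon>\<close> on the ball of the span. Replacing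
  \<open>w\<close> by a norm-controlled extension of its restriction to the span does not change the
  value of \<open>\<Phi>\<close>, and then \<open>bound\<close> applies.\<close>

lemma approximable_bounded:
  fixes C :: "'a::real_normed_vector set"
  assumes apx: "approximable C \<Phi>" and M: "0 \<le> M"
    and bound: "\<And>u b. linear u \<Longrightarrow> 0 \<le> b \<Longrightarrow> (\<And>x. \<bar>u x\<bar> \<le> b * norm x) \<Longrightarrow> \<bar>\<Phi> u\<bar> \<le> M * b"
  shows "approximable {y \<in> span C. norm y \<le> M + 1} \<Phi>"
  unfolding approximable_def
proof (intro allI impI)
  fix N :: "('a \<Rightarrow> real) set" and \<epsilon> :: real
  assume N: "finite N" "\<forall>u\<in>N. bounded_linear u" and eps: "0 < \<epsilon>"
  define D where "D = {y \<in> span C. norm y \<le> M + 1}"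
  have D0: "0 \<in> D" unfolding D_def using M by (simp add: span_zero)
  have Dneg: "- y \<in> D" if "y \<in> D" for y
    using that unfolding D_def by (simp add: span_neg)
  have "D = span C \<inter> cball 0 (M + 1)" unfolding D_def by auto
  then have D: "convex D"
    by (simp add: convex_Int convex_cball subspace_imp_convex)
  show "\<exists>y\<in>{y \<in> span C. norm y \<le> M + 1}. \<forall>u\<in>N. \<bar>u y - \<Phi> u\<bar> < \<epsilon>"
  proof (rule ccontr)
    assume "\<not> ?thesis"
    then have neg: "\<exists>u\<in>N. \<epsilon> \<le> \<bar>u y - \<Phi> u\<bar>" if "y \<in> D" for y
      using that unfolding D_def by (meson not_less)
    define I where "I = N \<times> {1, - 1 :: real}"
    have I: "finite I" "I \<noteq> {}"
      unfolding I_def using N neg[OF D0] by auto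
    define f where "f p y = snd p * (fst p y - \<Phi> (fst p)) - \<epsilon>" for p :: "('a \<Rightarrow> real) \<times> real" and y
    have blI: "bounded_linear (fst p)" if "p \<in> I" for p
      using that N unfolding I_def by auto
    have "\<exists>l. (\<forall>p\<in>I. 0 \<le> l p) \<and> sum l I = 1 \<and> (\<forall>y\<in>D. 0 \<le> (\<Sum>p\<in>I. l p * f p y))"
    proof (rule convexlike_alternative[OF I])
      fix x y and t :: real assume xy: "x \<in> D" "y \<in> D" and t: "0 \<le> t" "t \<le> 1"
      have "f p ((1 - t) *\<^sub>R x + t *\<^sub>R y) = (1 - t) * f p x + t * f p y" if "p \<in> I" for p
        using bounded_linear.linear[OF blI[OF that]] unfolding f_def
        by (simp add: linear_add linear_scale linear_diff algebra_simps)
      then show "\<exists>z\<in>D. \<forall>p\<in>I. f p z \<le> (1 - t) * f p x + t * f p y"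
        using convexD_alt[OF D xy t] by (intro bexI[of _ "(1 - t) *\<^sub>R x + t *\<^sub>R y"]) auto
    next
      fix y assume "y \<in> D"
      then obtain u where u: "u \<in> N" "\<epsilon> \<le> \<bar>u y - \<Phi> u\<bar>" using neg by blast
      show "\<exists>p\<in>I. 0 \<le> f p y"
      proof (cases "0 \<le> u y - \<Phi> u")
        case True
        then show ?thesis using u by (intro bexI[of _ "(u, 1)"]) (auto simp: f_def I_def)
      next
        case False
        then show ?thesis using u by (intro bexI[of _ "(u, - 1)"]) (auto simp: f_def I_def)
      qed
    qed
    then obtain l where l: "\<And>p. p \<in> I \<Longrightarrow> 0 \<le> l p" "sum l I = 1"
      and lD: "\<And>y. y \<in> D \<Longrightarrow> 0 \<le> (\<Sum>p\<in>I. l p * f p y)" by blast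
    define w where "w x = (\<Sum>p\<in>I. (l p * snd p) * fst p x)" for x
    have blw: "bounded_linear w"
      unfolding w_def using blI by (intro bounded_linear_sum bounded_linear_const_mult)
    have linw: "linear w" using blw by (rule bounded_linear.linear)
    have \<Phi>w: "\<Phi> w = (\<Sum>p\<in>I. (l p * snd p) * \<Phi> (fst p))"
      unfolding w_def by (rule approximable_sum[OF apx I(1)]) (rule blI)
    have "(\<Sum>p\<in>I. l p * f p y) = w y - \<Phi> w - \<epsilon> * sum l I" for y
      unfolding \<Phi>w w_def sum_distrib_left sum_subtractf[symmetric]
      by (intro sum.cong) (auto simp: f_def algebra_simps)
    then have wD: "\<Phi> w + \<epsilon> \<le> w y" if "y \<in> D" for y
      using lD[OF that] l(2) by simp
    \<comment> \<open>Since \<open>D\<close> is symmetric, \<open>\<sigma>\<close> bounds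
      \<open>w\<close> on \<open>D\<close>, so \<open>\<sigma> / (M + 1)\<close> bounds its norm on
      the span. The radius \<open>M + 1\<close> keeps the quotient meaningful for
      \<open>M = 0\<close>.\<close>
    define \<sigma> where "\<sigma> = - \<Phi> w - \<epsilon>"
    have wD': "w y \<le> \<sigma>" if "y \<in> D" for y
      using wD[OF Dneg[OF that]] linw unfolding \<sigma>_def by (simp add: linear_neg)
    have \<sigma>: "0 \<le> \<sigma>" using wD'[OF D0] linw by (simp add: linear_0)
    have "\<exists>g. linear g \<and> (\<forall>y\<in>span C. g y = w y) \<and> (\<forall>x. \<bar>g x\<bar> \<le> \<sigma> / (M + 1) * norm x)"
    proof (rule hahn_banach_extension[OF linw])
      fix y assume y: "y \<in> span C"
      show "w y \<le> \<sigma> / (M + 1) * norm y"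
      proof (cases "y = 0")
        case False
        define t where "t = (M + 1) / norm y"
        have t: "0 < t" unfolding t_def using False M by simp
        have "t *\<^sub>R y \<in> D"
          unfolding D_def using y False M by (simp add: span_scale t_def)
        then have "t * w y \<le> \<sigma>" using wD' linw by (metis linear_scale real_scaleR_def)
        then show ?thesis using False M unfolding t_def by (simp add: field_simps)
      qed (use linw in \<open>simp add: linear_0\<close>)
    qed (use \<sigma> M in auto)
    then obtain g where g: "linear g" "\<And>y. y \<in> span C \<Longrightarrow> g y = w y"
      and gb: "\<And>x. \<bar>g x\<bar> \<le> \<sigma> / (M + 1) * norm x" by blast
    have blg: "bounded_linear g" unfolding bounded_linear_real_iff using g(1) gb by blast
    \<comment> \<open>\<open>h\<close> vanishes on \<open>C\<close>, from which
      \<open>\<Phi>\<close> is approximated; hence \<open>\<Phi> h = 0\<close> and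
      \<open>\<Phi> w = \<Phi> g\<close>.\<close>
    define h where "h x = 1 * g x + (- 1) * w x" for x
    have blh: "bounded_linear h"
      unfolding h_def using blg blw by (intro bounded_linear_add bounded_linear_const_mult)
    have "\<bar>\<Phi> h\<bar> < e" if "0 < e" for e
    proof -
      have "\<exists>y\<in>C. \<forall>v\<in>{h}. \<bar>v y - \<Phi> v\<bar> < e"
        using blh that by (intro approximableD[OF apx]) auto
      then show ?thesis using g(2) by (auto simp: h_def span_base)
    qed
    then have "\<Phi> h = 0" by (metis abs_zero less_irrefl zero_less_abs_iff)
    moreover have "\<Phi> h = 1 * \<Phi> g + (- 1) * \<Phi> w"
      unfolding h_def by (rule approximable_lincomb[OF apx blg blw])
    ultimately have "\<bar>\<Phi> w\<bar> \<le> M * (\<sigma> / (M + 1))"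
      using bound[OF g(1) _ gb] \<sigma> M by simp
    also have "\<dots> \<le> \<sigma>" using \<sigma> M by (simp add: field_simps)
    finally show False using eps unfolding \<sigma>_def by linarith
  qed
qed

section \<open>The dual ball in the topology of pointwise convergence\<close>

text \<open>Functionals are plain functions here, so that the weak* topology is the product topology of the
  function type.\<close>

definition dual_ball :: "real \<Rightarrow> ('a::real_normed_vector \<Rightarrow> real) set" where
  "dual_ball r = {u. linear u \<and> (\<forall>x. \<bar>u x\<bar> \<le> r * norm x)}"

lemma dual_ball_bounded_linear: "u \<in> dual_ball r \<Longrightarrow> bounded_linear u"
  unfolding dual_ball_def bounded_linear_real_iff by blast

lemma zero_in_dual_ball: "0 \<le> r \<Longrightarrow> (\<lambda>_. 0) \<in> dual_ball r"
  unfolding dual_ball_def by (auto intro: linear_zero)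

lemma closed_dual_ball: "closed (dual_ball r :: ('a::real_normed_vector \<Rightarrow> real) set)"
proof -
  have ev: "continuous_on UNIV (\<lambda>u::'a \<Rightarrow> real. u x)" for x by (rule continuous_on_eval)
  have "dual_ball r = {u::'a \<Rightarrow> real. (\<forall>x y. u (x + y) = u x + u y) \<and>
    (\<forall>c x. u (c *\<^sub>R x) = c * u x) \<and> (\<forall>x. \<bar>u x\<bar> \<le> r * norm x)}"
    unfolding dual_ball_def linear_iff by auto
  also have "closed \<dots>"
    by (intro closed_Collect_conj closed_Collect_all closed_Collect_eq closed_Collect_le
        continuous_on_add continuous_on_mult continuous_on_const continuous_on_rabs ev)
  finally show ?thesis .
qed

text \<open>Banach--Alaoglu: the ball is a closed subset of a product of intervals.\<close>

lemma compact_dual_ball: "compact (dual_ball r :: ('a::real_normed_vector \<Rightarrow> real) set)"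
proof -
  have "compact {w::'a \<Rightarrow> real. \<forall>x. w x \<in> {- (r * norm x)..r * norm x}}"
    by (rule compact_product) simp
  then have "compact ({w::'a \<Rightarrow> real. \<forall>x. w x \<in> {- (r * norm x)..r * norm x}} \<inter> dual_ball r)"
    using closed_dual_ball by (rule compact_Int_closed)
  moreover have "{w::'a \<Rightarrow> real. \<forall>x. w x \<in> {- (r * norm x)..r * norm x}} \<inter> dual_ball r = dual_ball r"
    unfolding dual_ball_def by (auto simp: abs_le_iff minus_le_iff)
  ultimately show ?thesis by simp
qed

lemma pconvex_dual_ball: "pconvex (dual_ball r)"
  unfolding pconvex_def
proof (intro ballI allI impI)
  fix u v :: "'a \<Rightarrow> real" and t :: real
  assume u: "u \<in> dual_ball r" and v: "v \<in> dual_ball r" and t: "0 \<le> t" "t \<le> 1"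
  have "\<bar>(1 - t) * u x + t * v x\<bar> \<le> (1 - t) * (r * norm x) + t * (r * norm x)" for x
    using u v t unfolding dual_ball_def
    by (intro order.trans[OF abs_triangle_ineq] add_mono) (auto simp: abs_mult intro: mult_left_mono)
  then have "\<bar>(1 - t) * u x + t * v x\<bar> \<le> r * norm x" for x
    by (simp add: algebra_simps)
  moreover have "linear (\<lambda>x. (1 - t) * u x + t * v x)"
    using u v unfolding dual_ball_def linear_iff by (auto simp: algebra_simps)
  ultimately show "(\<lambda>x. (1 - t) * u x + t * v x) \<in> dual_ball r"
    unfolding dual_ball_def by blast
qed

text \<open>Rational combinations are coded by lists, so countability is immediate and induction
  over the span prepends one term at a time.\<close>

lemma countable_dense_in_span:
  fixes C :: "'a::real_normed_vector set"
  assumes "countable C"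
  shows "\<exists>Z. countable Z \<and> (\<forall>y\<in>span C. \<forall>e>0. \<exists>z\<in>Z. norm (y - z) < e)"
proof -
  define s where "s xs = (\<Sum>(q, c)\<leftarrow>xs. of_rat q *\<^sub>R c)" for xs :: "(rat \<times> 'a) list"
  define Z where "Z = s ` lists (UNIV \<times> C)"
  have "countable Z" unfolding Z_def using assms by (intro countable_image countable_lists) auto
  moreover have "\<forall>e>0. \<exists>z\<in>Z. norm (y - z) < e" if "y \<in> span C" for y
    using that
  proof (induction rule: span_induct_alt)
    case base
    have "0 \<in> Z" unfolding Z_def s_def by (rule image_eqI[of _ _ "[]"]) auto
    then show ?case by force
  next
    case (step c x y)
    show ?case
    proof (intro allI impI)
      fix e :: real assume e: "0 < e"
      obtain z where z: "z \<in> Z" "norm (y - z) < e / 2"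
        using step.IH e by (meson half_gt_zero)
      then obtain xs where xs: "xs \<in> lists (UNIV \<times> C)" "z = s xs" unfolding Z_def by blast
      define N where "N = norm x + 1"
      have N: "0 < N" unfolding N_def by (simp add: add_nonneg_pos)
      define \<delta> where "\<delta> = e / (2 * N)"
      have d: "0 < \<delta>" unfolding \<delta>_def using e N by simp
      obtain q where q: "c < of_rat q" "of_rat q < c + \<delta>"
        using of_rat_dense[of c "c + \<delta>"] d by auto
      have "norm (c *\<^sub>R x - of_rat q *\<^sub>R x) = \<bar>c - of_rat q\<bar> * norm x"
        by (metis norm_scaleR scaleR_diff_left)
      also have "\<dots> \<le> \<delta> * N"
        unfolding N_def using q by (intro mult_mono) auto
      also have "\<dots> = e / 2"
        unfolding \<delta>_def using N by simp
      finally have "norm (c *\<^sub>R x + y - (of_rat q *\<^sub>R x + z)) < e"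
        using z(2) norm_triangle_ineq[of "c *\<^sub>R x - of_rat q *\<^sub>R x" "y - z"]
        by (simp add: algebra_simps)
      moreover have "of_rat q *\<^sub>R x + z \<in> Z"
        unfolding Z_def xs(2) by (rule image_eqI[of _ _ "(q, x) # xs"]) (use xs(1) step.hyps in \<open>auto simp: s_def\<close>)
      ultimately show "\<exists>z\<in>Z. norm (c *\<^sub>R x + y - z) < e" by blast
    qed
  qed
  ultimately show ?thesis by blast
qed

section \<open>A convergent sequence or an independent tree\<close>

text \<open>Complex functionals are represented by their real parts: \<open>J\<close> is the multiplication by \<open>\<i>\<close> for complex
  scalars and \<open>0\<close> for real scalars, and \<open>hat u x\<close> below is the complex conjugate of the value at \<open>x\<close> of the
  functional with real part \<open>u\<close>.\<close>

locale approximated_functional =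
  fixes J :: "'a::real_normed_vector \<Rightarrow> 'a" and \<Phi> :: "('a \<Rightarrow> real) \<Rightarrow> real"
    and D :: "'a set" and M :: real
  assumes linear_J: "linear J" and norm_J: "norm (J x) \<le> norm x"
    and convex_D: "convex D" and approx: "approximable D \<Phi>"
    and bound: "u \<in> dual_ball 1 \<Longrightarrow> \<bar>\<Phi> u\<bar> \<le> M"
begin

text \<open>For complex scalars this is the real part of \<open>\<theta>\<close> times the
  functional with real part \<open>u\<close>. Half-plane conditions on values thereby become bounds
  on real functionals.\<close>

definition rot :: "complex \<Rightarrow> ('a \<Rightarrow> real) \<Rightarrow> 'a \<Rightarrow> real" where
  "rot \<theta> u = (\<lambda>x. Re \<theta> * u x + Im \<theta> * u (J x))"

definition hat :: "('a \<Rightarrow> real) \<Rightarrow> 'a \<Rightarrow> complex" where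
  "hat u x = Complex (u x) (u (J x))"

definition \<Phi>hat :: "('a \<Rightarrow> real) \<Rightarrow> complex" where
  "\<Phi>hat u = Complex (\<Phi> u) (\<Phi> (\<lambda>x. u (J x)))"

lemma bounded_linear_J: "bounded_linear J"
  using linear_J norm_J by (intro bounded_linear_intro[of J 1]) (auto simp: linear_add linear_scale)

lemma bounded_linear_comp_J: "bounded_linear u \<Longrightarrow> bounded_linear (\<lambda>x. u (J x))"
  using bounded_linear_compose bounded_linear_J by blast

lemma rot_eq: "rot \<theta> u x = \<theta> \<bullet> hat u x"
  unfolding rot_def hat_def by (simp add: inner_complex_def)

lemma bounded_linear_rot: "bounded_linear u \<Longrightarrow> bounded_linear (rot \<theta> u)"
  unfolding rot_def
  by (intro bounded_linear_add bounded_linear_const_mult bounded_linear_comp_J)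

lemma \<Phi>_rot: "bounded_linear u \<Longrightarrow> \<Phi> (rot \<theta> u) = \<theta> \<bullet> \<Phi>hat u"
  unfolding rot_def \<Phi>hat_def
  using approximable_lincomb[OF approx _ bounded_linear_comp_J, of u u "Re \<theta>" "Im \<theta>"]
  by (simp add: inner_complex_def)

lemma compact_rot: "compact Q \<Longrightarrow> compact (rot \<theta> ` Q)"
  unfolding rot_def
  by (rule compact_continuous_image, rule continuous_on_coordinatewise_then_product,
      intro continuous_on_add continuous_on_mult continuous_on_const continuous_on_eval)

lemma rot_combination:
  "rot \<theta> (\<lambda>x. a * u x + b * v x) = (\<lambda>x. a * rot \<theta> u x + b * rot \<theta> v x)"
  unfolding rot_def by (auto simp: algebra_simps)

lemma pconvex_rot: "pconvex Q \<Longrightarrow> pconvex (rot \<theta> ` Q)"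
  unfolding pconvex_def by (auto simp: rot_combination[symmetric])

lemma hat_diff_le:
  assumes "u \<in> dual_ball 1"
  shows "cmod (hat u x - hat u y) \<le> 2 * norm (x - y)"
proof -
  have lin: "linear u" and le: "\<bar>u z\<bar> \<le> norm z" for z
    using assms unfolding dual_ball_def by auto
  have "hat u x - hat u y = Complex (u (x - y)) (u (J (x - y)))"
    unfolding hat_def using lin linear_J by (simp add: linear_diff complex_eq_iff)
  then have "cmod (hat u x - hat u y) \<le> \<bar>u (x - y)\<bar> + \<bar>u (J (x - y))\<bar>"
    using cmod_le by (metis complex.sel)
  then show ?thesis using le[of "x - y"] le[of "J (x - y)"] norm_J[of "x - y"] by linarith
qed

lemma norm_\<Phi>hat:
  assumes "u \<in> dual_ball 1"
  shows "cmod (\<Phi>hat u) \<le> 2 * M"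
proof -
  have "\<bar>u (J x)\<bar> \<le> norm x" for x
    using assms norm_J[of x] order.trans unfolding dual_ball_def by fastforce
  then have "(\<lambda>x. u (J x)) \<in> dual_ball 1"
    using linear_compose[OF linear_J, of u] assms unfolding dual_ball_def by (auto simp: o_def)
  then show ?thesis
    using bound[OF assms] bound cmod_le[of "\<Phi>hat u"] unfolding \<Phi>hat_def by fastforce
qed

section \<open>Countable covers by pieces of small oscillation\<close>

definition small_piece :: "real \<Rightarrow> ('a \<Rightarrow> real) set \<Rightarrow> bool" where
  "small_piece \<epsilon> Q \<longleftrightarrow> compact Q \<and> pconvex Q \<and> Q \<subseteq> dual_ball 1 \<and> (\<forall>u\<in>Q. \<forall>v\<in>Q. \<bar>\<Phi> u - \<Phi> v\<bar> \<le> \<epsilon>)"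

definition covered :: "real \<Rightarrow> ('a \<Rightarrow> real) set \<Rightarrow> bool" where
  "covered \<epsilon> S \<longleftrightarrow> (\<exists>\<Q>. countable \<Q> \<and> (\<forall>Q\<in>\<Q>. small_piece \<epsilon> Q) \<and> S \<subseteq> \<Union>\<Q>)"

lemma covered_subset: "covered \<epsilon> S \<Longrightarrow> T \<subseteq> S \<Longrightarrow> covered \<epsilon> T"
  unfolding covered_def by (meson order.trans)

lemma covered_UN:
  assumes "countable \<S>" "\<And>S. S \<in> \<S> \<Longrightarrow> covered \<epsilon> (f S)"
  shows "covered \<epsilon> (\<Union>S\<in>\<S>. f S)"
proof -
  have "\<forall>S\<in>\<S>. \<exists>\<Q>. countable \<Q> \<and> (\<forall>Q\<in>\<Q>. small_piece \<epsilon> Q) \<and> f S \<subseteq> \<Union>\<Q>"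
    using assms(2) unfolding covered_def by blast
  then obtain q where q: "\<forall>S\<in>\<S>. countable (q S) \<and> (\<forall>Q\<in>q S. small_piece \<epsilon> Q) \<and> f S \<subseteq> \<Union>(q S)"
    by metis
  have "countable (\<Union>(q ` \<S>))" using assms(1) q by blast
  moreover have "\<forall>Q\<in>\<Union>(q ` \<S>). small_piece \<epsilon> Q" using q by blast
  moreover have "(\<Union>S\<in>\<S>. f S) \<subseteq> \<Union>(\<Union>(q ` \<S>))" using q by fastforce
  ultimately show ?thesis unfolding covered_def by blast
qed

lemma covered_Un: "covered \<epsilon> S \<Longrightarrow> covered \<epsilon> T \<Longrightarrow> covered \<epsilon> (S \<union> T)"
  using covered_UN[of "{S, T}" \<epsilon> "\<lambda>x. x"] by auto

text \<open>Stage \<open>n\<close> treats the first \<open>n + 1\<close> pieces of the first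
  \<open>n + 1\<close> covers simultaneously. Each \<open>u\<close> lies in some piece of every
  cover, so it is treated with every accuracy from some stage on.\<close>

lemma converging_sequence:
  assumes cov: "\<And>\<epsilon>. 0 < \<epsilon> \<Longrightarrow> covered \<epsilon> (dual_ball 1)"
  shows "\<exists>y::nat \<Rightarrow> 'a. (\<forall>n. y n \<in> D) \<and> (\<forall>u. bounded_linear u \<longrightarrow> (\<lambda>n. u (y n)) \<longlonglongrightarrow> \<Phi> u)"
proof -
  define e where "e k = 1 / real (Suc k)" for k
  have e: "0 < e k" for k unfolding e_def by simp
  have emono: "e n \<le> e k" if "k \<le> n" for k n
    unfolding e_def using that by (intro divide_left_mono) auto
  have "\<exists>\<Q>. countable \<Q> \<and> (\<forall>Q\<in>\<Q>. small_piece (e k) Q) \<and> dual_ball 1 \<subseteq> \<Union>\<Q>" for k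
    using cov[OF e] unfolding covered_def .
  then obtain \<Q> where \<Q>: "\<And>k. countable (\<Q> k)" "\<And>k Q. Q \<in> \<Q> k \<Longrightarrow> small_piece (e k) Q"
    "\<And>k. dual_ball 1 \<subseteq> \<Union>(\<Q> k)"
    by (metis (no_types, lifting))
  have ne: "\<Q> k \<noteq> {}" for k using \<Q>(3)[of k] zero_in_dual_ball[of 1] by force
  define Q where "Q k j = from_nat_into (\<Q> k) j" for k j
  have Qin: "Q k j \<in> \<Q> k" for k j unfolding Q_def using ne by (rule from_nat_into)
  have Qall: "\<exists>j. u \<in> Q k j" if u: "u \<in> dual_ball 1" for u k
  proof -
    obtain S where S: "S \<in> \<Q> k" "u \<in> S" using \<Q>(3)[of k] u by blast
    have "Q k (to_nat_on (\<Q> k) S) = S"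
      unfolding Q_def using \<Q>(1) S(1) by simp
    then show ?thesis using S(2) by blast
  qed
  have Q: "compact (Q k j)" "pconvex (Q k j)" "Q k j \<subseteq> dual_ball 1"
    and osc: "u \<in> Q k j \<Longrightarrow> v \<in> Q k j \<Longrightarrow> \<bar>\<Phi> u - \<Phi> v\<bar> \<le> e k" for k j u v
    using \<Q>(2)[OF Qin[of k j]] unfolding small_piece_def by auto
  have neg: "\<Phi> (rot (- 1) u) = - \<Phi> u" if "bounded_linear u" for u
    using \<Phi>_rot[OF that, of "- 1"] by (simp add: \<Phi>hat_def inner_complex_def)
  define q where "q k j = (SOME u. u \<in> Q k j)" for k j
  have q: "q k j \<in> Q k j" if "u \<in> Q k j" for u k j unfolding q_def using that by (rule someI[where P = "\<lambda>u. u \<in> Q k j"])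
  have "\<exists>y\<in>D. \<forall>k\<le>n. \<forall>j\<le>n. \<forall>u\<in>Q k j. \<bar>u y - \<Phi> u\<bar> \<le> 2 * e k + e n" for n
  proof -
    \<comment> \<open>Only upper bounds can be prescribed; the reflected piece in \<open>P2\<close>
      turns the lower bound into one. The value at the reference point \<open>q k j\<close> differs
      from all values of \<open>\<Phi>\<close> on the piece by at most \<open>e k\<close>.\<close>
    define P1 P2 where "P1 p = (Q (fst p) (snd p), \<Phi> (q (fst p) (snd p)) + e (fst p))"
      and "P2 p = (rot (- 1) ` Q (fst p) (snd p), - \<Phi> (q (fst p) (snd p)) + e (fst p))" for p
    have "\<exists>y\<in>D. \<forall>(S, c)\<in>P1 ` ({..n} \<times> {..n}) \<union> P2 ` ({..n} \<times> {..n}). \<forall>u\<in>S. u y < c + e n"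
    proof (rule approximable_uniformly[OF approx convex_D _ e])
      fix S c assume "(S, c) \<in> P1 ` ({..n} \<times> {..n}) \<union> P2 ` ({..n} \<times> {..n})"
      then consider k j where "S = Q k j" "c = \<Phi> (q k j) + e k"
        | k j where "S = rot (- 1) ` Q k j" "c = - \<Phi> (q k j) + e k"
        unfolding P1_def P2_def by auto
      then show "compact S \<and> pconvex S \<and> (\<forall>u\<in>S. bounded_linear u \<and> \<Phi> u \<le> c)"
      proof cases
        case 1
        have "\<Phi> u \<le> c" if u: "u \<in> Q k j" for u
          using osc[OF u q[OF u]] 1(2) by linarith
        then show ?thesis using Q[of k j] 1 dual_ball_bounded_linear by blast
      next
        case 2
        have "bounded_linear (rot (- 1) u) \<and> \<Phi> (rot (- 1) u) \<le> c" if u: "u \<in> Q k j" for u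
        proof -
          have bl: "bounded_linear u" using u Q(3) dual_ball_bounded_linear by blast
          show ?thesis
            using osc[OF u q[OF u]] 2(2) neg[OF bl] bounded_linear_rot[OF bl] by auto
        qed
        then show ?thesis using Q[of k j] 2 compact_rot pconvex_rot by auto
      qed
    qed auto
    then obtain y where y: "y \<in> D"
      "\<And>S c u. (S, c) \<in> P1 ` ({..n} \<times> {..n}) \<union> P2 ` ({..n} \<times> {..n}) \<Longrightarrow> u \<in> S \<Longrightarrow> u y < c + e n"
      by blast
    have "\<bar>u y - \<Phi> u\<bar> \<le> 2 * e k + e n" if kj: "k \<le> n" "j \<le> n" and u: "u \<in> Q k j" for k j u
    proof -
      have "u y < \<Phi> (q k j) + e k + e n"
        using kj u by (intro y(2)[of "Q k j"]) (auto simp: P1_def image_iff intro!: bexI[of _ "(k, j)"])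
      moreover have "rot (- 1) u y < - \<Phi> (q k j) + e k + e n"
        using kj u by (intro y(2)[of "rot (- 1) ` Q k j"])
          (auto simp: P2_def image_iff intro!: disjI2 bexI[of _ "(k, j)"])
      moreover have "rot (- 1) u y = - u y" unfolding rot_def by simp
      ultimately show ?thesis using osc[OF u q[OF u]] by linarith
    qed
    then show ?thesis using y(1) by blast
  qed
  then obtain y where y: "\<And>n. y n \<in> D"
    and close: "\<And>n k j u. k \<le> n \<Longrightarrow> j \<le> n \<Longrightarrow> u \<in> Q k j \<Longrightarrow> \<bar>u (y n) - \<Phi> u\<bar> \<le> 2 * e k + e n"
    by metis
  have ball: "(\<lambda>n. u (y n)) \<longlonglongrightarrow> \<Phi> u" if u: "u \<in> dual_ball 1" for u
  proof (rule LIMSEQ_I)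
    fix r :: real assume r: "0 < r"
    \<comment> \<open>For \<open>n \<ge> max k j\<close> the error is at most
      \<open>2 * e k + e n \<le> 3 * e k\<close>.\<close>
    obtain k where "e k < r / 3" using reals_Archimedean[of "r / 3"] r unfolding e_def
      by (auto simp: inverse_eq_divide)
    obtain j where j: "u \<in> Q k j" using Qall[OF u] by blast
    have "norm (u (y n) - \<Phi> u) < r" if "max k j \<le> n" for n
      using close[OF _ _ j, of n] emono[of k n] that \<open>e k < r / 3\<close> by auto
    then show "\<exists>n0. \<forall>n\<ge>n0. norm (u (y n) - \<Phi> u) < r" by blast
  qed
  have "(\<lambda>n. u (y n)) \<longlonglongrightarrow> \<Phi> u" if u: "bounded_linear u" for u
  proof -
    obtain b where b: "0 < b" "\<And>x. norm (u x) \<le> norm x * b"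
      using bounded_linear.pos_bounded[OF u] by blast
    \<comment> \<open>The summand with coefficient 0 only gives \<open>v\<close> the shape required
      by \<open>approximable_lincomb\<close>.\<close>
    define v where "v = (\<lambda>x. (1 / b) * u x + 0 * u x)"
    have "linear v"
      unfolding v_def using bounded_linear.linear[OF u] unfolding linear_iff by (simp add: algebra_simps)
    then have "v \<in> dual_ball 1"
      unfolding dual_ball_def using b by (auto simp: v_def abs_mult field_simps)
    then have "(\<lambda>n. b * v (y n)) \<longlonglongrightarrow> b * \<Phi> v" by (intro tendsto_intros ball)
    moreover have "\<Phi> v = (1 / b) * \<Phi> u + 0 * \<Phi> u"
      unfolding v_def by (rule approximable_lincomb[OF approx u u])
    ultimately show ?thesis using b(1) by (simp add: v_def)
  qed
  then show ?thesis using y by blast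
qed

end

section \<open>Plane geometry of a diametral pair\<close>

text \<open>If \<open>z\<close> is roughly within distance \<open>d\<close> of \<open>\<beta>\<close> and on the far side of the line through \<open>\<alpha>\<close> orthogonal to \<open>\<beta> - \<alpha>\<close>,
  then \<open>z\<close> is close to \<open>\<alpha>\<close>. The disc is replaced by two half planes, since \<open>approximable_uniformly\<close>
  yields linear bounds only; their normals are tilted by the angle with cosine \<open>1023/1025\<close>.\<close>

lemma near_of_half_planes:
  fixes z \<alpha> \<beta> \<omega> :: complex
  assumes \<omega>: "cmod \<omega> = 1" and \<beta>: "\<beta> = \<alpha> + of_real d * \<omega>" and d: "0 < d"
    and \<eta>: "0 \<le> \<eta>" "10000 * \<eta> \<le> d"
    and h0: "\<omega> \<bullet> z \<le> \<omega> \<bullet> \<alpha> + 3 * \<eta>"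
    and h1: "- (\<omega> * Complex (1023 / 1025) (64 / 1025)) \<bullet> z
      \<le> - (\<omega> * Complex (1023 / 1025) (64 / 1025)) \<bullet> \<beta> + d + 3 * \<eta>"
    and h2: "- (\<omega> * Complex (1023 / 1025) (- 64 / 1025)) \<bullet> z
      \<le> - (\<omega> * Complex (1023 / 1025) (- 64 / 1025)) \<bullet> \<beta> + d + 3 * \<eta>"
  shows "cmod (z - \<alpha>) \<le> d / 16"
proof -
  \<comment> \<open>In this coordinate \<open>\<alpha>\<close> is 0 and \<open>\<beta>\<close> is
    the positive real number \<open>d\<close>.\<close>
  define w where "w = cnj \<omega> * (z - \<alpha>)"
  have \<omega>\<omega>: "\<omega> * cnj \<omega> = 1" using \<omega> by (simp add: complex_norm_square[symmetric])
  have zw: "z = \<alpha> + \<omega> * w" unfolding w_def using \<omega>\<omega> by (simp add: mult.assoc[symmetric])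
  have inner_mult: "(\<omega> * a) \<bullet> (\<omega> * b) = a \<bullet> b" for a b
  proof -
    have "(\<omega> * a) \<bullet> (\<omega> * b) = Re ((\<omega> * cnj \<omega>) * (cnj a * b))"
      unfolding inner_complex_def by (simp add: algebra_simps)
    then show ?thesis unfolding \<omega>\<omega> inner_complex_def by simp
  qed
  have s: "Re w \<le> 3 * \<eta>"
    using h0 inner_mult[of 1 w] unfolding zw inner_add_right by (simp add: inner_complex_def)
  have *: "- (\<omega> * e) \<bullet> z \<le> - (\<omega> * e) \<bullet> \<beta> + d + 3 * \<eta> \<longleftrightarrow> Re e * d - d - 3 * \<eta> \<le> e \<bullet> w" for e
    unfolding zw \<beta> inner_add_right inner_minus_left inner_mult
    using inner_mult[of e "of_real d"] by (simp add: mult.commute[of "of_real d"] inner_complex_def[of e "of_real d"])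
      linarith
  \<comment> \<open>The normals are exact unit vectors because 1023, 64, 1025 is a Pythagorean
    triple (\<open>32\<^sup>2 - 1\<close>, \<open>2 * 32\<close>, \<open>32\<^sup>2 + 1\<close>). Up
    to multiples of \<open>\<eta>\<close>, these bounds and \<open>Re w \<le> 3 * \<eta>\<close>
    leave at most \<open>2 * d / 64 = d / 32\<close> for the imaginary part and
    \<open>2 * d / 1023\<close> for the real part, well inside \<open>d / 16\<close>.\<close>
  have "1023 * d - 1025 * (d + 3 * \<eta>) \<le> 1023 * Re w + 64 * Im w"
    "1023 * d - 1025 * (d + 3 * \<eta>) \<le> 1023 * Re w - 64 * Im w"
    using h1 h2 unfolding * by (simp_all add: inner_complex_def field_simps)
  then have "\<bar>Re w\<bar> + \<bar>Im w\<bar> \<le> d / 16"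
    using s d \<eta> by (auto simp: abs_if)
  then have "cmod w \<le> d / 16" using cmod_le[of w] by linarith
  then show ?thesis unfolding zw using \<omega> by (simp add: norm_mult)
qed

text \<open>Dependent choice with the whole list chosen so far as its state, since the tree
  invariant refers to all earlier vectors.\<close>

lemma extend_lists:
  assumes base: "P []" and step: "\<And>ys. P ys \<Longrightarrow> \<exists>y. P (ys @ [y])"
  shows "\<exists>f::nat \<Rightarrow> 'b. \<forall>n. P (map f [0..<n])"
proof -
  define nxt where "nxt ys = (SOME y. P (ys @ [y]))" for ys
  define g where "g = rec_nat [] (\<lambda>_ ys. ys @ [nxt ys])"
  have gS: "g 0 = []" "g (Suc n) = g n @ [nxt (g n)]" for n unfolding g_def by auto
  have P: "P (g n)" for n
  proof (induction n)
    case (Suc n)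
    then show ?case unfolding gS nxt_def using someI_ex[OF step] by blast
  qed (simp add: gS base)
  have "map (\<lambda>n. nxt (g n)) [0..<n] = g n" for n
    by (induction n) (auto simp: gS)
  then show ?thesis using P by metis
qed

context approximated_functional
begin

section \<open>Closed convex hulls and the remainder after derivation\<close>

definition pc_hull :: "('a \<Rightarrow> real) set \<Rightarrow> ('a \<Rightarrow> real) set" where
  "pc_hull S = \<Inter>{Q. closed Q \<and> pconvex Q \<and> S \<subseteq> Q}"

lemma pc_hull_minimal: "closed Q \<Longrightarrow> pconvex Q \<Longrightarrow> S \<subseteq> Q \<Longrightarrow> pc_hull S \<subseteq> Q"
  unfolding pc_hull_def by blast

lemma pc_hull_subset: "S \<subseteq> pc_hull S"
  unfolding pc_hull_def by blast

lemma pc_hull_mono: "S \<subseteq> T \<Longrightarrow> pc_hull S \<subseteq> pc_hull T"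
  unfolding pc_hull_def by blast

lemma closed_pc_hull: "closed (pc_hull S)"
  unfolding pc_hull_def by (rule closed_Inter) blast

lemma pconvex_pc_hull: "pconvex (pc_hull S)"
  unfolding pc_hull_def by (rule pconvex_Inter) blast

lemma pc_hull_dual_ball: "S \<subseteq> dual_ball 1 \<Longrightarrow> pc_hull S \<subseteq> dual_ball 1"
  using closed_dual_ball pconvex_dual_ball by (intro pc_hull_minimal)

lemma compact_pc_hull: "S \<subseteq> dual_ball 1 \<Longrightarrow> compact (pc_hull S)"
  using compact_Int_closed[OF compact_dual_ball closed_pc_hull] pc_hull_dual_ball
  by (metis inf.absorb_iff2)

text \<open>The opposite inequality defines a closed convex half space, which contains the hull as
  soon as it contains \<open>S\<close>. This is the only passage from hull points back to points of
  the set.\<close>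

lemma rot_less_on_hull:
  assumes "u \<in> pc_hull S" "rot \<theta> u y < c"
  shows "\<exists>v\<in>S. rot \<theta> v y < c"
proof (rule ccontr)
  assume neg: "\<not> ?thesis"
  have "continuous_on UNIV (\<lambda>u. rot \<theta> u y)"
    unfolding rot_def by (intro continuous_on_add continuous_on_mult continuous_on_const continuous_on_eval)
  then have "closed {u. c \<le> rot \<theta> u y}"
    by (intro closed_Collect_le continuous_on_const)
  moreover have "pconvex {u. c \<le> rot \<theta> u y}"
    unfolding pconvex_def
  proof (safe)
    fix u v and t :: real assume "c \<le> rot \<theta> u y" "c \<le> rot \<theta> v y" "0 \<le> t" "t \<le> 1"
    then have "(1 - t) * c + t * c \<le> (1 - t) * rot \<theta> u y + t * rot \<theta> v y"
      by (intro add_mono mult_left_mono) auto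
    then show "c \<le> rot \<theta> (\<lambda>x. (1 - t) * u x + t * v x) y"
      unfolding rot_combination by (simp add: algebra_simps)
  qed
  ultimately have "pc_hull S \<subseteq> {u. c \<le> rot \<theta> u y}"
    using neg by (intro pc_hull_minimal) (auto simp: not_less)
  then show False using assms by auto
qed

text \<open>Reading off countably many coordinates makes Lindelof's theorem available for families
  of windows.\<close>

definition window :: "(nat \<Rightarrow> 'a) \<Rightarrow> (nat \<Rightarrow> real) set \<Rightarrow> ('a \<Rightarrow> real) set" where
  "window z U = {u \<in> dual_ball 1. (\<lambda>n. u (z n)) \<in> U}"

text \<open>\<open>R\<close> is what remains after discarding all coverable windows. If the hull of
  \<open>window z U \<inter> R\<close> had small oscillation, this hull together with the discarded
  part would cover the window, which would then have been discarded itself.\<close>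

lemma bad_remainder:
  assumes "\<not> covered \<epsilon> (dual_ball 1)"
  shows "\<exists>R\<subseteq>dual_ball 1. R \<noteq> {} \<and> (\<forall>U. open U \<longrightarrow> window z U \<inter> R \<noteq> {} \<longrightarrow>
    (\<exists>u\<in>pc_hull (window z U \<inter> R). \<exists>v\<in>pc_hull (window z U \<inter> R). \<epsilon> < \<bar>\<Phi> u - \<Phi> v\<bar>))"
proof -
  define \<G> where "\<G> = {U. open U \<and> covered \<epsilon> (window z U)}"
  obtain \<G>' where \<G>': "\<G>' \<subseteq> \<G>" "countable \<G>'" "\<Union>\<G>' = \<Union>\<G>"
    using Lindelof[of \<G>] unfolding \<G>_def by blast
  define G where "G = \<Union>\<G>"
  have "window z G = (\<Union>U\<in>\<G>'. window z U)" unfolding G_def \<G>'(3)[symmetric] window_def by auto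
  moreover have "covered \<epsilon> (\<Union>U\<in>\<G>'. window z U)"
    using \<G>'(1,2) unfolding \<G>_def by (intro covered_UN) auto
  ultimately have G: "covered \<epsilon> (window z G)" by simp
  define R where "R = dual_ball 1 - window z G"
  have "R \<noteq> {}"
    using covered_subset[OF G] assms unfolding R_def by blast
  moreover have "\<exists>u\<in>pc_hull (window z U \<inter> R). \<exists>v\<in>pc_hull (window z U \<inter> R). \<epsilon> < \<bar>\<Phi> u - \<Phi> v\<bar>"
    if U: "open U" "window z U \<inter> R \<noteq> {}" for U
  proof (rule ccontr)
    assume neg: "\<not> ?thesis"
    have sub: "window z U \<inter> R \<subseteq> dual_ball 1" unfolding R_def by blast
    have "small_piece \<epsilon> (pc_hull (window z U \<inter> R))"
      unfolding small_piece_def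
      using neg compact_pc_hull[OF sub] pc_hull_dual_ball[OF sub] pconvex_pc_hull
      by (auto simp: not_less)
    then have "covered \<epsilon> (pc_hull (window z U \<inter> R))"
      unfolding covered_def by (intro exI[of _ "{pc_hull (window z U \<inter> R)}"]) auto
    then have "covered \<epsilon> (pc_hull (window z U \<inter> R) \<union> window z G)"
      using G by (rule covered_Un)
    moreover have "window z U \<subseteq> pc_hull (window z U \<inter> R) \<union> window z G"
      using pc_hull_subset[of "window z U \<inter> R"] unfolding R_def window_def by blast
    ultimately have "covered \<epsilon> (window z U)" by (rule covered_subset)
    then have "U \<subseteq> G" using U(1) unfolding G_def \<G>_def by blast
    then show False using U(2) unfolding R_def window_def by blast
  qed
  ultimately show ?thesis unfolding R_def by (intro exI[of _ R] conjI allI impI) (auto simp: R_def)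
qed

text \<open>The points \<open>\<alpha>\<close> and \<open>\<beta>\<close> come from a finite grid: on a window where the set of grid points met by the values
  of \<open>\<Phi>hat\<close> is minimal, smaller windows meet the same grid points.\<close>

lemma stable_values:
  assumes \<epsilon>: "0 < \<epsilon>" and R: "R \<subseteq> dual_ball 1" "R \<noteq> {}"
    and osc: "\<And>U. open U \<Longrightarrow> window z U \<inter> R \<noteq> {} \<Longrightarrow>
      \<exists>u\<in>pc_hull (window z U \<inter> R). \<exists>v\<in>pc_hull (window z U \<inter> R). \<epsilon> < \<bar>\<Phi> u - \<Phi> v\<bar>"
  shows "\<exists>U0 \<alpha> \<beta> \<eta>. open U0 \<and> window z U0 \<inter> R \<noteq> {} \<and> 0 < \<eta> \<and> 10000 * \<eta> \<le> cmod (\<beta> - \<alpha>) \<and>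
    (\<forall>u\<in>pc_hull (window z U0 \<inter> R). cmod (\<Phi>hat u - \<alpha>) \<le> cmod (\<beta> - \<alpha>) + \<eta> \<and>
       cmod (\<Phi>hat u - \<beta>) \<le> cmod (\<beta> - \<alpha>) + \<eta>) \<and>
    (\<forall>U. open U \<longrightarrow> U \<subseteq> U0 \<longrightarrow> window z U \<inter> R \<noteq> {} \<longrightarrow>
      (\<exists>u\<in>pc_hull (window z U \<inter> R). cmod (\<Phi>hat u - \<alpha>) < \<eta>) \<and>
      (\<exists>u\<in>pc_hull (window z U \<inter> R). cmod (\<Phi>hat u - \<beta>) < \<eta>))"
proof -
  \<comment> \<open>Two values more than \<open>\<epsilon> = 20000 * \<eta>\<close> apart lose only
    \<open>2 * \<eta>\<close> when rounded to grid points, so the diameter found below easily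
    exceeds \<open>10000 * \<eta>\<close>.\<close>
  define \<eta> where "\<eta> = \<epsilon> / 20000"
  have \<eta>: "0 < \<eta>" unfolding \<eta>_def using \<epsilon> by simp
  define H where "H U = pc_hull (window z U \<inter> R)" for U
  have Hball: "H U \<subseteq> dual_ball 1" for U
    unfolding H_def using R by (intro pc_hull_dual_ball) blast
  have Hmono: "H U \<subseteq> H V" if "U \<subseteq> V" for U V
    unfolding H_def using that by (intro pc_hull_mono) (auto simp: window_def)
  have "\<forall>e>0. \<exists>k. finite k \<and> cball (0::complex) (2 * M) \<subseteq> (\<Union>\<gamma>\<in>k. ball \<gamma> e)"
    using compact_cball[of "0::complex" "2 * M"] unfolding compact_eq_totally_bounded by blast
  then obtain \<Gamma> :: "complex set" where \<Gamma>: "finite \<Gamma>" "cball 0 (2 * M) \<subseteq> (\<Union>\<gamma>\<in>\<Gamma>. ball \<gamma> \<eta>)"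
    using \<eta> by blast
  define S where "S U = {\<gamma> \<in> \<Gamma>. \<exists>u\<in>H U. cmod (\<Phi>hat u - \<gamma>) < \<eta>}" for U
  have finS: "finite (S U)" for U unfolding S_def using \<Gamma>(1) by simp
  have Smono: "S U \<subseteq> S V" if "U \<subseteq> V" for U V
    unfolding S_def using Hmono[OF that] by blast
  have near: "\<exists>\<gamma>\<in>S U. cmod (\<Phi>hat u - \<gamma>) < \<eta>" if u: "u \<in> H U" for u U
  proof -
    have "\<Phi>hat u \<in> cball 0 (2 * M)" using norm_\<Phi>hat u Hball by auto
    then obtain \<gamma> where "\<gamma> \<in> \<Gamma>" "cmod (\<Phi>hat u - \<gamma>) < \<eta>"
      using \<Gamma>(2) by (auto simp: dist_norm norm_minus_commute)
    then show ?thesis unfolding S_def using u by blast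
  qed
  define good where "good U \<longleftrightarrow> open U \<and> window z U \<inter> R \<noteq> {}" for U
  have "good UNIV" unfolding good_def window_def using R by auto
  then obtain U0 where U0: "good U0" and min: "\<And>U. good U \<Longrightarrow> card (S U0) \<le> card (S U)"
    using ex_has_least_nat[of good UNIV "\<lambda>U. card (S U)"] by blast
  have S_eq: "S U = S U0" if "good U" "U \<subseteq> U0" for U
    using card_seteq[OF finS Smono[OF that(2)] min[OF that(1)]] .
  obtain u v where uv: "u \<in> H U0" "v \<in> H U0" "\<epsilon> < \<bar>\<Phi> u - \<Phi> v\<bar>"
    using osc U0 unfolding good_def H_def by blast
  obtain a b where ab: "a \<in> S U0" "cmod (\<Phi>hat u - a) < \<eta>" "b \<in> S U0" "cmod (\<Phi>hat v - b) < \<eta>"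
    using near[OF uv(1)] near[OF uv(2)] by blast
  define m where "m p = cmod (snd p - fst p)" for p :: "complex \<times> complex"
  have "finite (S U0 \<times> S U0)" "S U0 \<times> S U0 \<noteq> {}" using finS ab by auto
  then have fin: "finite (m ` (S U0 \<times> S U0))" and ne: "m ` (S U0 \<times> S U0) \<noteq> {}"
    by simp_all
  have "Max (m ` (S U0 \<times> S U0)) \<in> m ` (S U0 \<times> S U0)" by (rule Max_in[OF fin ne])
  then obtain p where p0: "p \<in> S U0 \<times> S U0" "m p = Max (m ` (S U0 \<times> S U0))" by fastforce
  have p: "p \<in> S U0 \<times> S U0" "\<And>q. q \<in> S U0 \<times> S U0 \<Longrightarrow> m q \<le> m p"
    using p0 Max_ge[OF fin] by auto
  define \<alpha> \<beta> where "\<alpha> = fst p" and "\<beta> = snd p"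
  have \<alpha>: "\<alpha> \<in> S U0" and \<beta>: "\<beta> \<in> S U0" using p(1) unfolding \<alpha>_def \<beta>_def by auto
  have max: "cmod (\<gamma>' - \<gamma>) \<le> cmod (\<beta> - \<alpha>)" if "\<gamma> \<in> S U0" "\<gamma>' \<in> S U0" for \<gamma> \<gamma>'
    using p(2)[of "(\<gamma>, \<gamma>')"] that unfolding m_def \<alpha>_def \<beta>_def by simp
  have "\<bar>\<Phi> u - \<Phi> v\<bar> \<le> cmod (\<Phi>hat u - \<Phi>hat v)"
    using abs_Re_le_cmod[of "\<Phi>hat u - \<Phi>hat v"] by (simp add: \<Phi>hat_def)
  also have "\<Phi>hat u - \<Phi>hat v = (\<Phi>hat u - a) + (a - b) + - (\<Phi>hat v - b)" by simp
  also have "cmod \<dots> \<le> cmod (\<Phi>hat u - a) + cmod (a - b) + cmod (\<Phi>hat v - b)"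
    using norm_triangle_ineq[of "(\<Phi>hat u - a) + (a - b)" "- (\<Phi>hat v - b)"]
      norm_triangle_ineq[of "\<Phi>hat u - a" "a - b"] unfolding norm_minus_cancel by linarith
  finally have "\<epsilon> < 2 * \<eta> + cmod (\<beta> - \<alpha>)" using uv ab max[OF ab(3,1)] by linarith
  then have big: "10000 * \<eta> \<le> cmod (\<beta> - \<alpha>)" unfolding \<eta>_def using \<epsilon> by simp
  have upper: "cmod (\<Phi>hat w - \<gamma>) \<le> cmod (\<beta> - \<alpha>) + \<eta>" if w: "w \<in> H U0" and \<gamma>: "\<gamma> \<in> S U0" for w \<gamma>
  proof -
    obtain \<gamma>' where g: "\<gamma>' \<in> S U0" "cmod (\<Phi>hat w - \<gamma>') < \<eta>" using near[OF w] by blast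
    have "cmod (\<Phi>hat w - \<gamma>) \<le> cmod (\<Phi>hat w - \<gamma>') + cmod (\<gamma>' - \<gamma>)"
      using norm_triangle_ineq[of "\<Phi>hat w - \<gamma>'" "\<gamma>' - \<gamma>"] by simp
    then show ?thesis using max[OF \<gamma> g(1)] g(2) by linarith
  qed
  have hit: "\<exists>u\<in>H U. cmod (\<Phi>hat u - \<gamma>) < \<eta>" if "good U" "U \<subseteq> U0" "\<gamma> \<in> S U0" for U \<gamma>
    using that(3) unfolding S_eq[OF that(1,2), symmetric] by (simp add: S_def)
  have "open U0" "window z U0 \<inter> R \<noteq> {}" using U0 unfolding good_def by auto
  moreover have "\<forall>u\<in>pc_hull (window z U0 \<inter> R). cmod (\<Phi>hat u - \<alpha>) \<le> cmod (\<beta> - \<alpha>) + \<eta> \<and>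
       cmod (\<Phi>hat u - \<beta>) \<le> cmod (\<beta> - \<alpha>) + \<eta>"
    using upper[OF _ \<alpha>] upper[OF _ \<beta>] unfolding H_def by simp
  moreover have "\<forall>U. open U \<longrightarrow> U \<subseteq> U0 \<longrightarrow> window z U \<inter> R \<noteq> {} \<longrightarrow>
      (\<exists>u\<in>pc_hull (window z U \<inter> R). cmod (\<Phi>hat u - \<alpha>) < \<eta>) \<and>
      (\<exists>u\<in>pc_hull (window z U \<inter> R). cmod (\<Phi>hat u - \<beta>) < \<eta>)"
    using hit[OF _ _ \<alpha>] hit[OF _ _ \<beta>] unfolding good_def H_def by simp
  ultimately show ?thesis
    using \<eta> big by (intro exI[of _ U0] exI[of _ \<alpha>] exI[of _ \<beta>] exI[of _ \<eta>] conjI)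
qed

section \<open>Growing the independent tree\<close>

text \<open>One \<open>y\<close> has to split all windows of \<open>\<U>\<close>. For each window,
  hull points with values of \<open>\<Phi>hat\<close> near \<open>\<alpha>\<close> and near
  \<open>\<beta>\<close> are fixed, and a single half plane is prescribed for each. The half planes
  bounding the distance from the other point are prescribed once, on the whole hull over
  \<open>U0\<close>. A point of the window that obeys the single half plane at \<open>y\<close> lies
  in that hull and so obeys the others too.\<close>

lemma tree_step:
  fixes z :: "nat \<Rightarrow> 'a"
  assumes R: "R \<subseteq> dual_ball 1"
    and dense: "\<And>y e. y \<in> D \<Longrightarrow> 0 < e \<Longrightarrow> \<exists>n. norm (y - z n) < e"
    and J: "\<And>n. \<exists>m. J (z n) = z m"
    and U0: "open U0" "window z U0 \<inter> R \<noteq> {}"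
    and \<eta>: "0 < \<eta>" "10000 * \<eta> \<le> cmod (\<beta> - \<alpha>)"
    and upper: "\<And>u. u \<in> pc_hull (window z U0 \<inter> R) \<Longrightarrow> cmod (\<Phi>hat u - \<alpha>) \<le> cmod (\<beta> - \<alpha>) + \<eta> \<and>
       cmod (\<Phi>hat u - \<beta>) \<le> cmod (\<beta> - \<alpha>) + \<eta>"
    and hit: "\<And>U. open U \<Longrightarrow> U \<subseteq> U0 \<Longrightarrow> window z U \<inter> R \<noteq> {} \<Longrightarrow>
      (\<exists>u\<in>pc_hull (window z U \<inter> R). cmod (\<Phi>hat u - \<alpha>) < \<eta>) \<and>
      (\<exists>u\<in>pc_hull (window z U \<inter> R). cmod (\<Phi>hat u - \<beta>) < \<eta>)"
    and \<U>: "finite \<U>" "\<And>U. U \<in> \<U> \<Longrightarrow> open U \<and> U \<subseteq> U0 \<and> window z U \<inter> R \<noteq> {}"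
  shows "\<exists>y. (\<exists>y0\<in>D. norm (y0 - y) \<le> 1) \<and> (\<forall>U\<in>\<U>. \<forall>\<gamma>\<in>{\<alpha>, \<beta>}. \<exists>V. open V \<and> V \<subseteq> U \<and> window z V \<inter> R \<noteq> {} \<and>
    (\<forall>u\<in>window z V. cmod (hat u y - \<gamma>) \<le> cmod (\<beta> - \<alpha>) / 8))"
proof -
  define d where "d = cmod (\<beta> - \<alpha>)"
  have d: "0 < d" using \<eta> unfolding d_def by linarith
  define \<omega> where "\<omega> = (\<beta> - \<alpha>) / of_real d"
  have \<omega>: "cmod \<omega> = 1" unfolding \<omega>_def using d by (simp add: norm_divide d_def)
  have \<beta>: "\<beta> = \<alpha> + of_real d * \<omega>" unfolding \<omega>_def using d by simp
  have \<alpha>: "\<alpha> = \<beta> + of_real d * (- \<omega>)" unfolding \<beta> by simp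
  define v1 v2 where "v1 = \<omega> * Complex (1023 / 1025) (64 / 1025)"
    and "v2 = \<omega> * Complex (1023 / 1025) (- 64 / 1025)"
  have v: "cmod v1 = 1" "cmod v2 = 1"
    unfolding v1_def v2_def norm_mult \<omega> by (simp_all add: cmod_def power2_eq_square)
  define H where "H U = pc_hull (window z U \<inter> R)" for U
  have Hball: "H U \<subseteq> dual_ball 1" for U
    unfolding H_def using R by (intro pc_hull_dual_ball) blast
  have H: "compact (H U)" "pconvex (H U)" for U
    unfolding H_def using R by (auto intro: compact_pc_hull pconvex_pc_hull)
  have blH: "bounded_linear u" if "u \<in> H U" for u U
    using that Hball dual_ball_bounded_linear by blast
  define a b where "a U = (SOME u. u \<in> H U \<and> cmod (\<Phi>hat u - \<alpha>) < \<eta>)"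
    and "b U = (SOME u. u \<in> H U \<and> cmod (\<Phi>hat u - \<beta>) < \<eta>)" for U
  have a: "a U \<in> H U" "cmod (\<Phi>hat (a U) - \<alpha>) < \<eta>"
    and b: "b U \<in> H U" "cmod (\<Phi>hat (b U) - \<beta>) < \<eta>" if "U \<in> \<U>" for U
  proof -
    have "\<exists>u. u \<in> H U \<and> cmod (\<Phi>hat u - \<alpha>) < \<eta>" "\<exists>u. u \<in> H U \<and> cmod (\<Phi>hat u - \<beta>) < \<eta>"
      using hit[of U] \<U>(2)[OF that] unfolding H_def by blast+
    from someI_ex[OF this(1)] someI_ex[OF this(2)]
    show "a U \<in> H U" "cmod (\<Phi>hat (a U) - \<alpha>) < \<eta>" "b U \<in> H U" "cmod (\<Phi>hat (b U) - \<beta>) < \<eta>"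
      unfolding a_def b_def by blast+
  qed
  have inner_le: "\<theta> \<bullet> x \<le> \<theta> \<bullet> y + c" if "cmod \<theta> = 1" "cmod (x - y) \<le> c" for \<theta> x y c
    using norm_cauchy_schwarz[of \<theta> "x - y"] that by (simp add: inner_diff_right)
  \<comment> \<open>\<open>P0\<close> bounds the distance from \<open>\<beta>\<close> and from
    \<open>\<alpha>\<close> in two tilted directions each; \<open>P1\<close> and \<open>P2\<close>
    push one hull point per window towards \<open>\<alpha>\<close> and one towards
    \<open>\<beta>\<close>.\<close>
  define P0 where "P0 = (\<lambda>(v, \<gamma>). (rot v ` H U0, v \<bullet> \<gamma> + d + \<eta>)) `
    {(- v1, \<beta>), (- v2, \<beta>), (v1, \<alpha>), (v2, \<alpha>)}"
  define P1 where "P1 = (\<lambda>U. ({rot \<omega> (a U)}, \<omega> \<bullet> \<alpha> + \<eta>)) ` \<U>"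
  define P2 where "P2 = (\<lambda>U. ({rot (- \<omega>) (b U)}, (- \<omega>) \<bullet> \<beta> + \<eta>)) ` \<U>"
  have "\<exists>y\<in>D. \<forall>(Q, c)\<in>P0 \<union> P1 \<union> P2. \<forall>u\<in>Q. u y < c + \<eta>"
  proof (rule approximable_uniformly[OF approx convex_D _ \<eta>(1)])
    show "finite (P0 \<union> P1 \<union> P2)" unfolding P0_def P1_def P2_def using \<U>(1) by simp
    fix Q c assume "(Q, c) \<in> P0 \<union> P1 \<union> P2"
    then consider v \<gamma> where "Q = rot v ` H U0" "c = v \<bullet> \<gamma> + d + \<eta>" "cmod v = 1" "\<gamma> = \<alpha> \<or> \<gamma> = \<beta>"
      | U where "U \<in> \<U>" "Q = {rot \<omega> (a U)}" "c = \<omega> \<bullet> \<alpha> + \<eta>"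
      | U where "U \<in> \<U>" "Q = {rot (- \<omega>) (b U)}" "c = (- \<omega>) \<bullet> \<beta> + \<eta>"
      unfolding P0_def P1_def P2_def using v by auto
    then show "compact Q \<and> pconvex Q \<and> (\<forall>u\<in>Q. bounded_linear u \<and> \<Phi> u \<le> c)"
    proof cases
      case 1
      have "bounded_linear (rot v u) \<and> \<Phi> (rot v u) \<le> c" if u: "u \<in> H U0" for u
      proof -
        have "cmod (\<Phi>hat u - \<gamma>) \<le> d + \<eta>" using upper[of u] u 1(4) unfolding H_def d_def by auto
        then show ?thesis
          using inner_le[OF 1(3)] 1(2) \<Phi>_rot[OF blH[OF u]] bounded_linear_rot[OF blH[OF u]]
          by (simp add: add.assoc)
      qed
      then show ?thesis using 1(1) H compact_rot pconvex_rot by auto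
    next
      case 2
      have "\<Phi> (rot \<omega> (a U)) \<le> c"
        using inner_le[OF \<omega> less_imp_le[OF a(2)[OF 2(1)]]] \<Phi>_rot[OF blH[OF a(1)[OF 2(1)]]] 2(3) by simp
      then show ?thesis
        using 2(2) bounded_linear_rot[OF blH[OF a(1)[OF 2(1)]]] by (simp add: pconvex_singleton)
    next
      case 3
      have "\<Phi> (rot (- \<omega>) (b U)) \<le> c"
        using inner_le[of "- \<omega>", OF _ less_imp_le[OF b(2)[OF 3(1)]]] \<omega>
          \<Phi>_rot[OF blH[OF b(1)[OF 3(1)]]] 3(3) by simp
      then show ?thesis
        using 3(2) bounded_linear_rot[OF blH[OF b(1)[OF 3(1)]]] by (simp add: pconvex_singleton)
    qed
  qed
  then obtain y0 where y0: "y0 \<in> D"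
    and y0P: "\<And>Q c u. (Q, c) \<in> P0 \<union> P1 \<union> P2 \<Longrightarrow> u \<in> Q \<Longrightarrow> u y0 < c + \<eta>" by blast
  obtain n where n: "norm (y0 - z n) < min (\<eta> / 2) 1" using dense[OF y0, of "min (\<eta> / 2) 1"] \<eta>(1) by auto
  \<comment> \<open>Taking \<open>y\<close> from the enumeration \<open>z\<close> instead of from
    \<open>D\<close> makes \<open>y\<close> and \<open>J y\<close> coordinates of windows, so that
    closeness of \<open>hat u y\<close> to a value is an open condition.\<close>
  define y where "y = z n"
  obtain m where m: "J y = z m" using J[of n] unfolding y_def by blast
  have hat_y: "hat u y = Complex (u (z n)) (u (z m))" for u
    unfolding hat_def m[symmetric] y_def ..
  have rot_y: "rot \<theta> u y \<le> rot \<theta> u y0 + \<eta>" if "cmod \<theta> = 1" "u \<in> dual_ball 1" for \<theta> u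
    unfolding rot_eq using hat_diff_le[OF that(2), of y y0] n
    by (intro inner_le[OF that(1)]) (simp add: y_def norm_minus_commute)
  \<comment> \<open>The \<open>3 * \<eta>\<close> here and below collects one \<open>\<eta>\<close>
    each from the grid, from the minimax approximation and from replacing \<open>y0\<close> by
    \<open>y\<close>.\<close>
  have ctrl: "v \<bullet> hat u y \<le> v \<bullet> \<gamma> + d + 3 * \<eta>"
    if "(v, \<gamma>) \<in> {(- v1, \<beta>), (- v2, \<beta>), (v1, \<alpha>), (v2, \<alpha>)}" "u \<in> H U0" for v \<gamma> u
  proof -
    have "rot v u y0 < v \<bullet> \<gamma> + d + \<eta> + \<eta>"
      by (rule y0P[of "rot v ` H U0"]) (use that in \<open>auto simp: P0_def\<close>)
    moreover have "cmod v = 1" using that(1) v by auto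
    ultimately show ?thesis
      using rot_y[of v u] that(2) Hball unfolding rot_eq by fastforce
  qed
  have inH: "u \<in> H U0" if "u \<in> window z U \<inter> R" "U \<in> \<U>" for u U
    using that \<U>(2)[OF that(2)] pc_hull_subset[of "window z U0 \<inter> R"] unfolding H_def window_def by blast
  have near_\<alpha>: "\<exists>u\<in>window z U \<inter> R. cmod (hat u y - \<alpha>) \<le> d / 16" if U: "U \<in> \<U>" for U
  proof -
    have "rot \<omega> (a U) y0 < \<omega> \<bullet> \<alpha> + \<eta> + \<eta>"
      by (rule y0P[of "{rot \<omega> (a U)}"]) (use U in \<open>auto simp: P1_def\<close>)
    then have "rot \<omega> (a U) y < \<omega> \<bullet> \<alpha> + 3 * \<eta>"
      using rot_y[OF \<omega>, of "a U"] a(1)[OF U] Hball by fastforce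
    then obtain u where u: "u \<in> window z U \<inter> R" "rot \<omega> u y < \<omega> \<bullet> \<alpha> + 3 * \<eta>"
      using rot_less_on_hull a(1)[OF U] unfolding H_def by blast
    have "cmod (hat u y - \<alpha>) \<le> d / 16"
      using u(2) ctrl[OF _ inH[OF u(1) U], of "- v1" \<beta>] ctrl[OF _ inH[OF u(1) U], of "- v2" \<beta>] \<eta>
      by (intro near_of_half_planes[OF \<omega> \<beta> d, of \<eta>, folded v1_def v2_def])
        (auto simp: rot_eq d_def)
    then show ?thesis using u(1) by blast
  qed
  \<comment> \<open>The same argument with the two points exchanged and \<open>\<omega>\<close>
    reversed.\<close>
  have near_\<beta>: "\<exists>u\<in>window z U \<inter> R. cmod (hat u y - \<beta>) \<le> d / 16" if U: "U \<in> \<U>" for U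
  proof -
    have "rot (- \<omega>) (b U) y0 < (- \<omega>) \<bullet> \<beta> + \<eta> + \<eta>"
      by (rule y0P[of "{rot (- \<omega>) (b U)}"]) (use U in \<open>auto simp: P2_def\<close>)
    moreover have "rot (- \<omega>) (b U) y \<le> rot (- \<omega>) (b U) y0 + \<eta>"
      using b(1)[OF U] Hball \<omega> by (intro rot_y) auto
    ultimately have "rot (- \<omega>) (b U) y < (- \<omega>) \<bullet> \<beta> + 3 * \<eta>" by linarith
    then obtain u where u: "u \<in> window z U \<inter> R" "rot (- \<omega>) u y < (- \<omega>) \<bullet> \<beta> + 3 * \<eta>"
      using rot_less_on_hull b(1)[OF U] unfolding H_def by blast
    have "cmod (hat u y - \<beta>) \<le> d / 16"
      using u(2) ctrl[OF _ inH[OF u(1) U], of v1 \<alpha>] ctrl[OF _ inH[OF u(1) U], of v2 \<alpha>] \<eta> \<omega>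
      by (intro near_of_half_planes[OF _ \<alpha> d, of \<eta>,
            unfolded mult_minus_left minus_minus, folded v1_def v2_def])
        (auto simp: rot_eq d_def)
    then show ?thesis using u(1) by blast
  qed
  have "\<exists>V. open V \<and> V \<subseteq> U \<and> window z V \<inter> R \<noteq> {} \<and> (\<forall>u\<in>window z V. cmod (hat u y - \<gamma>) \<le> d / 8)"
    if U: "U \<in> \<U>" and \<gamma>: "\<gamma> \<in> {\<alpha>, \<beta>}" for U \<gamma>
  proof -
    obtain u where u: "u \<in> window z U" "u \<in> R" "cmod (hat u y - \<gamma>) \<le> d / 16"
      using near_\<alpha>[OF U] near_\<beta>[OF U] \<gamma> by blast
    \<comment> \<open>A further \<open>d / 16\<close> around the value at \<open>u\<close> leaves
      room for an open set while keeping the total at \<open>d / 8\<close>.\<close>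
    define V where "V = U \<inter> {w. cmod (Complex (w n) (w m) - hat u y) < d / 16}"
    have "continuous_on UNIV (\<lambda>w. cmod (Complex (w n) (w m) - hat u y))"
      unfolding complex_of_real_def[symmetric] Complex_eq
      by (intro continuous_on_norm continuous_on_diff continuous_on_add continuous_on_mult
          continuous_on_of_real continuous_on_const continuous_on_eval)
    then have "open {w. cmod (Complex (w n) (w m) - hat u y) < d / 16}"
      by (intro open_Collect_less continuous_on_const)
    then have "open V" unfolding V_def using \<U>(2)[OF U] by (intro open_Int) auto
    moreover have "u \<in> window z V"
      using u(1) d unfolding window_def V_def by (simp add: hat_y)
    moreover have "cmod (hat w y - \<gamma>) \<le> d / 8" if "w \<in> window z V" for w
    proof -
      have "cmod (hat w y - hat u y) < d / 16"
        using that unfolding window_def V_def by (simp add: hat_y)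
      then show ?thesis
        using norm_triangle_ineq[of "hat w y - hat u y" "hat u y - \<gamma>"] u(3) by simp
    qed
    ultimately show ?thesis using u(2) unfolding V_def by (intro exI[of _ V]) (auto simp: V_def)
  qed
  moreover have "norm (y0 - y) \<le> 1" using n unfolding y_def by simp
  ultimately show ?thesis using y0 unfolding d_def by blast
qed

text \<open>If some \<open>\<epsilon>\<close> admits no cover, \<open>tree_step\<close> is iterated.
  Each level has one vector common to all branches, so every pattern of values near
  \<open>\<alpha>\<close> and \<open>\<beta>\<close> is realised on one and the same
  sequence.\<close>

theorem sequence_or_tree:
  assumes dense: "\<exists>Z. countable Z \<and> (\<forall>y\<in>D. \<forall>e>0. \<exists>z\<in>Z. norm (y - z) < e)"
    and JJ: "\<And>x. J (J x) \<in> {0, - x}"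
  shows "(\<exists>y::nat \<Rightarrow> 'a. (\<forall>n. y n \<in> D) \<and> (\<forall>u. bounded_linear u \<longrightarrow> (\<lambda>n. u (y n)) \<longlonglongrightarrow> \<Phi> u)) \<or>
    (\<exists>\<alpha> \<beta> (y::nat \<Rightarrow> 'a). \<alpha> \<noteq> \<beta> \<and> (\<forall>n. \<exists>y0\<in>D. norm (y0 - y n) \<le> 1) \<and>
      (\<forall>n s. \<exists>u\<in>dual_ball 1. \<forall>i<n. cmod (hat u (y i) - (if i \<in> s then \<beta> else \<alpha>)) \<le> cmod (\<beta> - \<alpha>) / 8))"
proof (cases "\<forall>\<epsilon>>0. covered \<epsilon> (dual_ball 1)")
  case True
  then show ?thesis using converging_sequence by blast
next
  case False
  then obtain \<epsilon> where \<epsilon>: "0 < \<epsilon>" "\<not> covered \<epsilon> (dual_ball 1)" by blast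
  obtain Z0 where Z0: "countable Z0" "\<And>y e. y \<in> D \<Longrightarrow> 0 < e \<Longrightarrow> \<exists>z\<in>Z0. norm (y - z) < e"
    using dense by blast
  \<comment> \<open>Stability under \<open>J\<close> follows from \<open>JJ\<close>: applying
    \<open>J\<close> twice gives 0 or a change of sign.\<close>
  define Z where "Z = insert 0 (Z0 \<union> uminus ` Z0 \<union> J ` Z0 \<union> J ` uminus ` Z0)"
  have Jneg: "J (- x) = - J x" and J0: "J 0 = 0" for x
    using linear_J by (simp_all add: linear_neg linear_0)
  have JZ: "J x \<in> Z" if "x \<in> Z" for x
    using that JJ unfolding Z_def by (auto simp: Jneg J0 image_iff) (metis minus_minus neg_0_equal_iff_equal)+
  have "countable Z" unfolding Z_def using Z0(1) by simp
  moreover have "Z \<noteq> {}" unfolding Z_def by simp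
  ultimately obtain z :: "nat \<Rightarrow> 'a" where z: "range z = Z" by (metis uncountable_def)
  have zdense: "\<exists>n. norm (y - z n) < e" if "y \<in> D" "0 < e" for y e
    using Z0(2)[OF that] z unfolding Z_def by (metis UnI1 insertCI rangeE)
  have zJ: "\<exists>m. J (z n) = z m" for n
    using JZ z by (metis rangeI rangeE)
  obtain R where R: "R \<subseteq> dual_ball 1" "R \<noteq> {}" and osc: "\<And>U. open U \<Longrightarrow> window z U \<inter> R \<noteq> {} \<Longrightarrow>
    \<exists>u\<in>pc_hull (window z U \<inter> R). \<exists>v\<in>pc_hull (window z U \<inter> R). \<epsilon> < \<bar>\<Phi> u - \<Phi> v\<bar>"
    using bad_remainder[OF \<epsilon>(2), of z] by blast
  obtain U0 \<alpha> \<beta> \<eta> where U0: "open U0" "window z U0 \<inter> R \<noteq> {}"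
    and \<eta>: "0 < \<eta>" "10000 * \<eta> \<le> cmod (\<beta> - \<alpha>)"
    and upper: "\<And>u. u \<in> pc_hull (window z U0 \<inter> R) \<Longrightarrow> cmod (\<Phi>hat u - \<alpha>) \<le> cmod (\<beta> - \<alpha>) + \<eta> \<and>
       cmod (\<Phi>hat u - \<beta>) \<le> cmod (\<beta> - \<alpha>) + \<eta>"
    and hit: "\<And>U. open U \<Longrightarrow> U \<subseteq> U0 \<Longrightarrow> window z U \<inter> R \<noteq> {} \<Longrightarrow>
      (\<exists>u\<in>pc_hull (window z U \<inter> R). cmod (\<Phi>hat u - \<alpha>) < \<eta>) \<and>
      (\<exists>u\<in>pc_hull (window z U \<inter> R). cmod (\<Phi>hat u - \<beta>) < \<eta>)"
    using stable_values[OF \<epsilon>(1) R osc] by blast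
  define r where "r = cmod (\<beta> - \<alpha>) / 8"
  define node where "node ys s V \<longleftrightarrow> open V \<and> V \<subseteq> U0 \<and> window z V \<inter> R \<noteq> {} \<and>
    (\<forall>u\<in>window z V. \<forall>i<length ys. cmod (hat u (ys ! i) - (if i \<in> s then \<beta> else \<alpha>)) \<le> r)"
    for ys and s :: "nat set" and V
  define tree where "tree ys \<longleftrightarrow> (\<forall>y\<in>set ys. \<exists>y0\<in>D. norm (y0 - y) \<le> 1) \<and> (\<forall>s\<subseteq>{..<length ys}. \<exists>V. node ys s V)"
    for ys
  have "\<exists>f::nat \<Rightarrow> 'a. \<forall>n. tree (map f [0..<n])"
  proof (rule extend_lists)
    show "tree []" unfolding tree_def node_def using U0 by auto
  next
    fix ys assume ys: "tree ys"
    \<comment> \<open>The windows of all subsets are fixed first, so that one application of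
      \<open>tree_step\<close> splits all of them by the same vector.\<close>
    define V where "V s = (SOME V. node ys s V)" for s
    have V: "node ys s (V s)" if "s \<subseteq> {..<length ys}" for s
      using ys that someI_ex[of "node ys s"] unfolding tree_def V_def by blast
    have "\<exists>y. (\<exists>y0\<in>D. norm (y0 - y) \<le> 1) \<and> (\<forall>U\<in>V ` Pow {..<length ys}. \<forall>\<gamma>\<in>{\<alpha>, \<beta>}. \<exists>V. open V \<and> V \<subseteq> U \<and>
      window z V \<inter> R \<noteq> {} \<and> (\<forall>u\<in>window z V. cmod (hat u y - \<gamma>) \<le> cmod (\<beta> - \<alpha>) / 8))"
      by (rule tree_step[OF R(1) zdense zJ U0 \<eta> upper hit]) (use V in \<open>auto simp: node_def\<close>)
    then obtain y where y: "\<exists>y0\<in>D. norm (y0 - y) \<le> 1"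
      and yV: "\<And>s \<gamma>. s \<subseteq> {..<length ys} \<Longrightarrow> \<gamma> \<in> {\<alpha>, \<beta>} \<Longrightarrow> \<exists>W. open W \<and> W \<subseteq> V s \<and>
        window z W \<inter> R \<noteq> {} \<and> (\<forall>u\<in>window z W. cmod (hat u y - \<gamma>) \<le> r)"
      unfolding r_def by blast
    have "\<exists>W. node (ys @ [y]) s W" if s: "s \<subseteq> {..<length (ys @ [y])}" for s
    proof -
      define s' where "s' = s \<inter> {..<length ys}"
      have s': "s' \<subseteq> {..<length ys}" unfolding s'_def by blast
      define \<gamma> where "\<gamma> = (if length ys \<in> s then \<beta> else \<alpha>)"
      have "\<gamma> \<in> {\<alpha>, \<beta>}" unfolding \<gamma>_def by simp
      from yV[OF s' this] obtain W where W: "open W" "W \<subseteq> V s'" "window z W \<inter> R \<noteq> {}"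
        "\<And>u. u \<in> window z W \<Longrightarrow> cmod (hat u y - \<gamma>) \<le> r"
        by blast
      have "window z W \<subseteq> window z (V s')" using W(2) unfolding window_def by blast
      then have "node (ys @ [y]) s W"
        using W V[OF s'] unfolding node_def s'_def \<gamma>_def by (auto simp: less_Suc_eq nth_append split: if_splits)
      then show ?thesis by blast
    qed
    then show "\<exists>y. tree (ys @ [y])" using ys y unfolding tree_def by (intro exI[of _ y]) auto
  qed
  then obtain f :: "nat \<Rightarrow> 'a" where f: "\<And>n. tree (map f [0..<n])" by blast
  have "\<exists>y0\<in>D. norm (y0 - f n) \<le> 1" for n
    using f[of "Suc n"] unfolding tree_def by auto
  moreover have "\<exists>u\<in>dual_ball 1. \<forall>i<n. cmod (hat u (f i) - (if i \<in> s then \<beta> else \<alpha>)) \<le> r" for n s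
  proof -
    have "\<exists>V. node (map f [0..<n]) (s \<inter> {..<n}) V" using f[of n] unfolding tree_def by auto
    then obtain V u where "node (map f [0..<n]) (s \<inter> {..<n}) V" "u \<in> window z V"
      unfolding node_def by blast
    then show ?thesis unfolding node_def window_def by (intro bexI[of _ u]) auto
  qed
  moreover have "\<alpha> \<noteq> \<beta>" using \<eta> by auto
  ultimately show ?thesis unfolding r_def by blast
qed

end

section \<open>Weak topologies\<close>

lemma topspace_weak_topology: "topspace (weak_topology E Z) = E"
  unfolding weak_topology_def by auto

lemma openin_weak_topology_basic:
  fixes Z :: "('e \<Rightarrow> 'k::metric_space) set"
  assumes "finite N" "N \<subseteq> Z" "x \<in> E"
  shows "openin (weak_topology E Z) {y \<in> E. \<forall>z\<in>N. dist (z y) (z x) < \<epsilon>}"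
  using assms
proof (induction N rule: finite_induct)
  case empty
  then show ?case using openin_topspace[of "weak_topology E Z"] by (simp add: topspace_weak_topology)
next
  case (insert z N)
  have "openin (weak_topology E Z) {y \<in> E. z y \<in> ball (z x) \<epsilon>}"
    unfolding weak_topology_def using insert.prems
    by (intro topology_generated_by_Basis) (use open_ball in blast)
  moreover have "openin (weak_topology E Z) {y \<in> E. \<forall>z\<in>N. dist (z y) (z x) < \<epsilon>}"
    using insert by auto
  ultimately have "openin (weak_topology E Z)
      ({y \<in> E. z y \<in> ball (z x) \<epsilon>} \<inter> {y \<in> E. \<forall>z\<in>N. dist (z y) (z x) < \<epsilon>})"
    by (rule openin_Int)
  moreover have "{y \<in> E. z y \<in> ball (z x) \<epsilon>} \<inter> {y \<in> E. \<forall>z\<in>N. dist (z y) (z x) < \<epsilon>}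
      = {y \<in> E. \<forall>z\<in>insert z N. dist (z y) (z x) < \<epsilon>}"
    by (auto simp: dist_commute)
  ultimately show ?case by simp
qed

text \<open>Finitely many members of \<open>Z\<close> and one radius describe a neighbourhood base;
  the whole set \<open>E\<close> as a generator corresponds to empty \<open>N\<close>.\<close>

lemma weak_topology_neighbourhood:
  fixes Z :: "('e \<Rightarrow> 'k::metric_space) set"
  assumes "openin (weak_topology E Z) T" "x \<in> T"
  shows "\<exists>N \<epsilon>. finite N \<and> N \<subseteq> Z \<and> 0 < \<epsilon> \<and> {y \<in> E. \<forall>z\<in>N. dist (z y) (z x) < \<epsilon>} \<subseteq> T"
proof -
  have "generate_topology_on (insert E {{x\<in>E. \<phi> x \<in> U} | \<phi> U. \<phi> \<in> Z \<and> open U}) T"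
    using assms(1) unfolding weak_topology_def openin_topology_generated_by_iff .
  then show ?thesis using assms(2)
  proof (induction arbitrary: x rule: generate_topology_on.induct)
    case Empty
    then show ?case by simp
  next
    case (Int a b)
    obtain N \<epsilon> where 1: "finite N" "N \<subseteq> Z" "0 < \<epsilon>" "{y \<in> E. \<forall>z\<in>N. dist (z y) (z x) < \<epsilon>} \<subseteq> a"
      using Int.IH(1)[of x] Int.prems by auto
    obtain N' \<epsilon>' where 2: "finite N'" "N' \<subseteq> Z" "0 < \<epsilon>'" "{y \<in> E. \<forall>z\<in>N'. dist (z y) (z x) < \<epsilon>'} \<subseteq> b"
      using Int.IH(2)[of x] Int.prems by auto
    show ?case
      by (rule exI[of _ "N \<union> N'"], rule exI[of _ "min \<epsilon> \<epsilon>'"]) (use 1 2 in auto)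
  next
    case (UN K)
    then obtain k where k: "k \<in> K" "x \<in> k" by blast
    obtain N \<epsilon> where "finite N" "N \<subseteq> Z" "0 < \<epsilon>" "{y \<in> E. \<forall>z\<in>N. dist (z y) (z x) < \<epsilon>} \<subseteq> k"
      using UN.IH[OF k] by blast
    then show ?case using k(1) by (meson Union_upper order.trans)
  next
    case (Basis s)
    show ?case
    proof (cases "s = E")
      case True
      then show ?thesis by (intro exI[of _ "{}"] exI[of _ 1]) auto
    next
      case False
      then obtain \<phi> U where U: "\<phi> \<in> Z" "open U" "s = {x \<in> E. \<phi> x \<in> U}" using Basis.hyps by blast
      then have "\<phi> x \<in> U" using Basis.prems by auto
      then obtain \<epsilon> where "0 < \<epsilon>" "\<And>k. dist k (\<phi> x) < \<epsilon> \<Longrightarrow> k \<in> U"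
        using U(2) unfolding open_dist by blast
      then show ?thesis using U by (intro exI[of _ "{\<phi>}"] exI[of _ \<epsilon>]) auto
    qed
  qed
qed

lemma in_weak_topology_closure:
  fixes Z :: "('e \<Rightarrow> 'k::metric_space) set"
  shows "x \<in> weak_topology E Z closure_of S \<longleftrightarrow>
    x \<in> E \<and> (\<forall>N \<epsilon>. finite N \<longrightarrow> N \<subseteq> Z \<longrightarrow> 0 < \<epsilon> \<longrightarrow> (\<exists>s\<in>S \<inter> E. \<forall>z\<in>N. dist (z s) (z x) < \<epsilon>))"
    (is "?L \<longleftrightarrow> ?R")
proof
  assume L: ?L
  then have x: "x \<in> E" unfolding in_closure_of topspace_weak_topology by simp
  have "\<exists>s\<in>S \<inter> E. \<forall>z\<in>N. dist (z s) (z x) < \<epsilon>" if N: "finite N" "N \<subseteq> Z" "0 < \<epsilon>" for N \<epsilon>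
  proof -
    define B where "B = {y \<in> E. \<forall>z\<in>N. dist (z y) (z x) < \<epsilon>}"
    have "x \<in> B" "openin (weak_topology E Z) B"
      using x N openin_weak_topology_basic[OF N(1,2) x, of \<epsilon>] unfolding B_def by simp_all
    then obtain s where "s \<in> S" "s \<in> B" using L unfolding in_closure_of by blast
    then show ?thesis unfolding B_def by blast
  qed
  then show ?R using x by blast
next
  assume R: ?R
  have "\<exists>y. y \<in> S \<and> y \<in> T" if T: "x \<in> T" "openin (weak_topology E Z) T" for T
  proof -
    obtain N \<epsilon> where N: "finite N" "N \<subseteq> Z" "0 < \<epsilon>" "{y \<in> E. \<forall>z\<in>N. dist (z y) (z x) < \<epsilon>} \<subseteq> T"
      using weak_topology_neighbourhood[OF T(2,1)] by blast
    then obtain s where "s \<in> S \<inter> E" "\<forall>z\<in>N. dist (z s) (z x) < \<epsilon>" using R by blast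
    then show ?thesis using N(4) by blast
  qed
  then show ?L unfolding in_closure_of topspace_weak_topology using R by blast
qed

lemma limitin_weak_topology:
  fixes Z :: "('e \<Rightarrow> 'k::metric_space) set"
  assumes f: "\<And>n. f n \<in> E"
  shows "limitin (weak_topology E Z) f l sequentially \<longleftrightarrow> l \<in> E \<and> (\<forall>z\<in>Z. (\<lambda>n. z (f n)) \<longlonglongrightarrow> z l)"
    (is "?L \<longleftrightarrow> ?R")
proof
  assume L: ?L
  then have l: "l \<in> E" unfolding limitin_def topspace_weak_topology by simp
  have "(\<lambda>n. z (f n)) \<longlonglongrightarrow> z l" if z: "z \<in> Z" for z
  proof (rule tendstoI)
    fix e :: real assume e: "0 < e"
    have "openin (weak_topology E Z) {y \<in> E. \<forall>z\<in>{z}. dist (z y) (z l) < e}"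
      using z l by (intro openin_weak_topology_basic) auto
    moreover have "l \<in> {y \<in> E. \<forall>z\<in>{z}. dist (z y) (z l) < e}" using l e by simp
    ultimately have "\<forall>\<^sub>F n in sequentially. f n \<in> {y \<in> E. \<forall>z\<in>{z}. dist (z y) (z l) < e}"
      using L unfolding limitin_def by blast
    then show "\<forall>\<^sub>F n in sequentially. dist (z (f n)) (z l) < e"
      by (rule eventually_mono) simp
  qed
  then show ?R using l by blast
next
  assume R: ?R
  show ?L
    unfolding limitin_def topspace_weak_topology
  proof (intro conjI allI impI)
    fix T assume T: "openin (weak_topology E Z) T \<and> l \<in> T"
    obtain N \<epsilon> where N: "finite N" "N \<subseteq> Z" "0 < \<epsilon>" "{y \<in> E. \<forall>z\<in>N. dist (z y) (z l) < \<epsilon>} \<subseteq> T"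
      using weak_topology_neighbourhood[of E Z T l] T by blast
    have "\<forall>z\<in>N. \<forall>\<^sub>F n in sequentially. dist (z (f n)) (z l) < \<epsilon>"
    proof
      fix z assume "z \<in> N"
      then have "(\<lambda>n. z (f n)) \<longlonglongrightarrow> z l" using R N(2) by blast
      then show "\<forall>\<^sub>F n in sequentially. dist (z (f n)) (z l) < \<epsilon>" using N(3) by (rule tendstoD)
    qed
    then have "\<forall>\<^sub>F n in sequentially. \<forall>z\<in>N. dist (z (f n)) (z l) < \<epsilon>"
      using N(1) by (simp add: eventually_ball_finite_distrib)
    then show "\<forall>\<^sub>F n in sequentially. f n \<in> T"
      by (rule eventually_mono) (use N(4) f in blast)
  qed (use R in blast)
qed

section \<open>Real and complex scalars\<close>

text \<open>\<open>j\<close> is the imaginary unit for complex scalars and 0 for real ones, so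
  formulas with \<open>j\<close> serve both fields.\<close>

lemma scalar_embedding:
  "\<exists>(e :: 'k::real_or_complex \<Rightarrow> complex) j.
    (\<forall>x y. e (x + y) = e x + e y) \<and> (\<forall>x y. e (x * y) = e x * e y) \<and>
    (\<forall>r x. e (r *\<^sub>R x) = r *\<^sub>R e x) \<and> (\<forall>x. cmod (e x) = norm x) \<and>
    (j = 0 \<and> range e = \<real> \<or> e j = \<i> \<and> surj e)"
  using iso_real_or_complex[where 'a = 'k]
proof
  assume "\<exists>h :: 'k \<Rightarrow> real. bij h \<and> (\<forall>x y. h (x + y) = h x + h y) \<and> (\<forall>x y. h (x * y) = h x * h y) \<and>
        (\<forall>r x. h (r *\<^sub>R x) = r *\<^sub>R h x) \<and> (\<forall>x. norm (h x) = norm x)"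
  then obtain h :: "'k \<Rightarrow> real" where h: "bij h" "\<forall>x y. h (x + y) = h x + h y"
    "\<forall>x y. h (x * y) = h x * h y" "\<forall>r x. h (r *\<^sub>R x) = r *\<^sub>R h x" "\<forall>x. norm (h x) = norm x" by blast
  have "range (\<lambda>x. complex_of_real (h x)) = \<real>"
    unfolding Reals_def using bij_is_surj[OF h(1)] by (metis image_image)
  then show ?thesis
    using h by (intro exI[of _ "\<lambda>x. complex_of_real (h x)"] exI[of _ 0]) (simp add: scaleR_conv_of_real)
next
  assume "\<exists>h :: 'k \<Rightarrow> complex. bij h \<and> (\<forall>x y. h (x + y) = h x + h y) \<and> (\<forall>x y. h (x * y) = h x * h y) \<and>
        (\<forall>r x. h (r *\<^sub>R x) = r *\<^sub>R h x) \<and> (\<forall>x. norm (h x) = norm x)"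
  then obtain h :: "'k \<Rightarrow> complex" where h: "bij h" "\<forall>x y. h (x + y) = h x + h y"
    "\<forall>x y. h (x * y) = h x * h y" "\<forall>r x. h (r *\<^sub>R x) = r *\<^sub>R h x" "\<forall>x. norm (h x) = norm x" by blast
  have s: "surj h" using h(1) by (rule bij_is_surj)
  then show ?thesis
    using h by (intro exI[of _ h] exI[of _ "inv h \<i>"]) (simp add: surj_f_inv_f)
qed

text \<open>The embedding \<open>e\<close> of the scalars into \<open>complex\<close> allows a uniform treatment of both scalar fields.\<close>

locale embedded_banach_space = banach_space_over smul
  for smul :: "'k::real_or_complex \<Rightarrow> 'a::banach \<Rightarrow> 'a" +
  fixes e :: "'k \<Rightarrow> complex" and j :: 'k
  assumes e_add: "e (x + y) = e x + e y" and e_mult: "e (x * y) = e x * e y"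
    and e_scaleR: "e (r *\<^sub>R x) = r *\<^sub>R e x" and norm_e: "cmod (e x) = norm x"
    and e_j: "j = 0 \<and> range e = \<real> \<or> e j = \<i> \<and> surj e"
begin

lemma e_0: "e 0 = 0" using norm_e[of 0] by simp

lemma e_uminus: "e (- x) = - e x" using e_scaleR[of "-1" x] by simp

lemma e_diff: "e (x - y) = e x - e y"
  using e_add[of x "- y"] by (simp add: e_uminus)

lemma e_sum: "e (sum f A) = (\<Sum>x\<in>A. e (f x))"
  by (induction A rule: infinite_finite_induct) (auto simp: e_0 e_add)

lemma e_eq_iff: "e x = e y \<longleftrightarrow> x = y"
  using e_diff[of x y] norm_e[of "x - y"] by auto

lemma e_1: "e 1 = 1"
proof -
  have "e 1 * e 1 = e 1" using e_mult[of 1 1] by simp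
  moreover have "e 1 \<noteq> 0" using norm_e[of 1] by auto
  ultimately show ?thesis by simp
qed

lemma e_of_real: "e (of_real r) = of_real r"
  using e_scaleR[of r 1] by (simp add: e_1 of_real_def)

lemma dist_e: "dist (e x) (e y) = dist x y"
  by (simp add: dist_norm e_diff[symmetric] norm_e)

lemma j_cases: "j = 0 \<or> e j = \<i>" using e_j by blast

lemma j_square: "j = 0 \<or> j * j = - 1"
  using j_cases e_eq_iff[of "j * j" "- 1"] by (auto simp: e_mult e_uminus e_1)

lemma norm_j: "norm j \<le> 1"
  using j_cases norm_e[of j] by auto

text \<open>Over the reals both sides vanish. Over both fields the identity recovers a scalar
  functional from its real part.\<close>

lemma Im_e: "Im (e x) = - Re (e (j * x))"
proof (cases "e j = \<i>")
  case False
  then have "j = 0" "range e = \<real>" using e_j by auto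
  then have "e x \<in> \<real>" by blast
  then show ?thesis using \<open>j = 0\<close> by (simp add: e_0 complex_is_Real_iff)
qed (simp add: e_mult)

lemma e_surj: "(j = 0 \<Longrightarrow> b = 0) \<Longrightarrow> \<exists>k. e k = Complex a b"
proof (cases "e j = \<i> \<and> surj e")
  case True
  then show ?thesis by (metis surjD)
next
  case False
  assume b: "j = 0 \<Longrightarrow> b = 0"
  have "j = 0" "range e = \<real>" using False e_j by auto
  then have "Complex a b \<in> range e" using b by (simp add: complex_is_Real_iff)
  then show ?thesis by (metis imageE)
qed

lemma scalar_decomposition: "c = of_real (Re (e c)) + of_real (Im (e c)) * j"
proof -
  have "e c = of_real (Re (e c)) + of_real (Im (e c)) * e j"
    using j_cases Im_e[of c] by (auto simp: complex_eq_iff e_0)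
  then have "e c = e (of_real (Re (e c)) + of_real (Im (e c)) * j)"
    by (simp add: e_add e_mult e_of_real)
  then show ?thesis by (simp only: e_eq_iff)
qed

definition J :: "'a \<Rightarrow> 'a" where "J x = smul j x"

lemma smul_eq: "smul c x = Re (e c) *\<^sub>R x + Im (e c) *\<^sub>R J x"
  by (subst scalar_decomposition[of c])
    (simp add: scale_left_distrib smul_of_real scale_scale[symmetric] J_def del: scale_scale)

lemma smul_scaleR: "smul c (r *\<^sub>R x) = r *\<^sub>R smul c x"
  unfolding smul_of_real[symmetric] by (rule scale_left_commute)

lemma bounded_linear_smul: "bounded_linear (smul c)"
  by (rule bounded_linear_intro[of _ "norm c"])
    (simp_all add: scale_right_distrib smul_scaleR norm_smul mult.commute)

lemma linear_J: "linear J"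
  using bounded_linear.linear[OF bounded_linear_smul[of j]] by (simp add: J_def[abs_def] eta_contract_eq)

lemma norm_J: "norm (J x) \<le> norm x"
  unfolding J_def norm_smul using norm_j by (simp add: mult_left_le_one_le)

lemma J_J: "J (J x) \<in> {0, - x}"
  using j_square unfolding J_def by auto

section \<open>Functionals and their real parts\<close>

definition realpart :: "('a \<Rightarrow>\<^sub>L 'k) \<Rightarrow> 'a \<Rightarrow> real" where
  "realpart f = (\<lambda>x. Re (e (blinfun_apply f x)))"

lemma bounded_linear_e: "bounded_linear e"
  by (rule bounded_linear_intro[of _ 1]) (simp_all add: e_add e_scaleR norm_e)

lemma bounded_linear_realpart: "bounded_linear (realpart f)"
  unfolding realpart_def
  by (intro bounded_linear_compose[OF bounded_linear_Re] bounded_linear_compose[OF bounded_linear_e]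
      blinfun.bounded_linear_right)

lemma dual_smul: "f \<in> dual smul \<Longrightarrow> blinfun_apply f (smul c x) = c * blinfun_apply f x"
  unfolding dual_def by blast

lemma e_dual: "f \<in> dual smul \<Longrightarrow> e (blinfun_apply f x) = Complex (realpart f x) (- realpart f (J x))"
  unfolding realpart_def J_def by (simp add: dual_smul complex_eq_iff Im_e)

text \<open>The classical formula \<open>u x - \<i> * u (\<i> * x)\<close>; its second term
  disappears for real scalars because \<open>J\<close> is then 0.\<close>

lemma complexification:
  assumes u: "bounded_linear u"
  shows "\<exists>f\<in>dual smul. realpart f = u"
proof -
  have lin: "linear u" using u by (rule bounded_linear.linear)
  define g where "g x = (SOME k. e k = Complex (u x) (- u (J x)))" for x
  have "\<exists>k. e k = Complex (u x) (- u (J x))" for x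
  proof (rule e_surj)
    assume "j = 0"
    then have "J x = 0" unfolding J_def by simp
    then show "- u (J x) = 0" using lin by (simp add: linear_0)
  qed
  then have g: "e (g x) = Complex (u x) (- u (J x))" for x
    unfolding g_def by (rule someI_ex)
  obtain b where b: "\<And>x. norm (u x) \<le> norm x * b" "0 \<le> b"
    using bounded_linear.nonneg_bounded[OF u] by blast
  have add: "g (x + y) = g x + g y" for x y
    using lin linear_J by (subst e_eq_iff[symmetric]) (simp add: g e_add linear_add complex_eq_iff)
  have scale: "g (smul c x) = c * g x" for c x
  proof -
    have "Im (e c) * u (J (J x)) = - Im (e c) * u x"
    proof (cases "j = 0")
      case True
      then have "Im (e c) = 0" by (simp add: Im_e e_0)
      then show ?thesis by simp
    next
      case False
      then have "J (J x) = - x" using j_square unfolding J_def by simp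
      then show ?thesis using lin by (simp add: linear_neg)
    qed
    moreover have "u (J (smul c x)) = Re (e c) * u (J x) + Im (e c) * u (J (J x))"
      unfolding smul_eq[of c x] using lin linear_J by (simp add: linear_add linear_scale)
    moreover have "u (smul c x) = Re (e c) * u x + Im (e c) * u (J x)"
      unfolding smul_eq[of c x] using lin by (simp add: linear_add linear_scale)
    ultimately have "e (g (smul c x)) = e (c * g x)"
      unfolding g e_mult by (simp add: complex_eq_iff)
    then show ?thesis by (simp only: e_eq_iff)
  qed
  have "bounded_linear g"
  proof (rule bounded_linear_intro[of _ "2 * b"])
    fix x
    have "norm (g x) \<le> \<bar>u x\<bar> + \<bar>u (J x)\<bar>"
      using cmod_le[of "e (g x)"] unfolding norm_e by (simp add: g)
    also have "\<dots> \<le> norm x * b + norm x * b"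
      using b(1)[of x] order.trans[OF b(1)[of "J x"] mult_right_mono[OF norm_J b(2)]] by (intro add_mono) auto
    finally show "norm (g x) \<le> norm x * (2 * b)" by (simp add: algebra_simps)
  next
    fix r x show "g (r *\<^sub>R x) = r *\<^sub>R g x"
      using scale[of "of_real r" x] by (simp add: smul_of_real scaleR_conv_of_real)
  qed (rule add)
  then have "blinfun_apply (Blinfun g) = g" by (rule bounded_linear_Blinfun_apply)
  then show ?thesis
    by (intro bexI[of _ "Blinfun g"]) (auto simp: dual_def scale realpart_def g)
qed

lemma realpart_inject:
  assumes "f \<in> dual smul" "g \<in> dual smul" "realpart f = realpart g"
  shows "f = g"
  by (rule blinfun_eqI) (metis e_eq_iff e_dual assms)

text \<open>The factor 2 comes from adding the bounds for the real and the imaginary part; later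
  constants absorb it.\<close>

lemma norm_dual_le:
  assumes f: "f \<in> dual smul" and b: "0 \<le> b" "\<And>x. \<bar>realpart f x\<bar> \<le> b * norm x"
  shows "norm f \<le> 2 * b"
proof (rule norm_blinfun_bound)
  fix x
  have "norm (blinfun_apply f x) \<le> \<bar>realpart f x\<bar> + \<bar>realpart f (J x)\<bar>"
    using cmod_le[of "e (blinfun_apply f x)"] unfolding norm_e by (simp add: e_dual[OF f])
  also have "\<dots> \<le> b * norm x + b * norm x"
    using b(2)[of x] order.trans[OF b(2)[of "J x"] mult_left_mono[OF norm_J b(1)]] by (intro add_mono) auto
  finally show "norm (blinfun_apply f x) \<le> 2 * b * norm x" by simp
qed (use b in simp)

definition lift :: "('a \<Rightarrow> real) \<Rightarrow> 'a \<Rightarrow>\<^sub>L 'k" where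
  "lift u = (SOME f. f \<in> dual smul \<and> realpart f = u)"

lemma lift: "bounded_linear u \<Longrightarrow> lift u \<in> dual smul" "bounded_linear u \<Longrightarrow> realpart (lift u) = u"
  using someI_ex[of "\<lambda>f. f \<in> dual smul \<and> realpart f = u"] complexification[of u]
  unfolding lift_def by blast+

lemma lift_realpart: "f \<in> dual smul \<Longrightarrow> lift (realpart f) = f"
  by (intro realpart_inject) (simp_all add: lift bounded_linear_realpart)

lemma dual_add: "f \<in> dual smul \<Longrightarrow> g \<in> dual smul \<Longrightarrow> f + g \<in> dual smul"
  unfolding dual_def by (simp add: blinfun.add_left algebra_simps)

lemma dual_scaleR: "f \<in> dual smul \<Longrightarrow> r *\<^sub>R f \<in> dual smul"
  unfolding dual_def by (simp add: blinfun.scaleR_left)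

lemma dual_mult: "f \<in> dual smul \<Longrightarrow> blinfun_mult_right c o\<^sub>L f \<in> dual smul"
  unfolding dual_def by (simp add: algebra_simps)

lemma subspace_dual: "real_vector.subspace (dual smul)"
  by (rule real_vector.subspaceI) (auto simp: dual_add dual_scaleR, simp add: dual_def)

lemma canonical_embedding_apply: "f \<in> dual smul \<Longrightarrow> canonical_embedding smul x f = blinfun_apply f x"
  unfolding canonical_embedding_def by simp

lemma canonical_embedding_bidual: "canonical_embedding smul x \<in> bidual smul"
  unfolding bidual_def
proof (intro CollectI conjI)
  show "canonical_embedding smul x \<in> extensional (dual smul)"
    unfolding canonical_embedding_def by simp
  show "\<exists>B. \<forall>f\<in>dual smul. norm (canonical_embedding smul x f) \<le> B * norm f"
    using norm_blinfun by (intro exI[of _ "norm x"]) (auto simp: canonical_embedding_apply mult.commute)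
qed (auto simp: canonical_embedding_apply dual_add dual_mult blinfun.add_left)

lemma bidual_add: "F \<in> bidual smul \<Longrightarrow> f \<in> dual smul \<Longrightarrow> g \<in> dual smul \<Longrightarrow> F (f + g) = F f + F g"
  unfolding bidual_def by blast

lemma bidual_mult: "F \<in> bidual smul \<Longrightarrow> f \<in> dual smul \<Longrightarrow> F (blinfun_mult_right c o\<^sub>L f) = c * F f"
  unfolding bidual_def by blast

lemma bidual_scaleR: "F \<in> bidual smul \<Longrightarrow> f \<in> dual smul \<Longrightarrow> F (r *\<^sub>R f) = r *\<^sub>R F f"
proof -
  assume F: "F \<in> bidual smul" "f \<in> dual smul"
  have "r *\<^sub>R f = blinfun_mult_right (of_real r) o\<^sub>L f"
    by (rule blinfun_eqI) (simp add: blinfun.scaleR_left scaleR_conv_of_real)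
  then show ?thesis using bidual_mult[OF F] by (simp add: scaleR_conv_of_real)
qed

text \<open>The real part of \<open>F\<close>, transported to plain real functions so that the
  results on approximable functionals apply; \<open>e_bidual\<close> recovers
  \<open>F\<close>.\<close>

definition real_functional :: "(('a \<Rightarrow>\<^sub>L 'k) \<Rightarrow> 'k) \<Rightarrow> ('a \<Rightarrow> real) \<Rightarrow> real" where
  "real_functional F u = Re (e (F (lift u)))"

lemma e_bidual:
  assumes F: "F \<in> bidual smul" and f: "f \<in> dual smul"
  shows "e (F f) = Complex (real_functional F (realpart f)) (- real_functional F (\<lambda>x. realpart f (J x)))"
proof -
  define g where "g = blinfun_mult_right j o\<^sub>L f"
  have g: "g \<in> dual smul" unfolding g_def using f by (rule dual_mult)
  have "realpart g = (\<lambda>x. realpart f (J x))"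
    unfolding realpart_def J_def g_def using f by (simp add: dual_smul)
  then have "lift (\<lambda>x. realpart f (J x)) = g" using lift_realpart[OF g] by simp
  moreover have "F g = j * F f" unfolding g_def using F f by (rule bidual_mult)
  ultimately show ?thesis
    unfolding real_functional_def by (simp add: complex_eq_iff lift_realpart[OF f] Im_e)
qed

lemma bidual_closure_approx:
  assumes "F \<in> weak_star_bidual smul closure_of (canonical_embedding smul ` C)"
    and "finite N" "N \<subseteq> dual smul" "0 < \<epsilon>"
  shows "\<exists>x\<in>C. \<forall>f\<in>N. norm (blinfun_apply f x - F f) < \<epsilon>"
proof -
  have "\<exists>s\<in>canonical_embedding smul ` C \<inter> bidual smul. \<forall>z\<in>(\<lambda>f \<phi>. \<phi> f) ` N. dist (z s) (z F) < \<epsilon>"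
    by (rule assms(1)[unfolded weak_star_bidual_def in_weak_topology_closure, THEN conjunct2, rule_format])
      (use assms(2-4) in auto)
  then obtain x where "x \<in> C" "\<And>f. f \<in> N \<Longrightarrow> dist (canonical_embedding smul x f) (F f) < \<epsilon>" by auto
  then show ?thesis using assms(3) canonical_embedding_apply by (metis dist_norm subsetD)
qed

lemma approximable_real_functional:
  assumes "F \<in> weak_star_bidual smul closure_of (canonical_embedding smul ` C)"
  shows "approximable C (real_functional F)"
  unfolding approximable_def
proof (intro allI impI)
  fix N :: "('a \<Rightarrow> real) set" and \<epsilon> :: real
  assume N: "finite N" "\<forall>u\<in>N. bounded_linear u" "0 < \<epsilon>"
  obtain x where x: "x \<in> C" "\<And>u. u \<in> N \<Longrightarrow> norm (blinfun_apply (lift u) x - F (lift u)) < \<epsilon>"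
    using bidual_closure_approx[OF assms, of "lift ` N" \<epsilon>] N lift(1) by blast
  have "\<bar>u x - real_functional F u\<bar> < \<epsilon>" if u: "u \<in> N" for u
  proof -
    have "realpart (lift u) = u" using N(2) u by (simp add: lift(2))
    then have "u x - real_functional F u = Re (e (blinfun_apply (lift u) x - F (lift u)))"
      unfolding real_functional_def realpart_def e_diff by (metis minus_complex.sel(1))
    then show ?thesis using abs_Re_le_cmod[of "e (blinfun_apply (lift u) x - F (lift u))"] x(2)[OF u]
      by (simp add: norm_e)
  qed
  then show "\<exists>y\<in>C. \<forall>u\<in>N. \<bar>u y - real_functional F u\<bar> < \<epsilon>" using x(1) by blast
qed

lemma norm_lift_le:
  assumes u: "linear u" "0 \<le> b" "\<And>x. \<bar>u x\<bar> \<le> b * norm x"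
  shows "norm (lift u) \<le> 2 * b"
proof -
  have "bounded_linear u" using u bounded_linear_real_iff by blast
  then show ?thesis using u by (intro norm_dual_le) (auto simp: lift)
qed

section \<open>A copy of l1 from an independent tree\<close>

lemma contains_ell1I:
  fixes y :: "nat \<Rightarrow> 'a"
  assumes d: "0 < m" and b: "\<And>n. norm (y n) \<le> b"
    and lower: "\<And>n c. m * (\<Sum>i<n. norm (c i)) \<le> norm (\<Sum>i<n. smul (c i) (y i))"
  shows "contains_ell1 smul"
proof -
  have b0: "0 \<le> b" using b[of 0] norm_ge_zero order.trans by blast
  define T where "T a = (\<Sum>n. smul (a n) (y n))" for a
  have le: "norm (smul c (y n)) \<le> b * norm c" for c n
    using mult_left_mono[OF b[of n] norm_ge_zero[of c]] by (simp add: norm_smul mult.commute)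
  have sm: "summable (\<lambda>n. norm (smul (a n) (y n)))" and sm': "summable (\<lambda>n. b * norm (a n))"
    if "a \<in> ell1" for a
  proof -
    show s: "summable (\<lambda>n. b * norm (a n))" using that unfolding ell1_def by (simp add: summable_mult)
    show "summable (\<lambda>n. norm (smul (a n) (y n)))"
      by (rule summable_comparison_test'[OF s]) (simp add: le)
  qed
  have "T (\<lambda>n. a n + a' n) = T a + T a'" if "a \<in> ell1" "a' \<in> ell1" for a a'
    unfolding T_def scale_left_distrib
    using summable_norm_cancel[OF sm] that by (intro suminf_add[symmetric]) auto
  moreover have "T (\<lambda>n. c * a n) = smul c (T a)" if "a \<in> ell1" for a c
    unfolding T_def using bounded_linear.suminf[OF bounded_linear_smul summable_norm_cancel[OF sm[OF that]], of c]
    by simp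
  moreover have "m * ell1_norm a \<le> norm (T a) \<and> norm (T a) \<le> b * ell1_norm a" if a: "a \<in> ell1" for a
  proof
    have "(\<lambda>n. m * (\<Sum>i<n. norm (a i))) \<longlonglongrightarrow> m * ell1_norm a"
      unfolding ell1_norm_def using a unfolding ell1_def
      by (intro tendsto_mult_left summable_LIMSEQ) simp
    moreover have "(\<lambda>n. norm (\<Sum>i<n. smul (a i) (y i))) \<longlonglongrightarrow> norm (T a)"
      unfolding T_def using summable_norm_cancel[OF sm[OF a]] by (intro tendsto_norm summable_LIMSEQ)
    ultimately show "m * ell1_norm a \<le> norm (T a)"
      by (rule LIMSEQ_le) (use lower in blast)
    have "norm (T a) \<le> (\<Sum>n. norm (smul (a n) (y n)))"
      unfolding T_def by (rule summable_norm[OF sm[OF a]])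
    also have "\<dots> \<le> (\<Sum>n. b * norm (a n))"
      by (rule suminf_le[OF le sm[OF a] sm'[OF a]])
    also have "\<dots> = b * ell1_norm a"
      unfolding ell1_norm_def using a unfolding ell1_def by (intro suminf_mult) simp
    finally show "norm (T a) \<le> b * ell1_norm a" .
  qed
  ultimately show ?thesis unfolding contains_ell1_def using d by blast
qed

text \<open>\<open>u1\<close> follows the signs of the coefficients and \<open>u2\<close> the
  opposite signs. In the difference of the two functionals the common offset of
  \<open>\<alpha>\<close> and \<open>\<beta>\<close> cancels and values near plus or minus
  \<open>cnj (\<beta> - \<alpha>)\<close> remain. Two values match signs but not complex phases, so
  the coefficients are seen through a real projection \<open>\<pi>\<close>, later the real and the
  imaginary part.\<close>

lemma tree_lower_bound:
  fixes y :: "nat \<Rightarrow> 'a" and \<pi> :: "complex \<Rightarrow> real"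
  assumes tree: "\<And>n s. \<exists>u\<in>dual_ball 1. \<forall>i<n.
      cmod (Complex (u (y i)) (u (J (y i))) - (if i \<in> s then \<beta> else \<alpha>)) \<le> d / 8"
    and \<pi>: "linear \<pi>" "\<And>w. \<bar>\<pi> w\<bar> \<le> cmod w"
  shows "(\<Sum>i<n. \<bar>\<pi> (e (c i) * cnj (\<beta> - \<alpha>))\<bar>) - d / 4 * (\<Sum>i<n. norm (c i))
    \<le> 4 * norm (\<Sum>i<n. smul (c i) (y i))"
proof -
  define \<gamma> where "\<gamma> = cnj (\<beta> - \<alpha>)"
  define s where "s = {i. 0 \<le> \<pi> (e (c i) * \<gamma>)}"
  define v where "v = (\<Sum>i<n. smul (c i) (y i))"
  obtain u1 where u1: "u1 \<in> dual_ball 1"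
    "\<forall>i<n. cmod (Complex (u1 (y i)) (u1 (J (y i))) - (if i \<in> s then \<beta> else \<alpha>)) \<le> d / 8"
    using tree by blast
  obtain u2 where u2: "u2 \<in> dual_ball 1"
    "\<forall>i<n. cmod (Complex (u2 (y i)) (u2 (J (y i))) - (if i \<in> - s then \<beta> else \<alpha>)) \<le> d / 8"
    using tree by blast
  define f where "f u x = e (blinfun_apply (lift u) x)" for u x
  have f: "f u x = cnj (Complex (u x) (u (J x)))" and fv: "cmod (f u v) \<le> 2 * norm v"
    and fsum: "f u v = (\<Sum>i<n. e (c i) * f u (y i))" if "u \<in> dual_ball 1" for u x
  proof -
    have bl: "bounded_linear u" using that by (rule dual_ball_bounded_linear)
    show "f u x = cnj (Complex (u x) (u (J x)))"
      unfolding f_def by (simp add: e_dual[OF lift(1)[OF bl]] lift(2)[OF bl] complex_eq_iff)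
    have "norm (lift u) \<le> 2 * 1"
      using that by (intro norm_lift_le) (auto simp: dual_ball_def)
    then show "cmod (f u v) \<le> 2 * norm v"
      unfolding f_def norm_e using norm_blinfun[of "lift u" v] mult_right_mono[of "norm (lift u)" 2 "norm v"]
      by simp
    show "f u v = (\<Sum>i<n. e (c i) * f u (y i))"
      unfolding f_def v_def blinfun.sum_right by (simp add: e_sum dual_smul[OF lift(1)[OF bl]] e_mult)
  qed
  have near: "cmod (f u1 (y i) - (if i \<in> s then cnj \<beta> else cnj \<alpha>)) \<le> d / 8"
    "cmod (f u2 (y i) - (if i \<in> s then cnj \<alpha> else cnj \<beta>)) \<le> d / 8" if "i < n" for i
    using u1(2)[rule_format, OF that] u2(2)[rule_format, OF that]
      complex_mod_cnj[of "Complex (u1 (y i)) (u1 (J (y i))) - (if i \<in> s then \<beta> else \<alpha>)"]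
      complex_mod_cnj[of "Complex (u2 (y i)) (u2 (J (y i))) - (if i \<in> - s then \<beta> else \<alpha>)"]
    unfolding f[OF u1(1)] f[OF u2(1)] by (auto simp: complex_cnj_diff simp del: complex_mod_cnj complex_cnj)
  have summand: "\<bar>\<pi> (e (c i) * \<gamma>)\<bar> - d / 4 * norm (c i) \<le> \<pi> (e (c i) * (f u1 (y i) - f u2 (y i)))"
    if i: "i < n" for i
  proof -
    define \<sigma> where "\<sigma> = (if i \<in> s then \<gamma> else - \<gamma>)"
    define r where "r = f u1 (y i) - f u2 (y i) - \<sigma>"
    have "r = (f u1 (y i) - (if i \<in> s then cnj \<beta> else cnj \<alpha>)) - (f u2 (y i) - (if i \<in> s then cnj \<alpha> else cnj \<beta>))"
      unfolding r_def \<sigma>_def \<gamma>_def by auto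
    then have "cmod r \<le> d / 8 + d / 8"
      using near[OF i] norm_triangle_ineq4 order.trans add_mono by metis
    then have "cmod (e (c i) * r) \<le> d / 4 * norm (c i)"
      unfolding norm_mult norm_e using mult_right_mono[of "cmod r" "d / 4" "norm (c i)"] by (simp add: mult.commute)
    then have "\<bar>\<pi> (e (c i) * r)\<bar> \<le> d / 4 * norm (c i)" using \<pi>(2) order.trans by blast
    moreover have "\<pi> (e (c i) * \<sigma>) = \<bar>\<pi> (e (c i) * \<gamma>)\<bar>"
      unfolding \<sigma>_def s_def using \<pi>(1) by (auto simp: linear_neg)
    moreover have "\<pi> (e (c i) * (f u1 (y i) - f u2 (y i))) = \<pi> (e (c i) * \<sigma>) + \<pi> (e (c i) * r)"
      unfolding r_def using \<pi>(1) by (simp add: linear_add[symmetric] algebra_simps)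
    ultimately show ?thesis by linarith
  qed
  have "(\<Sum>i<n. \<bar>\<pi> (e (c i) * \<gamma>)\<bar>) - d / 4 * (\<Sum>i<n. norm (c i))
      = (\<Sum>i<n. \<bar>\<pi> (e (c i) * \<gamma>)\<bar> - d / 4 * norm (c i))"
    by (simp add: sum_subtractf sum_distrib_left)
  also have "\<dots> \<le> (\<Sum>i<n. \<pi> (e (c i) * (f u1 (y i) - f u2 (y i))))"
    by (intro sum_mono summand) simp
  also have "\<dots> = \<pi> (f u1 v - f u2 v)"
    unfolding fsum[OF u1(1)] fsum[OF u2(1)] sum_subtractf[symmetric] linear_sum[OF \<pi>(1)]
    by (simp add: right_diff_distrib)
  also have "\<dots> \<le> cmod (f u1 v) + cmod (f u2 v)"
    using \<pi>(2)[of "f u1 v - f u2 v"] norm_triangle_ineq4[of "f u1 v" "f u2 v"] by linarith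
  \<comment> \<open>Two lifted functionals, each of norm at most 2.\<close>
  also have "\<dots> \<le> 4 * norm v" using fv[OF u1(1)] fv[OF u2(1)] by linarith
  finally show ?thesis unfolding v_def \<gamma>_def .
qed

lemma contains_ell1_of_tree:
  fixes y :: "nat \<Rightarrow> 'a"
  assumes ne: "\<alpha> \<noteq> \<beta>" and b: "\<And>n. norm (y n) \<le> b"
    and tree: "\<And>n s. \<exists>u\<in>dual_ball 1. \<forall>i<n.
      cmod (Complex (u (y i)) (u (J (y i))) - (if i \<in> s then \<beta> else \<alpha>)) \<le> cmod (\<beta> - \<alpha>) / 8"
  shows "contains_ell1 smul"
proof (rule contains_ell1I[OF _ b])
  define d where "d = cmod (\<beta> - \<alpha>)"
  \<comment> \<open>Adding the bounds for real and imaginary part leaves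
    \<open>d - 2 * (d / 4) = d / 2\<close> against a factor 8 in front of the norm.\<close>
  show "0 < d / 16" unfolding d_def using ne by simp
  fix n and c :: "nat \<Rightarrow> 'k"
  have "d * norm (c i) \<le> \<bar>Re (e (c i) * cnj (\<beta> - \<alpha>))\<bar> + \<bar>Im (e (c i) * cnj (\<beta> - \<alpha>))\<bar>" for i
    using cmod_le[of "e (c i) * cnj (\<beta> - \<alpha>)"] unfolding norm_mult norm_e complex_mod_cnj d_def
    by (simp only: mult.commute)
  then have "d * (\<Sum>i<n. norm (c i)) \<le>
    (\<Sum>i<n. \<bar>Re (e (c i) * cnj (\<beta> - \<alpha>))\<bar>) + (\<Sum>i<n. \<bar>Im (e (c i) * cnj (\<beta> - \<alpha>))\<bar>)"
    unfolding sum_distrib_left sum.distrib[symmetric] by (intro sum_mono)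
  moreover have "(\<Sum>i<n. \<bar>Re (e (c i) * cnj (\<beta> - \<alpha>))\<bar>) - d / 4 * (\<Sum>i<n. norm (c i))
    \<le> 4 * norm (\<Sum>i<n. smul (c i) (y i))"
    unfolding d_def by (rule tree_lower_bound[OF tree bounded_linear.linear[OF bounded_linear_Re] abs_Re_le_cmod])
  moreover have "(\<Sum>i<n. \<bar>Im (e (c i) * cnj (\<beta> - \<alpha>))\<bar>) - d / 4 * (\<Sum>i<n. norm (c i))
    \<le> 4 * norm (\<Sum>i<n. smul (c i) (y i))"
    unfolding d_def by (rule tree_lower_bound[OF tree bounded_linear.linear[OF bounded_linear_Im] abs_Im_le_cmod])
  ultimately show "d / 16 * (\<Sum>i<n. norm (c i)) \<le> norm (\<Sum>i<n. smul (c i) (y i))"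
    by linarith
qed

text \<open>The dichotomy with its second case excluded. The norm bound is recorded because the
  envelope needs estimates uniform along the sequence.\<close>

lemma countable_closure_point_bounded_sequence:
  assumes no: "\<not> contains_ell1 smul" and F: "F \<in> countable_closure_points smul"
  shows "\<exists>y b. (\<forall>n. norm (y n) \<le> b) \<and> (\<forall>f\<in>dual smul. (\<lambda>n. blinfun_apply f (y n)) \<longlonglongrightarrow> F f)"
proof -
  obtain C where C: "countable C" "F \<in> weak_star_bidual smul closure_of (canonical_embedding smul ` C)"
    and Fb: "F \<in> bidual smul"
    using F unfolding countable_closure_points_def by blast
  obtain B where B: "\<And>f. f \<in> dual smul \<Longrightarrow> norm (F f) \<le> B * norm f"
    using Fb unfolding bidual_def by blast
  \<comment> \<open>The factor 2 is the one lost in \<open>norm_lift_le\<close>.\<close>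
  define M where "M = 2 * \<bar>B\<bar>"
  define \<Phi> where "\<Phi> = real_functional F"
  have apx: "approximable C \<Phi>" unfolding \<Phi>_def by (rule approximable_real_functional[OF C(2)])
  have bound: "\<bar>\<Phi> u\<bar> \<le> M * b" if u: "linear u" "0 \<le> b" "\<And>x. \<bar>u x\<bar> \<le> b * norm x" for u b
  proof -
    have bl: "bounded_linear u" using u bounded_linear_real_iff by blast
    have "\<bar>\<Phi> u\<bar> \<le> norm (F (lift u))"
      unfolding \<Phi>_def real_functional_def norm_e[symmetric] by (rule abs_Re_le_cmod)
    also have "\<dots> \<le> \<bar>B\<bar> * norm (lift u)"
      using B[OF lift(1)[OF bl]] mult_right_mono[OF abs_ge_self[of B] norm_ge_zero[of "lift u"]] by linarith
    also have "\<dots> \<le> \<bar>B\<bar> * (2 * b)" by (intro mult_left_mono norm_lift_le u) auto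
    finally show ?thesis unfolding M_def by simp
  qed
  define D where "D = {y \<in> real_vector.span C. norm y \<le> M + 1}"
  interpret approximated_functional J \<Phi> D M
  proof (rule approximated_functional.intro)
    have "D = real_vector.span C \<inter> cball 0 (M + 1)" unfolding D_def by auto
    then show "convex D" by (simp add: convex_Int convex_cball subspace_imp_convex)
    show "approximable D \<Phi>"
      unfolding D_def by (rule approximable_bounded[OF apx _ bound]) (simp_all add: M_def)
    show "\<bar>\<Phi> u\<bar> \<le> M" if "u \<in> dual_ball 1" for u
      using bound[of u 1] that unfolding dual_ball_def by simp
  qed (rule linear_J norm_J)+
  have dense: "\<exists>Z. countable Z \<and> (\<forall>y\<in>D. \<forall>e>0. \<exists>z\<in>Z. norm (y - z) < e)"
    using countable_dense_in_span[OF C(1)] unfolding D_def by blast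
  from sequence_or_tree[OF dense J_J] show ?thesis
  proof
    assume "\<exists>y::nat \<Rightarrow> 'a. (\<forall>n. y n \<in> D) \<and> (\<forall>u. bounded_linear u \<longrightarrow> (\<lambda>n. u (y n)) \<longlonglongrightarrow> \<Phi> u)"
    then obtain y :: "nat \<Rightarrow> 'a" where y: "\<And>n. y n \<in> D"
      "\<And>u. bounded_linear u \<Longrightarrow> (\<lambda>n. u (y n)) \<longlonglongrightarrow> \<Phi> u" by blast
    have "(\<lambda>n. blinfun_apply f (y n)) \<longlonglongrightarrow> F f" if f: "f \<in> dual smul" for f
    proof -
      have "(\<lambda>n. e (blinfun_apply f (y n))) \<longlonglongrightarrow> e (F f)"
        unfolding e_dual[OF f] e_bidual[OF Fb f] \<Phi>_def[symmetric] Complex_eq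
        by (intro tendsto_intros y(2) bounded_linear_realpart bounded_linear_comp_J)
      then show ?thesis unfolding tendsto_iff dist_e .
    qed
    then show ?thesis using y(1) unfolding D_def by blast
  next
    assume "\<exists>\<alpha> \<beta> (y::nat \<Rightarrow> 'a). \<alpha> \<noteq> \<beta> \<and> (\<forall>n. \<exists>y0\<in>D. norm (y0 - y n) \<le> 1) \<and>
      (\<forall>n s. \<exists>u\<in>dual_ball 1. \<forall>i<n. cmod (hat u (y i) - (if i \<in> s then \<beta> else \<alpha>)) \<le> cmod (\<beta> - \<alpha>) / 8)"
    then obtain \<alpha> \<beta> and y :: "nat \<Rightarrow> 'a" where ne: "\<alpha> \<noteq> \<beta>" and y: "\<And>n. \<exists>y0\<in>D. norm (y0 - y n) \<le> 1"
      and tree: "\<And>n s. \<exists>u\<in>dual_ball 1. \<forall>i<n. cmod (hat u (y i) - (if i \<in> s then \<beta> else \<alpha>)) \<le> cmod (\<beta> - \<alpha>) / 8"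
      by blast
    have "norm (y n) \<le> M + 2" for n
    proof -
      obtain y0 where "norm y0 \<le> M + 1" "norm (y0 - y n) \<le> 1" using y[of n] unfolding D_def by blast
      then show ?thesis using norm_triangle_ineq4[of y0 "y0 - y n"] by simp
    qed
    then have "contains_ell1 smul"
      by (rule contains_ell1_of_tree[OF ne _ tree[unfolded hat_def]])
    then show ?thesis using no by blast
  qed
qed

theorem B1_eq_countable_closure_points:
  assumes "\<not> contains_ell1 smul"
  shows "B1 smul = countable_closure_points smul"
proof (intro equalityI subsetI)
  fix F assume F: "F \<in> countable_closure_points smul"
  obtain y where "\<forall>f\<in>dual smul. (\<lambda>n. blinfun_apply f (y n)) \<longlonglongrightarrow> F f"
    using countable_closure_point_bounded_sequence[OF assms F] by blast
  moreover have "F \<in> bidual smul" using F unfolding countable_closure_points_def by blast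
  ultimately show "F \<in> B1 smul"
    unfolding B1_def weak_star_bidual_def limitin_weak_topology[OF canonical_embedding_bidual]
    by (auto simp: canonical_embedding_apply)
next
  fix F assume "F \<in> B1 smul"
  then obtain x :: "nat \<Rightarrow> 'a" where F: "F \<in> bidual smul"
    and lim: "\<forall>z\<in>(\<lambda>f \<phi>. \<phi> f) ` dual smul. (\<lambda>n. z (canonical_embedding smul (x n))) \<longlonglongrightarrow> z F"
    unfolding B1_def weak_star_bidual_def limitin_weak_topology[OF canonical_embedding_bidual] by blast
  have "F \<in> weak_star_bidual smul closure_of (canonical_embedding smul ` range x)"
    unfolding weak_star_bidual_def in_weak_topology_closure
  proof (intro conjI allI impI F)
    fix N :: "((('a \<Rightarrow>\<^sub>L 'k) \<Rightarrow> 'k) \<Rightarrow> 'k) set" and \<epsilon> :: real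
    assume N: "finite N" "N \<subseteq> (\<lambda>f \<phi>. \<phi> f) ` dual smul" "0 < \<epsilon>"
    have "\<forall>z\<in>N. \<forall>\<^sub>F n in sequentially. dist (z (canonical_embedding smul (x n))) (z F) < \<epsilon>"
    proof
      fix z assume "z \<in> N"
      then have "(\<lambda>n. z (canonical_embedding smul (x n))) \<longlonglongrightarrow> z F"
        by (intro bspec[OF lim] subsetD[OF N(2)])
      then show "\<forall>\<^sub>F n in sequentially. dist (z (canonical_embedding smul (x n))) (z F) < \<epsilon>"
        using N(3) by (rule tendstoD)
    qed
    then have "\<forall>\<^sub>F n in sequentially. \<forall>z\<in>N. dist (z (canonical_embedding smul (x n))) (z F) < \<epsilon>"
      using N(1) by (simp add: eventually_ball_finite_distrib)
    then obtain n where "\<forall>z\<in>N. dist (z (canonical_embedding smul (x n))) (z F) < \<epsilon>"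
      using eventually_happens'[OF sequentially_bot] by blast
    then show "\<exists>s\<in>canonical_embedding smul ` range x \<inter> bidual smul. \<forall>z\<in>N. dist (z s) (z F) < \<epsilon>"
      by (intro bexI[of _ "canonical_embedding smul (x n)"]) (simp_all add: canonical_embedding_bidual)
  qed
  then show "F \<in> countable_closure_points smul"
    unfolding countable_closure_points_def using F by (auto intro!: exI[of _ "range x"])
qed

section \<open>The envelope\<close>

lemma closed_dual: "closed (dual smul)"
proof -
  have "continuous_on UNIV (\<lambda>f::'a \<Rightarrow>\<^sub>L 'k. blinfun_apply f x)" for x
    by (intro linear_continuous_on blinfun.bounded_linear_left)
  then show ?thesis
    unfolding dual_def
    by (intro closed_Collect_all closed_Collect_eq continuous_on_mult continuous_on_const)
qed

lemma convex_dual: "convex (dual smul)"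
  using subspace_dual by (rule subspace_imp_convex)

lemma weak_star_dual_closure:
  "f \<in> weak_star_dual smul closure_of S \<longleftrightarrow> f \<in> dual smul \<and>
    (\<forall>N \<epsilon>. finite N \<longrightarrow> 0 < \<epsilon> \<longrightarrow>
      (\<exists>s\<in>S \<inter> dual smul. \<forall>x\<in>N. norm (blinfun_apply s x - blinfun_apply f x) < \<epsilon>))"
    (is "?L \<longleftrightarrow> ?R")
proof
  assume L: ?L
  have f: "f \<in> dual smul"
    using L unfolding weak_star_dual_def in_weak_topology_closure by (rule conjunct1)
  have "\<exists>s\<in>S \<inter> dual smul. \<forall>x\<in>N. norm (blinfun_apply s x - blinfun_apply f x) < \<epsilon>"
    if N: "finite N" "0 < \<epsilon>" for N \<epsilon>
  proof -
    have "\<exists>s\<in>S \<inter> dual smul. \<forall>z\<in>canonical_embedding smul ` N. dist (z s) (z f) < \<epsilon>"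
      by (rule L[unfolded weak_star_dual_def in_weak_topology_closure, THEN conjunct2, rule_format])
        (use N in auto)
    then obtain s where s: "s \<in> S \<inter> dual smul"
      "\<And>x. x \<in> N \<Longrightarrow> dist (canonical_embedding smul x s) (canonical_embedding smul x f) < \<epsilon>" by auto
    then show ?thesis
      using f by (intro bexI[of _ s]) (auto simp: canonical_embedding_apply dist_norm)
  qed
  then show ?R using f by simp
next
  assume R: ?R
  show ?L
    unfolding weak_star_dual_def in_weak_topology_closure
  proof (intro conjI allI impI)
    show f: "f \<in> dual smul" using R by simp
    fix N :: "(('a \<Rightarrow>\<^sub>L 'k) \<Rightarrow> 'k) set" and \<epsilon> :: real
    assume N: "finite N" "N \<subseteq> range (canonical_embedding smul)" "0 < \<epsilon>"
    obtain X where X: "finite X" "N = canonical_embedding smul ` X"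
      using finite_subset_image[OF N(1,2)] by blast
    obtain s where s: "s \<in> S \<inter> dual smul" "\<forall>x\<in>X. norm (blinfun_apply s x - blinfun_apply f x) < \<epsilon>"
      using R[THEN conjunct2, rule_format, OF X(1) N(3)] by blast
    show "\<exists>s\<in>S \<inter> dual smul. \<forall>z\<in>N. dist (z s) (z f) < \<epsilon>"
      using s f unfolding X(2) by (intro bexI[of _ s]) (auto simp: canonical_embedding_apply dist_norm)
  qed
qed

lemma realpart_add: "realpart (f + g) x = realpart f x + realpart g x"
  unfolding realpart_def by (simp add: blinfun.add_left e_add)

lemma realpart_diff: "realpart (f - g) x = realpart f x - realpart g x"
  unfolding realpart_def by (simp add: blinfun.diff_left e_diff)

lemma realpart_scaleR: "realpart (r *\<^sub>R f) x = r * realpart f x"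
  unfolding realpart_def by (simp add: blinfun.scaleR_left e_scaleR)

lemma realpart_sum: "realpart (sum f A) x = (\<Sum>i\<in>A. realpart (f i) x)"
  unfolding realpart_def by (simp add: blinfun.sum_left e_sum)

lemma norm_le_realparts:
  assumes "f \<in> dual smul"
  shows "norm (blinfun_apply f x) \<le> \<bar>realpart f x\<bar> + \<bar>realpart f (J x)\<bar>"
  using cmod_le[of "e (blinfun_apply f x)"] unfolding norm_e by (simp add: e_dual[OF assms])

lemma abs_realpart_le: "\<bar>realpart f x\<bar> \<le> norm f * norm x"
  unfolding realpart_def using abs_Re_le_cmod[of "e (blinfun_apply f x)"] norm_blinfun[of f x]
  by (simp add: norm_e)

text \<open>Pointwise limits of real parts give weak* limits of the functionals: the imaginary part
  at \<open>y\<close> is read off as a real part at \<open>J y\<close>, so the test set is enlarged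
  by its image under \<open>J\<close> and each part may err by
  \<open>\<epsilon> / 2\<close>.\<close>

lemma lift_add_mem_closure:
  assumes x: "x \<in> dual smul" and S: "S \<subseteq> dual smul"
    and u: "u \<in> closure ((\<lambda>f. realpart (f - x)) ` S)" and bl: "bounded_linear u"
  shows "lift u + x \<in> weak_star_dual smul closure_of S"
  unfolding weak_star_dual_closure
proof (intro conjI allI impI)
  have lu: "lift u \<in> dual smul" "realpart (lift u) = u" using lift[OF bl] by auto
  show f: "lift u + x \<in> dual smul" using lu(1) x by (rule dual_add)
  fix N :: "'a set" and \<epsilon> :: real assume N: "finite N" "0 < \<epsilon>"
  obtain s where s: "s \<in> S" "\<And>y. y \<in> N \<union> J ` N \<Longrightarrow> dist (realpart (s - x) y) (u y) < \<epsilon> / 2"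
    using closure_product_approx[OF u, of "N \<union> J ` N" "\<epsilon> / 2"] N by auto
  have sd: "s \<in> dual smul" using s(1) S by blast
  have d: "s - (lift u + x) \<in> dual smul" by (rule real_vector.subspace_diff[OF subspace_dual sd f])
  have "norm (blinfun_apply s y - blinfun_apply (lift u + x) y) < \<epsilon>" if y: "y \<in> N" for y
  proof -
    have "\<bar>realpart (s - (lift u + x)) z\<bar> < \<epsilon> / 2" if "z \<in> N \<union> J ` N" for z
      using s(2)[OF that] by (simp add: realpart_diff realpart_add lu(2) dist_real_def algebra_simps)
    from this[of y] this[of "J y"] show ?thesis
      using norm_le_realparts[OF d, of y] y by (simp add: blinfun.diff_left)
  qed
  then show "\<exists>s\<in>S \<inter> dual smul. \<forall>y\<in>N. norm (blinfun_apply s y - blinfun_apply (lift u + x) y) < \<epsilon>"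
    using s(1) sd by blast
qed

text \<open>The shift by \<open>x\<close> turns a bound that depends on \<open>y\<close> through
  \<open>realpart x y\<close> into a constant, as \<open>minimax_alternative\<close>
  requires.\<close>

lemma compact_shifted_closure:
  assumes x: "x \<in> dual smul" and S: "S \<subseteq> dual smul" "convex S" "\<And>f. f \<in> S \<Longrightarrow> norm f \<le> m"
  defines "K \<equiv> closure ((\<lambda>f. realpart (f - x)) ` S)"
  shows "compact K" "pconvex K" "K \<subseteq> dual_ball (m + norm x)"
proof -
  have "realpart (f - x) \<in> dual_ball (m + norm x)" if f: "f \<in> S" for f
  proof -
    have "norm (f - x) \<le> m + norm x" using norm_triangle_ineq4[of f x] S(3)[OF f] by linarith
    then have "\<bar>realpart (f - x) y\<bar> \<le> (m + norm x) * norm y" for y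
      using abs_realpart_le[of "f - x" y] mult_right_mono[of "norm (f - x)" "m + norm x" "norm y"] by simp
    then show ?thesis
      using bounded_linear.linear[OF bounded_linear_realpart] unfolding dual_ball_def by blast
  qed
  then show sub: "K \<subseteq> dual_ball (m + norm x)"
    unfolding K_def by (intro closure_minimal closed_dual_ball) blast
  then have "dual_ball (m + norm x) \<inter> K = K" by blast
  then show "compact K"
    using compact_Int_closed[OF compact_dual_ball closed_closure] unfolding K_def by metis
  have "pconvex ((\<lambda>f. realpart (f - x)) ` S)"
    unfolding pconvex_def
  proof (safe)
    fix f g and t :: real assume fg: "f \<in> S" "g \<in> S" and t: "0 \<le> t" "t \<le> 1"
    have "(1 - t) *\<^sub>R f + t *\<^sub>R g \<in> S" using convexD_alt[OF S(2) fg t] .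
    moreover have "(\<lambda>y. (1 - t) * realpart (f - x) y + t * realpart (g - x) y)
        = realpart ((1 - t) *\<^sub>R f + t *\<^sub>R g - x)"
      by (auto simp: realpart_diff realpart_add realpart_scaleR algebra_simps)
    ultimately show "(\<lambda>y. (1 - t) * realpart (f - x) y + t * realpart (g - x) y)
        \<in> (\<lambda>f. realpart (f - x)) ` S" by blast
  qed
  then show "pconvex K" unfolding K_def by (rule pconvex_closure)
qed

text \<open>Compactness is pulled back along the isometry \<open>e\<close>, whose range is closed in
  the plane.\<close>

lemma compact_scalar_cball: "compact (cball (0::'k) r)"
proof -
  have cl: "closed (range e)" using e_j closed_complex_Reals by auto
  have e: "inv e (e x) = x" for x using e_eq_iff by (intro inv_f_f) (auto simp: inj_def)
  have "continuous_on (range e) (inv e)"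
    unfolding continuous_on_iff by (auto simp: e dist_e)
  then have "compact (inv e ` (cball 0 r \<inter> range e))"
    by (intro compact_continuous_image compact_Int_closed compact_cball cl)
      (rule continuous_on_subset, auto)
  moreover have "inv e ` (cball 0 r \<inter> range e) = cball 0 r"
  proof (intro equalityI subsetI)
    fix k assume "k \<in> cball (0::'k) r"
    then have "e k \<in> cball 0 r \<inter> range e" by (simp add: norm_e)
    then have "inv e (e k) \<in> inv e ` (cball 0 r \<inter> range e)" by (rule imageI)
    then show "k \<in> inv e ` (cball 0 r \<inter> range e)" unfolding e .
  qed (auto simp: e norm_e)
  ultimately show ?thesis by simp
qed

text \<open>By compactness some \<open>w\<close> lies in the closures of all tails, and it is linear
  because each linear identity involves only finitely many functionals. A subsequence need not
  converge in general, so only approximation at arbitrarily late indices is claimed.\<close>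

lemma bounded_sequence_cluster_point:
  fixes y :: "nat \<Rightarrow> 'a"
  assumes y: "\<And>n. norm (y n) \<le> 1"
  shows "\<exists>F\<in>countable_closure_points smul. \<forall>N n. \<forall>\<epsilon>>0. finite N \<longrightarrow> N \<subseteq> dual smul \<longrightarrow>
    (\<exists>m\<ge>n. \<forall>f\<in>N. norm (blinfun_apply f (y m) - F f) < \<epsilon>)"
proof -
  define P where "P = {w::('a \<Rightarrow>\<^sub>L 'k) \<Rightarrow> 'k. \<forall>f. w f \<in> cball 0 (norm f)}"
  have P: "compact P" unfolding P_def by (intro compact_product compact_scalar_cball)
  define p where "p n f = blinfun_apply f (y n)" for n and f :: "'a \<Rightarrow>\<^sub>L 'k"
  have pP: "p n \<in> P" for n
  proof -
    have "norm f * norm (y n) \<le> norm f * 1" for f :: "'a \<Rightarrow>\<^sub>L 'k" using y by (intro mult_left_mono) auto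
    then show ?thesis unfolding P_def p_def using order.trans[OF norm_blinfun] by auto
  qed
  have "P \<inter> (\<Inter>n\<in>UNIV. closure (p ` {n..})) \<noteq> {}"
  proof (rule compact_imp_fip_image[OF P])
    fix I :: "nat set" assume I: "finite I"
    then obtain m where "\<forall>n\<in>I. n \<le> m" unfolding finite_nat_set_iff_bounded_le by blast
    then have "p m \<in> closure (p ` {n..})" if "n \<in> I" for n
      using that by (intro subsetD[OF closure_subset] imageI) auto
    then show "P \<inter> (\<Inter>n\<in>I. closure (p ` {n..})) \<noteq> {}" using pP by blast
  qed simp
  then obtain w where w: "w \<in> P" "\<And>n. w \<in> closure (p ` {n..})" by blast
  have near: "\<exists>m\<ge>n. \<forall>f\<in>N. norm (blinfun_apply f (y m) - w f) < \<epsilon>" if "finite N" "0 < \<epsilon>" for N n \<epsilon>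
    using closure_product_approx[OF w(2)[of n] that] by (auto simp: p_def dist_norm)
  define F where "F = restrict w (dual smul)"
  have F: "F f = w f" if "f \<in> dual smul" for f unfolding F_def using that by simp
  have Fb: "F \<in> bidual smul"
    unfolding bidual_def
  proof (intro CollectI conjI ballI allI)
    show "F \<in> extensional (dual smul)" unfolding F_def by simp
  next
    fix f g assume fg: "f \<in> dual smul" "g \<in> dual smul"
    have "norm (w (f + g) - (w f + w g)) \<le> 0 + \<epsilon>" if e: "0 < \<epsilon>" for \<epsilon>
    proof -
      obtain m where m: "\<forall>h\<in>{f, g, f + g}. norm (blinfun_apply h (y m) - w h) < \<epsilon> / 3"
        using near[of "{f, g, f + g}" "\<epsilon> / 3"] e by auto
      have "w (f + g) - (w f + w g) = (blinfun_apply f (y m) - w f) + (blinfun_apply g (y m) - w g)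
          - (blinfun_apply (f + g) (y m) - w (f + g))"
        by (simp add: blinfun.add_left)
      also have "norm \<dots> \<le> norm (blinfun_apply f (y m) - w f) + norm (blinfun_apply g (y m) - w g)
          + norm (blinfun_apply (f + g) (y m) - w (f + g))"
        by (rule order.trans[OF norm_triangle_ineq4 add_right_mono[OF norm_triangle_ineq]])
      finally show ?thesis using m by simp
    qed
    then have "norm (w (f + g) - (w f + w g)) \<le> 0" by (rule field_le_epsilon)
    then show "F (f + g) = F f + F g" using fg dual_add by (simp add: F)
  next
    fix c f assume f: "f \<in> dual smul"
    define g where "g = blinfun_mult_right c o\<^sub>L f"
    have "norm (w g - c * w f) \<le> 0 + \<epsilon>" if e: "0 < \<epsilon>" for \<epsilon>
    proof -
      define \<delta> where "\<delta> = \<epsilon> / (1 + norm c)"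
      have d: "0 < \<delta>" "\<delta> + norm c * \<delta> = \<epsilon>"
        unfolding \<delta>_def using e by (auto simp: add_pos_nonneg field_simps add_nonneg_eq_0_iff)
      obtain m where m: "\<forall>h\<in>{f, g}. norm (blinfun_apply h (y m) - w h) < \<delta>"
        using near[of "{f, g}" \<delta>] d by auto
      have "w g - c * w f = c * (blinfun_apply f (y m) - w f) - (blinfun_apply g (y m) - w g)"
        by (simp add: g_def algebra_simps)
      also have "norm \<dots> \<le> norm c * norm (blinfun_apply f (y m) - w f) + norm (blinfun_apply g (y m) - w g)"
        using norm_triangle_ineq4 norm_mult by metis
      also have "\<dots> \<le> norm c * \<delta> + \<delta>" using m by (intro add_mono mult_left_mono) auto
      finally show ?thesis using d(2) by simp
    qed
    then have "norm (w g - c * w f) \<le> 0" by (rule field_le_epsilon)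
    then show "F (blinfun_mult_right c o\<^sub>L f) = c * F f"
      using f dual_mult[OF f, of c] by (simp add: F g_def)
  next
    show "\<exists>B. \<forall>f\<in>dual smul. norm (F f) \<le> B * norm f"
      using w(1) unfolding P_def by (intro exI[of _ 1]) (auto simp: F)
  qed
  have nearF: "\<exists>m\<ge>n. \<forall>f\<in>N. norm (blinfun_apply f (y m) - F f) < \<epsilon>"
    if N: "finite N" "N \<subseteq> dual smul" "0 < \<epsilon>" for N n \<epsilon>
  proof -
    obtain m where "m \<ge> n" "\<forall>f\<in>N. norm (blinfun_apply f (y m) - w f) < \<epsilon>"
      using near[OF N(1,3)] by blast
    then show ?thesis using N(2) F by (intro exI[of _ m]) auto
  qed
  have "F \<in> weak_star_bidual smul closure_of (canonical_embedding smul ` range y)"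
    unfolding weak_star_bidual_def in_weak_topology_closure
  proof (intro conjI allI impI Fb)
    fix N :: "((('a \<Rightarrow>\<^sub>L 'k) \<Rightarrow> 'k) \<Rightarrow> 'k) set" and \<epsilon> :: real
    assume N: "finite N" "N \<subseteq> (\<lambda>f \<phi>. \<phi> f) ` dual smul" "0 < \<epsilon>"
    obtain X where X: "finite X" "X \<subseteq> dual smul" "N = (\<lambda>f \<phi>. \<phi> f) ` X"
      using finite_subset_image[OF N(1,2)] by blast
    obtain m where m: "\<forall>f\<in>X. norm (blinfun_apply f (y m) - F f) < \<epsilon>"
      using nearF[OF X(1,2) N(3)] by blast
    have "\<forall>z\<in>N. dist (z (canonical_embedding smul (y m))) (z F) < \<epsilon>"
      using m X(2) unfolding X(3) by (auto simp: canonical_embedding_apply dist_norm)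
    then show "\<exists>s\<in>canonical_embedding smul ` range y \<inter> bidual smul. \<forall>z\<in>N. dist (z s) (z F) < \<epsilon>"
      by (intro bexI[of _ "canonical_embedding smul (y m)"]) (simp_all add: canonical_embedding_bidual)
  qed
  then have "F \<in> countable_closure_points smul"
    unfolding countable_closure_points_def using Fb by (auto intro!: exI[of _ "range y"])
  then show ?thesis using nearF by (intro bexI[of _ F]) simp_all
qed

section \<open>The two inclusions between envelope and closure\<close>

text \<open>The three operations of the envelope are absorbed separately: inner weak* closures since
  \<open>q m\<close> evaluates at finitely many vectors only, the hull of the union since the convex
  sets \<open>W n\<close> increase, and the norm closure since \<open>q m\<close> is Lipschitz with
  a constant independent of \<open>m\<close>.\<close>

lemma I_env_subset_closure:
  assumes no: "\<not> contains_ell1 smul" and A: "A \<subseteq> dual smul"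
  shows "I_env smul A \<subseteq> weak_topology (dual smul) (B1 smul) closure_of (convex hull A)"
proof
  fix x assume x: "x \<in> I_env smul A"
  have xF: "x \<in> closure (convex hull (\<Union>n. weak_star_dual smul closure_of (convex hull (G n))))"
    if "A = (\<Union>n. G n)" for G :: "nat \<Rightarrow> ('a \<Rightarrow>\<^sub>L 'k) set"
    using x that unfolding I_env_def by blast
  \<comment> \<open>For empty \<open>A\<close> the cover by empty sets already excludes every
    point.\<close>
  have Ane: "A \<noteq> {}"
    using xF[of "\<lambda>_. {}"] by auto
  have hullA: "convex hull A \<subseteq> dual smul" using A convex_dual by (rule hull_minimal)
  have "(\<Union>n::nat. weak_star_dual smul closure_of (convex hull A)) \<subseteq> dual smul"
    by (auto simp: weak_star_dual_closure)
  then have "convex hull (\<Union>n::nat. weak_star_dual smul closure_of (convex hull A)) \<subseteq> dual smul"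
    using convex_dual by (rule hull_minimal)
  then have "closure (convex hull (\<Union>n::nat. weak_star_dual smul closure_of (convex hull A))) \<subseteq> dual smul"
    using closed_dual by (rule closure_minimal)
  then have xd: "x \<in> dual smul" using xF[of "\<lambda>_. A"] by auto
  show "x \<in> weak_topology (dual smul) (B1 smul) closure_of (convex hull A)"
    unfolding in_weak_topology_closure
  proof (intro conjI allI impI xd, rule ccontr)
    fix N :: "(('a \<Rightarrow>\<^sub>L 'k) \<Rightarrow> 'k) set" and \<epsilon> :: real
    assume N: "finite N" "N \<subseteq> B1 smul" and \<epsilon>: "0 < \<epsilon>"
      and neg0: "\<not> (\<exists>s\<in>convex hull A \<inter> dual smul. \<forall>\<phi>\<in>N. dist (\<phi> s) (\<phi> x) < \<epsilon>)"
    have neg: "\<exists>\<phi>\<in>N. \<epsilon> \<le> norm (\<phi> s - \<phi> x)" if s: "s \<in> convex hull A" for s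
    proof (rule ccontr)
      assume "\<not> ?thesis"
      then have "\<forall>\<phi>\<in>N. dist (\<phi> s) (\<phi> x) < \<epsilon>" by (auto simp: dist_norm not_le)
      then show False using neg0 s hullA by blast
    qed
    \<comment> \<open>A complex number of modulus at least \<open>\<epsilon>\<close> has real part
      at least \<open>\<epsilon> / 2\<close> after one of these four rotations.\<close>
    define \<Theta> where "\<Theta> = {1, - 1, \<i>, - \<i>}"
    define I where "I = N \<times> \<Theta>"
    have I: "finite I" unfolding I_def \<Theta>_def using N(1) by simp
    have Ine: "I \<noteq> {}"
      using neg Ane hull_inc[of _ A convex] unfolding I_def \<Theta>_def by fastforce
    define h where "h p s = Re (snd p * e (fst p s))" for p :: "(('a \<Rightarrow>\<^sub>L 'k) \<Rightarrow> 'k) \<times> complex" and s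
    have fstI: "fst p \<in> bidual smul" "fst p \<in> countable_closure_points smul" if "p \<in> I" for p
      using that N(2) B1_eq_countable_closure_points[OF no] unfolding I_def B1_def by auto
    have hlin: "h p (a *\<^sub>R s + b *\<^sub>R t) = a * h p s + b * h p t"
      if "p \<in> I" "s \<in> dual smul" "t \<in> dual smul" for p s t a b
      unfolding h_def using fstI[OF that(1)] that(2,3)
      by (simp add: bidual_add bidual_scaleR dual_scaleR e_add e_scaleR algebra_simps)
    have "\<exists>l. (\<forall>p\<in>I. 0 \<le> l p) \<and> sum l I = 1 \<and>
        (\<forall>s\<in>convex hull A. 0 \<le> (\<Sum>p\<in>I. l p * (h p s - h p x - \<epsilon> / 2)))"
    proof (rule convexlike_alternative[OF I Ine])
      fix s t and r :: real
      assume st: "s \<in> convex hull A" "t \<in> convex hull A" and r: "0 \<le> r" "r \<le> 1"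
      have "h p ((1 - r) *\<^sub>R s + r *\<^sub>R t) - h p x - \<epsilon> / 2
          \<le> (1 - r) * (h p s - h p x - \<epsilon> / 2) + r * (h p t - h p x - \<epsilon> / 2)" if p: "p \<in> I" for p
      proof -
        have "h p ((1 - r) *\<^sub>R s + r *\<^sub>R t) = (1 - r) * h p s + r * h p t"
          using st hullA by (intro hlin[OF p]) auto
        then show ?thesis by (simp only:) (simp add: field_simps)
      qed
      then show "\<exists>z\<in>convex hull A. \<forall>p\<in>I. h p z - h p x - \<epsilon> / 2
          \<le> (1 - r) * (h p s - h p x - \<epsilon> / 2) + r * (h p t - h p x - \<epsilon> / 2)"
        using convexD_alt[OF convex_convex_hull st r] by (intro bexI[of _ "(1 - r) *\<^sub>R s + r *\<^sub>R t"]) auto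
    next
      fix s assume s: "s \<in> convex hull A"
      obtain \<phi> where \<phi>: "\<phi> \<in> N" "\<epsilon> \<le> norm (\<phi> s - \<phi> x)" using neg[OF s] by blast
      define w where "w = e (\<phi> s) - e (\<phi> x)"
      have "\<epsilon> \<le> \<bar>Re w\<bar> + \<bar>Im w\<bar>"
        using \<phi>(2) cmod_le[of w] unfolding w_def e_diff[symmetric] norm_e by linarith
      then have "\<exists>\<theta>\<in>\<Theta>. \<epsilon> / 2 \<le> Re (\<theta> * w)" unfolding \<Theta>_def by (auto simp: abs_if split: if_splits)
      then obtain \<theta> where "\<theta> \<in> \<Theta>" "\<epsilon> / 2 \<le> Re (\<theta> * w)" by blast
      then show "\<exists>p\<in>I. 0 \<le> h p s - h p x - \<epsilon> / 2"
        using \<phi>(1) unfolding I_def h_def w_def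
        by (intro bexI[of _ "(\<phi>, \<theta>)"]) (auto simp: algebra_simps)
    qed
    then obtain l where l: "\<And>p. p \<in> I \<Longrightarrow> 0 \<le> l p" "sum l I = 1"
      and lA: "\<And>s. s \<in> convex hull A \<Longrightarrow> 0 \<le> (\<Sum>p\<in>I. l p * (h p s - h p x - \<epsilon> / 2))" by blast
    have "\<forall>p\<in>I. \<exists>y b. (\<forall>n. norm (y n) \<le> b) \<and> (\<forall>f\<in>dual smul. (\<lambda>n. blinfun_apply f (y n)) \<longlonglongrightarrow> fst p f)"
      using countable_closure_point_bounded_sequence[OF no] fstI by blast
    then obtain y where "\<forall>p\<in>I. \<exists>b. (\<forall>n. norm (y p n) \<le> b) \<and>
        (\<forall>f\<in>dual smul. (\<lambda>n. blinfun_apply f (y p n)) \<longlonglongrightarrow> fst p f)" by (rule bchoice[THEN exE])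
    then obtain b where yb: "\<forall>p\<in>I. (\<forall>n. norm (y p n) \<le> b p) \<and>
        (\<forall>f\<in>dual smul. (\<lambda>n. blinfun_apply f (y p n)) \<longlonglongrightarrow> fst p f)" by (rule bchoice[THEN exE])
    \<comment> \<open>\<open>Q\<close> is the real part of the separating combination of the elements of \<open>N\<close>, and \<open>q n\<close> approximates it.\<close>
    define q where "q n f = (\<Sum>p\<in>I. l p * Re (snd p * e (blinfun_apply f (y p n))))" for n f
    define Q where "Q f = (\<Sum>p\<in>I. l p * h p f)" for f
    define B where "B = (\<Sum>p\<in>I. l p * b p)"
    have norm_snd: "cmod (snd p) = 1" if "p \<in> I" for p using that unfolding I_def \<Theta>_def by auto
    have b0: "0 \<le> b p" if "p \<in> I" for p using yb that norm_ge_zero order.trans by blast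
    have B0: "0 \<le> B" unfolding B_def using l b0 by (intro sum_nonneg mult_nonneg_nonneg)
    have qlim: "(\<lambda>n. q n f) \<longlonglongrightarrow> Q f" if "f \<in> dual smul" for f
      unfolding q_def Q_def h_def using yb that
      by (intro tendsto_sum tendsto_mult_left tendsto_Re bounded_linear.tendsto[OF bounded_linear_e]) auto
    have qlin: "q n (a *\<^sub>R f + c *\<^sub>R g) = a * q n f + c * q n g" for n a c f g
      unfolding q_def sum_distrib_left sum.distrib[symmetric]
      by (intro sum.cong) (auto simp: blinfun.add_left blinfun.scaleR_left e_add e_scaleR algebra_simps)
    have q_dist: "\<bar>q n f - q n g\<bar> \<le> (\<Sum>p\<in>I. l p * norm (blinfun_apply f (y p n) - blinfun_apply g (y p n)))" for n f g
    proof -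
      have "q n f - q n g = (\<Sum>p\<in>I. l p * Re (snd p * e (blinfun_apply f (y p n) - blinfun_apply g (y p n))))"
        unfolding q_def sum_subtractf[symmetric] by (intro sum.cong) (auto simp: e_diff algebra_simps)
      also have "\<bar>\<dots>\<bar> \<le> (\<Sum>p\<in>I. l p * norm (blinfun_apply f (y p n) - blinfun_apply g (y p n)))"
      proof (intro order.trans[OF sum_abs] sum_mono)
        fix p assume p: "p \<in> I"
        show "\<bar>l p * Re (snd p * e (blinfun_apply f (y p n) - blinfun_apply g (y p n)))\<bar>
            \<le> l p * norm (blinfun_apply f (y p n) - blinfun_apply g (y p n))"
          using l(1)[OF p] abs_Re_le_cmod[of "snd p * e (blinfun_apply f (y p n) - blinfun_apply g (y p n))"]
          by (simp add: abs_mult norm_mult norm_snd[OF p] norm_e mult_left_mono)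
      qed
      finally show ?thesis .
    qed
    have q_lip: "\<bar>q n f - q n g\<bar> \<le> B * norm (f - g)" for n f g
    proof -
      have "(\<Sum>p\<in>I. l p * norm (blinfun_apply f (y p n) - blinfun_apply g (y p n)))
          \<le> (\<Sum>p\<in>I. l p * b p * norm (f - g))"
      proof (intro sum_mono)
        fix p assume p: "p \<in> I"
        have "norm (blinfun_apply f (y p n) - blinfun_apply g (y p n)) \<le> norm (f - g) * norm (y p n)"
          using norm_blinfun[of "f - g" "y p n"] by (simp add: blinfun.diff_left)
        also have "\<dots> \<le> norm (f - g) * b p" using yb p by (intro mult_left_mono) auto
        finally show "l p * norm (blinfun_apply f (y p n) - blinfun_apply g (y p n)) \<le> l p * b p * norm (f - g)"
          using l(1)[OF p] by (simp add: mult.assoc mult.commute[of "b p"] mult_left_mono)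
      qed
      then show ?thesis using q_dist[of n f g] unfolding B_def sum_distrib_right by linarith
    qed
    \<comment> \<open>Half way between \<open>Q x\<close> and the bound
      \<open>Q x + \<epsilon> / 2\<close> valid on \<open>A\<close>: strictness on \<open>A\<close>
      yields the cover, and the remaining \<open>\<epsilon> / 4\<close> exceeds the
      \<open>\<epsilon> / 8\<close> lost to the norm closure.\<close>
    define c where "c = Q x + \<epsilon> / 4"
    have QA: "c < Q s" if "s \<in> A" for s
    proof -
      have "(\<Sum>p\<in>I. l p * (h p s - h p x - \<epsilon> / 2)) = Q s - Q x - sum l I * (\<epsilon> / 2)"
        unfolding Q_def sum_distrib_right sum_subtractf[symmetric] by (intro sum.cong) (auto simp: algebra_simps)
      then show ?thesis using lA[OF hull_inc[OF that]] l(2) \<epsilon> unfolding c_def by simp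
    qed
    define G where "G n = {a \<in> A. \<forall>m\<ge>n. c \<le> q m a}" for n
    define W where "W n = {f. \<forall>m\<ge>n. c \<le> q m f}" for n
    have Wconv: "convex (W n)" for n
      unfolding W_def
    proof (rule convexI, safe)
      fix f g and s t :: real and m
      assume "\<forall>m\<ge>n. c \<le> q m f" "\<forall>m\<ge>n. c \<le> q m g" "0 \<le> s" "0 \<le> t" "s + t = 1" "n \<le> m"
      then have "s * c + t * c \<le> s * q m f + t * q m g" by (intro add_mono mult_left_mono) auto
      then show "c \<le> q m (s *\<^sub>R f + t *\<^sub>R g)"
        unfolding qlin using \<open>s + t = 1\<close> by (simp add: distrib_right[symmetric])
    qed
    have "A = (\<Union>n. G n)"
    proof -
      have "\<exists>n. \<forall>m\<ge>n. c \<le> q m a" if a: "a \<in> A" for a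
      proof -
        have "\<forall>\<^sub>F m in sequentially. c < q m a"
          using a A by (intro order_tendstoD(1)[OF qlim QA]) auto
        then show ?thesis unfolding eventually_sequentially by (meson less_imp_le)
      qed
      then show ?thesis unfolding G_def by blast
    qed
    then have xin: "x \<in> closure (convex hull (\<Union>n. weak_star_dual smul closure_of (convex hull (G n))))"
      by (rule xF)
    have sub: "weak_star_dual smul closure_of (convex hull (G n)) \<subseteq> W n" for n
    proof
      fix f assume f: "f \<in> weak_star_dual smul closure_of (convex hull (G n))"
      have hG: "convex hull (G n) \<subseteq> W n"
        using Wconv[of n] by (intro hull_minimal) (auto simp: G_def W_def)
      have "c \<le> q m f + \<delta>" if m: "n \<le> m" and \<delta>: "0 < \<delta>" for m \<delta>
      proof -
        obtain s where s: "s \<in> convex hull (G n)"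
          "\<forall>v\<in>(\<lambda>p. y p m) ` I. norm (blinfun_apply s v - blinfun_apply f v) < \<delta>"
          using f[unfolded weak_star_dual_closure, THEN conjunct2, rule_format, of "(\<lambda>p. y p m) ` I" \<delta>] I \<delta>
          by auto
        have "\<bar>q m s - q m f\<bar> \<le> (\<Sum>p\<in>I. l p * \<delta>)"
          using s(2) l(1) by (intro order.trans[OF q_dist] sum_mono mult_left_mono) (auto intro: less_imp_le)
        also have "\<dots> = \<delta>" using l(2) by (simp add: sum_distrib_right[symmetric])
        finally show ?thesis using hG s(1) m unfolding W_def by fastforce
      qed
      then show "f \<in> W n" unfolding W_def using field_le_epsilon by blast
    qed
    have Wmono: "W n \<subseteq> W n'" if "n \<le> n'" for n n' unfolding W_def using that by auto
    have "convex (\<Union>n. W n)"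
      unfolding convex_alt
    proof (intro ballI allI impI)
      fix f g and t :: real assume fg: "f \<in> (\<Union>n. W n)" "g \<in> (\<Union>n. W n)" and t: "0 \<le> t \<and> t \<le> 1"
      obtain n n' where "f \<in> W n" "g \<in> W n'" using fg by blast
      then have "f \<in> W (max n n')" "g \<in> W (max n n')"
        using Wmono[of n "max n n'"] Wmono[of n' "max n n'"] by auto
      then have "(1 - t) *\<^sub>R f + t *\<^sub>R g \<in> W (max n n')"
        using Wconv t by (intro convexD_alt) auto
      then show "(1 - t) *\<^sub>R f + t *\<^sub>R g \<in> (\<Union>n. W n)" by blast
    qed
    then have "convex hull (\<Union>n. weak_star_dual smul closure_of (convex hull (G n))) \<subseteq> (\<Union>n. W n)"
      using sub by (intro hull_minimal) blast+
    then have "x \<in> closure (\<Union>n. W n)" using xin closure_mono by blast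
    define \<delta> where "\<delta> = \<epsilon> / (8 * (B + 1))"
    have \<delta>: "0 < \<delta>" "B * \<delta> \<le> \<epsilon> / 8"
      unfolding \<delta>_def using \<epsilon> B0 by (auto simp: field_simps)
    obtain f n where f: "f \<in> W n" "dist f x < \<delta>"
      using \<open>x \<in> closure (\<Union>n. W n)\<close> \<delta>(1) unfolding closure_approachable by blast
    have "c - \<epsilon> / 8 \<le> q m x" if m: "n \<le> m" for m
    proof -
      have "B * norm (f - x) \<le> B * \<delta>" using f(2) B0 by (intro mult_left_mono) (auto simp: dist_norm)
      then show ?thesis using q_lip[of m f x] f(1) m \<delta>(2) unfolding W_def by fastforce
    qed
    then have "c - \<epsilon> / 8 \<le> Q x"
      using qlim[OF xd] by (intro LIMSEQ_le_const) auto
    then show False unfolding c_def using \<epsilon> by simp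
  qed
qed

text \<open>Intersecting the pieces with balls of integer radius makes the weak* closures of their
  hulls compact. For finitely many of them minimax leaves two cases: one vector of the unit ball
  separates them all from \<open>x\<close>, or a convex combination of points of the closures comes
  too near to \<open>x\<close> in norm. The margin \<open>\<eta>\<close> does not depend on the
  stage, so it survives at a cluster point.\<close>

lemma closure_subset_I_env:
  assumes no: "\<not> contains_ell1 smul" and A: "A \<subseteq> dual smul"
  shows "weak_topology (dual smul) (B1 smul) closure_of (convex hull A) \<subseteq> I_env smul A"
proof
  fix x assume x: "x \<in> weak_topology (dual smul) (B1 smul) closure_of (convex hull A)"
  have xd: "x \<in> dual smul" using x unfolding in_weak_topology_closure by (rule conjunct1)
  have "x \<in> closure (convex hull (\<Union>n. weak_star_dual smul closure_of (convex hull (G n))))"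
    if G: "A = (\<Union>n. G n)" for G :: "nat \<Rightarrow> ('a \<Rightarrow>\<^sub>L 'k) set"
  proof (rule ccontr)
    define V where "V = convex hull (\<Union>n. weak_star_dual smul closure_of (convex hull (G n)))"
    assume "x \<notin> closure (convex hull (\<Union>n. weak_star_dual smul closure_of (convex hull (G n))))"
    then obtain \<delta> where \<delta>: "0 < \<delta>" and "\<not> (\<exists>v\<in>V. dist v x < \<delta>)"
      unfolding closure_approachable V_def[symmetric] by blast
    then have far: "\<delta> \<le> norm (v - x)" if "v \<in> V" for v
      using that by (auto simp: dist_norm not_less)
    \<comment> \<open>A failure of separation yields a point of \<open>V\<close> whose real part
      differs from that of \<open>x\<close> by at most \<open>2 * \<eta>\<close> on the unit ball,
      so its norm distance from \<open>x\<close> is at most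
      \<open>4 * \<eta> = \<delta> / 2\<close>.\<close>
    define \<eta> where "\<eta> = \<delta> / 8"
    have \<eta>: "0 < \<eta>" unfolding \<eta>_def using \<delta> by simp
    define S where "S p = convex hull (G (fst p) \<inter> cball 0 (real (snd p)))" for p :: "nat \<times> nat"
    have Sd: "S p \<subseteq> dual smul" for p
      unfolding S_def using G A by (intro hull_minimal convex_dual) auto
    have Sn: "norm f \<le> real (snd p)" if "f \<in> S p" for f p
    proof -
      have "S p \<subseteq> cball 0 (real (snd p))" unfolding S_def by (intro hull_minimal convex_cball) simp
      then show ?thesis using that by auto
    qed
    define K where "K p = closure ((\<lambda>f. realpart (f - x)) ` S p)" for p
    have K: "compact (K p)" "pconvex (K p)" "K p \<subseteq> dual_ball (real (snd p) + norm x)" for p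
      using compact_shifted_closure[OF xd Sd _ Sn, of p] unfolding K_def by (simp_all add: S_def)
    have "\<exists>y. norm y \<le> 1 \<and> (\<forall>p\<in>{..n} \<times> {..n}. \<forall>f\<in>S p. realpart f y \<le> realpart x y - \<eta>)" for n
    proof (rule ccontr)
      assume neg: "\<not> ?thesis"
      define I where "I = {p \<in> {..n} \<times> {..n}. S p \<noteq> {}}"
      have I: "finite I" unfolding I_def by simp
      have alt: "\<exists>p\<in>I. \<exists>u\<in>K p. - \<eta> \<le> u y" if y: "y \<in> cball 0 1" for y
      proof -
        obtain p f where pf: "p \<in> {..n} \<times> {..n}" "f \<in> S p" "\<not> realpart f y \<le> realpart x y - \<eta>"
          using neg y by auto
        have "p \<in> I" unfolding I_def using pf by blast
        moreover have "realpart (f - x) \<in> K p"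
          unfolding K_def by (rule subsetD[OF closure_subset], rule imageI[OF pf(2)])
        moreover have "- \<eta> \<le> realpart (f - x) y" using pf(3) by (simp add: realpart_diff)
        ultimately show ?thesis by blast
      qed
      have Ine: "I \<noteq> {}" using alt[of 0] by auto
      have "\<exists>l w. (\<forall>p\<in>I. 0 \<le> l p \<and> w p \<in> K p) \<and> sum l I = 1 \<and>
          (\<forall>y\<in>cball 0 1. - \<eta> \<le> (\<Sum>p\<in>I. l p * (w p y - (- \<eta>))))"
      proof (rule minimax_alternative[OF I Ine convex_cball])
        show "K p \<noteq> {}" if "p \<in> I" for p using that unfolding K_def I_def by auto
        show "linear u" if "u \<in> K p" for p u using that K(3) unfolding dual_ball_def by blast
        show "\<exists>p\<in>I. \<exists>u\<in>K p. - \<eta> \<le> u y" if "y \<in> cball 0 1" for y by (rule alt[OF that])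
      qed (simp_all add: K \<eta>)
      then obtain l w where l: "\<And>p. p \<in> I \<Longrightarrow> 0 \<le> l p" "sum l I = 1" and w: "\<And>p. p \<in> I \<Longrightarrow> w p \<in> K p"
        and ge: "\<And>y. y \<in> cball 0 1 \<Longrightarrow> - \<eta> \<le> (\<Sum>p\<in>I. l p * (w p y - (- \<eta>)))" by blast
      have bl: "bounded_linear (w p)" if "p \<in> I" for p
        using w[OF that] K(3) dual_ball_bounded_linear by blast
      define g where "g = (\<Sum>p\<in>I. l p *\<^sub>R lift (w p))"
      have g: "g \<in> dual smul"
        unfolding g_def by (intro real_vector.subspace_sum[OF subspace_dual] dual_scaleR lift(1) bl)
      have "g + x = (\<Sum>p\<in>I. l p *\<^sub>R (lift (w p) + x))"
        unfolding g_def using l(2) by (simp add: scaleR_add_right sum.distrib scaleR_sum_left[symmetric])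
      also have "\<dots> \<in> V"
      proof (rule convex_sum[OF I])
        show "convex V" unfolding V_def by (rule convex_convex_hull)
        fix p assume p: "p \<in> I"
        have "lift (w p) + x \<in> weak_star_dual smul closure_of (S p)"
          using lift_add_mem_closure[OF xd Sd _ bl[OF p]] w[OF p] unfolding K_def by blast
        also have "\<dots> \<subseteq> weak_star_dual smul closure_of (convex hull (G (fst p)))"
          unfolding S_def by (intro closure_of_mono hull_mono) blast
        finally show "lift (w p) + x \<in> V" unfolding V_def by (intro hull_inc) blast
      qed (use l in auto)
      finally have "\<delta> \<le> norm g" using far by fastforce
      have rg: "realpart g y = (\<Sum>p\<in>I. l p * w p y)" for y
        unfolding g_def realpart_sum realpart_scaleR using bl lift(2) by (intro sum.cong) auto
      \<comment> \<open>One \<open>\<eta>\<close> is the separation level, the other the minimax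
        error. Applied to a vector and its negative, this one-sided bound controls the norm.\<close>
      have low: "- (2 * \<eta>) \<le> realpart g y" if y: "norm y \<le> 1" for y
      proof -
        have "(\<Sum>p\<in>I. l p * (w p y - (- \<eta>))) = realpart g y + sum l I * \<eta>"
          unfolding rg sum_distrib_right sum.distrib[symmetric] by (intro sum.cong) (auto simp: algebra_simps)
        then show ?thesis using ge[of y] y l(2) by simp
      qed
      have lin: "linear (realpart g)" using bounded_linear_realpart by (rule bounded_linear.linear)
      have "\<bar>realpart g y\<bar> \<le> 2 * \<eta> * norm y" for y
      proof (cases "y = 0")
        case True
        then show ?thesis using lin by (simp add: linear_0)
      next
        case False
        define z where "z = (1 / norm y) *\<^sub>R y"
        have z: "norm z \<le> 1" "norm (- z) \<le> 1" "y = norm y *\<^sub>R z" unfolding z_def using False by auto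
        have "\<bar>realpart g z\<bar> \<le> 2 * \<eta>"
          using low[OF z(1)] low[OF z(2)] lin by (simp add: linear_neg abs_le_iff)
        moreover have "realpart g y = norm y * realpart g z"
          using lin z(3) by (metis linear_scale real_scaleR_def)
        ultimately show ?thesis
          by (simp add: abs_mult mult.commute[of "norm y"] mult_right_mono)
      qed
      then have "norm g \<le> 2 * (2 * \<eta>)" using g \<eta> by (intro norm_dual_le) auto
      then show False using \<open>\<delta> \<le> norm g\<close> \<delta> unfolding \<eta>_def by simp
    qed
    then obtain y where y: "\<And>n. norm (y n) \<le> 1"
      and yS: "\<And>n p f. p \<in> {..n} \<times> {..n} \<Longrightarrow> f \<in> S p \<Longrightarrow> realpart f (y n) \<le> realpart x (y n) - \<eta>"
      by metis
    obtain F where F: "F \<in> countable_closure_points smul"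
      and FN: "\<forall>N n. \<forall>\<epsilon>>0. finite N \<longrightarrow> N \<subseteq> dual smul \<longrightarrow>
        (\<exists>m\<ge>n. \<forall>f\<in>N. norm (blinfun_apply f (y m) - F f) < \<epsilon>)"
      by (rule bexE[OF bounded_sequence_cluster_point[OF y]])
    note Fn = FN[rule_format]
    have Fb: "F \<in> bidual smul" using F unfolding countable_closure_points_def by blast
    have FA: "Re (e (F a)) \<le> Re (e (F x)) - \<eta>" if a: "a \<in> A" for a
    proof -
      have ad: "a \<in> dual smul" using a A by blast
      obtain i where i: "a \<in> G i" using a G by blast
      obtain k where k: "norm a \<le> real k" using real_arch_simple by blast
      \<comment> \<open>The index records both the piece and the radius, so \<open>a\<close> takes
        part in the separation from stage \<open>max i k\<close> on.\<close>
      have aS: "a \<in> S (i, k)" unfolding S_def using i k by (intro hull_inc) simp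
      have "Re (e (F a)) \<le> Re (e (F x)) - \<eta> + \<epsilon>" if \<epsilon>: "0 < \<epsilon>" for \<epsilon>
      proof -
        obtain m where m: "max i k \<le> m" "\<forall>f\<in>{a, x}. norm (blinfun_apply f (y m) - F f) < \<epsilon> / 2"
          using Fn[of "\<epsilon> / 2" "{a, x}" "max i k"] \<epsilon> ad xd by fastforce
        have d: "\<bar>realpart f (y m) - Re (e (F f))\<bar> < \<epsilon> / 2" if "f \<in> {a, x}" for f
          using m(2) that abs_Re_le_cmod[of "e (blinfun_apply f (y m) - F f)"]
          unfolding norm_e realpart_def by (fastforce simp: e_diff)
        have "realpart a (y m) \<le> realpart x (y m) - \<eta>"
          by (rule yS[OF _ aS]) (use m(1) in auto)
        moreover have "\<bar>realpart a (y m) - Re (e (F a))\<bar> < \<epsilon> / 2"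
          "\<bar>realpart x (y m) - Re (e (F x))\<bar> < \<epsilon> / 2"
          by (simp_all only: d insert_iff simp_thms)
        ultimately show ?thesis by linarith
      qed
      then show ?thesis by (rule field_le_epsilon)
    qed
    define W where "W = {f \<in> dual smul. Re (e (F f)) \<le> Re (e (F x)) - \<eta>}"
    have "convex W"
    proof (rule convexI)
      fix f g and s t :: real assume f: "f \<in> W" and g: "g \<in> W" and st: "0 \<le> s" "0 \<le> t" "s + t = 1"
      have fg: "f \<in> dual smul" "g \<in> dual smul" using f g unfolding W_def by auto
      have "s * Re (e (F f)) + t * Re (e (F g)) \<le> s * (Re (e (F x)) - \<eta>) + t * (Re (e (F x)) - \<eta>)"
        using f g st unfolding W_def by (intro add_mono mult_left_mono) auto
      also have "\<dots> = Re (e (F x)) - \<eta>" using st by (simp add: distrib_right[symmetric])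
      finally show "s *\<^sub>R f + t *\<^sub>R g \<in> W"
        unfolding W_def using fg Fb by (simp add: dual_add dual_scaleR bidual_add bidual_scaleR e_add e_scaleR)
    qed
    then have hull: "convex hull A \<subseteq> W"
      using FA A by (intro hull_minimal) (auto simp: W_def)
    have "F \<in> B1 smul" using F B1_eq_countable_closure_points[OF no] by simp
    then have "\<exists>s\<in>convex hull A \<inter> dual smul. \<forall>z\<in>{F}. dist (z s) (z x) < \<eta>"
      by (intro x[unfolded in_weak_topology_closure, THEN conjunct2, rule_format]) (auto simp: \<eta>)
    then obtain s where s: "s \<in> convex hull A" "norm (F s - F x) < \<eta>" by (auto simp: dist_norm)
    have "\<bar>Re (e (F s)) - Re (e (F x))\<bar> < \<eta>"
      using s(2) abs_Re_le_cmod[of "e (F s - F x)"] unfolding norm_e by (simp add: e_diff)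
    moreover have "Re (e (F s)) \<le> Re (e (F x)) - \<eta>" using s(1) hull unfolding W_def by blast
    ultimately show False by linarith
  qed
  then show "x \<in> I_env smul A" unfolding I_env_def by blast
qed

end

theorem theorem3p3:
  fixes smul :: "'k::real_or_complex \<Rightarrow> 'a::banach \<Rightarrow> 'a"
  assumes "banach_space_over smul"
    and "\<not> contains_ell1 smul"
  shows "B1 smul = countable_closure_points smul \<and>
    (\<forall>A. A \<subseteq> dual smul \<longrightarrow>
      I_env smul A = weak_topology (dual smul) (B1 smul) closure_of (convex hull A))"
proof -
  obtain e :: "'k \<Rightarrow> complex" and j where ej:
    "(\<forall>x y. e (x + y) = e x + e y) \<and> (\<forall>x y. e (x * y) = e x * e y) \<and>
    (\<forall>r x. e (r *\<^sub>R x) = r *\<^sub>R e x) \<and> (\<forall>x. cmod (e x) = norm x) \<and>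
    (j = 0 \<and> range e = \<real> \<or> e j = \<i> \<and> surj e)"
    using scalar_embedding by blast
  interpret embedded_banach_space smul e j
    by (intro embedded_banach_space.intro assms(1) embedded_banach_space_axioms.intro) (use ej in auto)
  show ?thesis
    using B1_eq_countable_closure_points[OF assms(2)] I_env_subset_closure[OF assms(2)]
      closure_subset_I_env[OF assms(2)] by (meson subset_antisym)
qed

end
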